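(* Let $\mathfrak{M}$ be a type II$_1$ factor with faithful normal tracial state $\tau$, and let $\mathcal{A}$ be a MASA in $\mathfrak{M}$ with corresponding normal conditional expectation $E_{\mathcal{A}}:\mathfrak{M}\to\mathcal{A}$. Let $N\in\mathfrak{M}$ be a normal operator such that $\sigma(N)$ consists of precisely three points, and these points are non-collinear. Then \[ \overline{\mathcal{D}_{\mathcal{A}}(N)}^{\|\cdot\|}=\{A\in\mathcal{A}\mid \tau(A)=\tau(N),\ \sigma(A)\subseteq\overline{\operatorname{conv}}(\sigma(N))\}. \]
   Context: A MASA is a maximal abelian self-adjoint subalgebra. For $T\in\mathfrak{M}$, $\mathcal{D}_{\mathcal{A}}(T):=\{E_{\mathcal{A}}(U^*TU)\mid U\in\mathfrak{M}\text{ unitary}\}$, and $\overline{\,\cdot\,}^{\|\cdot\|}$ denotes norm closure. The normal conditional expectation onto $\mathcal{A}$ is the trace-preserving one. $\sigma$ denotes spectrum and $\overline{\operatorname{conv}}$ the closed convex hull in $\mathbb{C}$. *)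

theory Defs
  imports "HOL-Analysis.Analysis"
begin

section \<open>Complex Hilbert spaces\<close>

class scaleC =
  fixes scaleC :: "complex \<Rightarrow> 'a \<Rightarrow> 'a"  (infixr \<open>*\<^sub>C\<close> 75)

text \<open>The inner product is linear in the first argument. Positive definiteness is contained
  in the last axiom, because the norm is a norm; completeness comes from the superclass.\<close>

class complex_hilbert = banach + scaleC +
  fixes cinner :: "'a \<Rightarrow> 'a \<Rightarrow> complex"
  assumes scaleC_add_right: "c *\<^sub>C (x + y) = c *\<^sub>C x + c *\<^sub>C y"
    and scaleC_add_left: "(c + d) *\<^sub>C x = c *\<^sub>C x + d *\<^sub>C x"
    and scaleC_scaleC: "c *\<^sub>C d *\<^sub>C x = (c * d) *\<^sub>C x"
    and scaleC_of_real: "complex_of_real r *\<^sub>C x = r *\<^sub>R x"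
    and cinner_add_left: "cinner (x + y) z = cinner x z + cinner y z"
    and cinner_scaleC_left: "cinner (c *\<^sub>C x) y = c * cinner x y"
    and cinner_commute: "cinner y x = cnj (cinner x y)"
    and cinner_self: "cinner x x = complex_of_real ((norm x)\<^sup>2)"

instantiation complex :: complex_hilbert
begin

definition scaleC_complex :: "complex \<Rightarrow> complex \<Rightarrow> complex" where
  "scaleC_complex c x = c * x"

definition cinner_complex :: "complex \<Rightarrow> complex \<Rightarrow> complex" where
  "cinner_complex x y = x * cnj y"

instance
proof
  show "cinner x x = complex_of_real ((norm x)\<^sup>2)" for x :: complex
    unfolding cinner_complex_def by (rule complex_norm_square [symmetric])
qed (simp_all add: scaleC_complex_def cinner_complex_def algebra_simps scaleR_conv_of_real)

end

lemma cinner_add_right: "cinner x (y + z) = cinner x y + cinner x (z :: 'a :: complex_hilbert)"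
  by (simp add: cinner_commute [of x] cinner_add_left)

lemma cinner_scaleC_right: "cinner x (c *\<^sub>C y) = cnj c * cinner x (y :: 'a :: complex_hilbert)"
  by (simp add: cinner_commute [of x] cinner_scaleC_left)

lemma cinner_scaleR_left: "cinner (r *\<^sub>R x) y = of_real r * cinner x (y :: 'a :: complex_hilbert)"
  by (simp add: scaleC_of_real [symmetric] cinner_scaleC_left)

lemma cinner_scaleR_right: "cinner x (r *\<^sub>R y) = of_real r * cinner x (y :: 'a :: complex_hilbert)"
  by (simp add: scaleC_of_real [symmetric] cinner_scaleC_right)

lemma cinner_diff_left: "cinner (x - y) z = cinner x z - cinner y (z :: 'a :: complex_hilbert)"
  using cinner_add_left [of "x - y" y z] by simp

lemma cinner_diff_right: "cinner x (y - z) = cinner x y - cinner x (z :: 'a :: complex_hilbert)"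
  using cinner_add_right [of x "y - z" z] by simp

lemma power2_norm_cinner: "(norm x)\<^sup>2 = Re (cinner x (x :: 'a :: complex_hilbert))"
  by (simp add: cinner_self)

lemma Re_cinner_commute: "Re (cinner x y) = Re (cinner y (x :: 'a :: complex_hilbert))"
  by (subst cinner_commute) simp

lemma norm_scaleC: "norm (c *\<^sub>C x) = norm c * norm (x :: 'a :: complex_hilbert)"
proof -
  have "complex_of_real ((norm (c *\<^sub>C x))\<^sup>2) = cinner (c *\<^sub>C x) (c *\<^sub>C x)"
    by (rule cinner_self [symmetric])
  also have "\<dots> = (c * cnj c) * cinner x x"
    by (simp add: cinner_scaleC_left cinner_scaleC_right)
  also have "\<dots> = complex_of_real ((norm c * norm x)\<^sup>2)"
    by (simp add: cinner_self complex_norm_square [symmetric] power_mult_distrib del: complex_cnj_mult)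
  finally have "(norm (c *\<^sub>C x))\<^sup>2 = (norm c * norm x)\<^sup>2"
    using of_real_eq_iff by blast
  then show ?thesis
    by (simp add: power2_eq_iff_nonneg)
qed

lemma Re_cinner_le: "Re (cinner x y) \<le> norm x * norm (y :: 'a :: complex_hilbert)"
proof -
  have "(norm (x + y))\<^sup>2 \<le> (norm x + norm y)\<^sup>2"
    by (simp add: norm_triangle_ineq power_mono)
  moreover have "(norm (x + y))\<^sup>2 = (norm x)\<^sup>2 + (norm y)\<^sup>2 + 2 * Re (cinner x y)"
    using Re_cinner_commute[of x y]
    by (simp add: power2_norm_cinner cinner_add_left cinner_add_right)
  ultimately show ?thesis
    by (simp add: power2_sum)
qed

lemma cinner_eqI:
  assumes "\<And>x. cinner x y = cinner x z"
  shows "y = (z :: 'a :: complex_hilbert)"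
proof -
  have "cinner (y - z) (y - z) = 0"
    by (simp only: assms cinner_diff_right diff_self)
  then show ?thesis
    by (simp add: cinner_self)
qed


section \<open>Bounded operators\<close>

text \<open>Operators live in the library type of bounded real-linear maps, which supplies the
  operator norm, composition and the identity; \<open>cbounded\<close> singles out the complex-linear
  ones, i.e. \<open>B(H)\<close>.\<close>

instantiation blinfun :: (real_normed_vector, complex_hilbert) scaleC
begin

lift_definition scaleC_blinfun :: "complex \<Rightarrow> ('a \<Rightarrow>\<^sub>L 'b) \<Rightarrow> ('a \<Rightarrow>\<^sub>L 'b)"
  is "\<lambda>c T x. c *\<^sub>C T x"
proof -
  fix c :: complex and T :: "'a \<Rightarrow> 'b"
  assume T: "bounded_linear T"
  have "c *\<^sub>C r *\<^sub>R y = r *\<^sub>R c *\<^sub>C y" for r and y :: 'b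
    by (metis mult.commute scaleC_of_real scaleC_scaleC)
  moreover obtain K where "\<And>x. norm (T x) \<le> norm x * K"
    using T bounded_linear.bounded by blast
  then have "norm (c *\<^sub>C T x) \<le> norm x * (norm c * K)" for x
    by (simp add: norm_scaleC mult_left_mono mult.left_commute[of "norm x"])
  ultimately show "bounded_linear (\<lambda>x. c *\<^sub>C T x)"
    using T
    by (intro bounded_linear_intro[where K = "norm c * K"])
      (simp_all add: linear_simps scaleC_add_right)
qed

instance ..

end

definition cbounded :: "('h :: complex_hilbert \<Rightarrow>\<^sub>L 'h) set" where
  "cbounded = {T :: 'h \<Rightarrow>\<^sub>L 'h. \<forall>c x. T (c *\<^sub>C x) = c *\<^sub>C T x}"

definition adj :: "('h :: complex_hilbert \<Rightarrow>\<^sub>L 'h) \<Rightarrow> ('h \<Rightarrow>\<^sub>L 'h)" where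
  "adj T = (THE S. S \<in> cbounded \<and> (\<forall>x y. cinner (T x) y = cinner x (S y)))"

lemma riesz_real:
  fixes f :: "'h :: complex_hilbert \<Rightarrow> real"
  assumes f: "bounded_linear f"
  shows "\<exists>z. \<forall>v. f v = Re (cinner v z)"
proof -
  interpret f: bounded_linear f by fact
  define Q where "Q x = (norm x)\<^sup>2 - 2 * f x" for x
  obtain K where K: "\<And>x. norm (f x) \<le> norm x * K"
    using f.bounded by blast
  have below: "- K\<^sup>2 \<le> Q x" for x
  proof -
    have "f x \<le> norm x * K" using K[of x] by simp
    moreover have "0 \<le> (norm x - K)\<^sup>2" by simp
    ultimately show ?thesis by (simp add: Q_def power2_diff)
  qed
  define m where "m = (INF x. Q x)"
  have bdd: "bdd_below (range Q)"
    using below by (intro bdd_belowI) auto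
  have m_le: "m \<le> Q x" for x
    unfolding m_def using bdd by (intro cINF_lower) auto
  have "\<exists>x. Q x < m + 1 / Suc n" for n
  proof -
    have "Inf (range Q) < m + 1 / Suc n" by (simp add: m_def)
    then show ?thesis using cINF_less_iff[OF _ bdd] by auto
  qed
  then obtain X where X: "\<And>n. Q (X n) < m + 1 / Suc n" by metis
  have par: "(norm (x - y))\<^sup>2 \<le> 2 * (Q x - m) + 2 * (Q y - m)" for x y
  proof -
    have "(norm (x - y))\<^sup>2 = 2 * Q x + 2 * Q y - 4 * Q ((1/2) *\<^sub>R (x + y))"
      by (simp add: Q_def f.scaleR f.add power2_norm_cinner cinner_diff_left cinner_diff_right
          cinner_add_left cinner_add_right cinner_scaleR_left cinner_scaleR_right
          algebra_simps Re_cinner_commute[of x y] del: norm_scaleR)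
    then show ?thesis using m_le[of "(1/2) *\<^sub>R (x + y)"] by simp
  qed
  have "Cauchy X"
  proof (rule metric_CauchyI)
    fix e :: real assume e: "0 < e"
    then obtain M where M: "1 / Suc M < e\<^sup>2 / 4"
      using nat_approx_posE[of "e\<^sup>2 / 4"] by auto
    have "dist (X i) (X j) < e" if "M \<le> i" "M \<le> j" for i j
    proof -
      have "1 / Suc i \<le> 1 / Suc M" "1 / Suc j \<le> 1 / Suc M"
        using that by (auto simp: field_simps)
      then have "(norm (X i - X j))\<^sup>2 < e\<^sup>2"
        using par[of "X i" "X j"] X[of i] X[of j] M by argo
      then show ?thesis
        using e by (simp add: dist_norm power_less_imp_less_base)
    qed
    then show "\<exists>M. \<forall>i\<ge>M. \<forall>j\<ge>M. dist (X i) (X j) < e" by blast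
  qed
  then obtain z where z: "X \<longlonglongrightarrow> z"
    using Cauchy_convergent_iff convergent_def by blast
  have "(\<lambda>n. Q (X n)) \<longlonglongrightarrow> Q z"
    unfolding Q_def by (intro tendsto_intros f.tendsto z)
  moreover have "(\<lambda>n. m + 1 / Suc n) \<longlonglongrightarrow> m + 0"
    by (intro tendsto_intros LIMSEQ_Suc lim_1_over_n)
  ultimately have "Q z \<le> m + 0"
    using X by (intro LIMSEQ_le[of "\<lambda>n. Q (X n)" _ "\<lambda>n. m + 1 / Suc n"]) (auto intro: less_imp_le)
  then have min: "Q z \<le> Q x" for x using m_le[of x] by simp
  have "f v = Re (cinner v z)" for v
  proof -
    define d where "d = Re (cinner v z) - f v"
    have quad: "0 \<le> 2 * t * d + t\<^sup>2 * (norm v)\<^sup>2" for t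
    proof -
      have "(norm (z + t *\<^sub>R v))\<^sup>2 = (norm z)\<^sup>2 + 2 * t * Re (cinner v z) + t\<^sup>2 * (norm v)\<^sup>2"
        unfolding power2_norm_cinner
        by (simp add: cinner_add_left cinner_add_right cinner_scaleR_left cinner_scaleR_right
            Re_cinner_commute[of z v] algebra_simps power2_eq_square)
      then show ?thesis
        using min[of "z + t *\<^sub>R v"] by (simp add: Q_def d_def f.scaleR f.add algebra_simps)
    qed
    have "d = 0"
    proof (cases "v = 0")
      case True
      then show ?thesis using quad[of 1] quad[of "-1"] by simp
    next
      case False
      define t where "t = - d / (norm v)\<^sup>2"
      have d: "d = - t * (norm v)\<^sup>2" using False by (simp add: t_def)
      have "0 \<le> - (t\<^sup>2 * (norm v)\<^sup>2)"
        using quad[of t] by (simp add: d power2_eq_square ac_simps)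
      then have "t = 0" using False by (simp add: mult_le_0_iff)
      then show ?thesis using d by simp
    qed
    then show ?thesis by (simp add: d_def)
  qed
  then show ?thesis by blast
qed

lemma adjoint_exists:
  fixes T :: "'h :: complex_hilbert \<Rightarrow>\<^sub>L 'h"
  assumes T: "T \<in> cbounded"
  shows "\<exists>!S. S \<in> cbounded \<and> (\<forall>x y. cinner (T x) y = cinner x (S y))"
proof -
  have "\<exists>z. \<forall>x. cinner (T x) y = cinner x z" for y
  proof -
    have "Re (cinner (T x) y) \<le> norm x * (norm T * norm y)" for x
      using Re_cinner_le[of "T x" y] mult_right_mono[OF norm_blinfun[of T x], of "norm y"]
      by (simp add: ac_simps)
    moreover have "- Re (cinner (T x) y) \<le> norm x * (norm T * norm y)" for x
      using calculation[of "- x"] cinner_scaleR_left[of "-1" "T x" y]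
      by (simp add: blinfun.minus_right)
    ultimately have "bounded_linear (\<lambda>x. Re (cinner (T x) y))"
      by (intro bounded_linear_intro[where K = "norm T * norm y"])
        (auto simp: blinfun.add_right blinfun.scaleR_right cinner_add_left cinner_scaleR_left
          abs_le_iff)
    then obtain z where z: "\<And>x. Re (cinner (T x) y) = Re (cinner x z)"
      using riesz_real by blast
    have "Im (cinner (T x) y) = Im (cinner x z)" for x
      using z[of "\<i> *\<^sub>C x"] T by (simp add: cbounded_def cinner_scaleC_left)
    then show ?thesis using z complex_eqI by blast
  qed
  then obtain S where S: "\<And>x y. cinner (T x) y = cinner x (S y)" by metis
  have lin: "S (y + z) = S y + S z" "S (c *\<^sub>C y) = c *\<^sub>C S y" for y z c
    by (rule cinner_eqI; simp add: S [symmetric] cinner_add_right cinner_scaleC_right)+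
  have "norm (S y) \<le> norm y * norm T" for y
  proof -
    have "(norm (S y))\<^sup>2 = Re (cinner (T (S y)) y)"
      by (simp add: power2_norm_cinner S)
    also have "\<dots> \<le> norm (T (S y)) * norm y" by (rule Re_cinner_le)
    also have "\<dots> \<le> (norm T * norm (S y)) * norm y"
      by (intro mult_right_mono norm_blinfun) auto
    finally show ?thesis
      by (cases "S y = 0") (auto simp: power2_eq_square ac_simps)
  qed
  then have "bounded_linear S"
    using lin by (intro bounded_linear_intro[where K = "norm T"]) (auto simp: scaleC_of_real [symmetric])
  then have "Blinfun S \<in> cbounded \<and> (\<forall>x y. cinner (T x) y = cinner x (Blinfun S y))"
    by (simp add: cbounded_def bounded_linear_Blinfun_apply lin S)
  moreover have "A = B" if A: "\<forall>x y. cinner (T x) y = cinner x (blinfun_apply A y)"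
    and B: "\<forall>x y. cinner (T x) y = cinner x (blinfun_apply B y)" for A B
  proof (rule blinfun_eqI, rule cinner_eqI)
    show "cinner x (A y) = cinner x (B y)" for x y
      using A[rule_format, of x y] B[rule_format, of x y] by simp
  qed
  ultimately show ?thesis
    by (intro ex1I[of _ "Blinfun S"]) blast+
qed

lemma
  assumes "T \<in> cbounded"
  shows adj_cbounded: "adj T \<in> cbounded"
    and cinner_adj: "cinner (blinfun_apply T x) y = cinner x (blinfun_apply (adj T) y)"
proof -
  have "adj T \<in> cbounded \<and> (\<forall>x y. cinner (blinfun_apply T x) y = cinner x (blinfun_apply (adj T) y))"
    unfolding adj_def by (rule theI' [OF adjoint_exists [OF assms]])
  then show "adj T \<in> cbounded" "cinner (blinfun_apply T x) y = cinner x (blinfun_apply (adj T) y)"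
    by blast+
qed

definition positive_op :: "('h :: complex_hilbert \<Rightarrow>\<^sub>L 'h) \<Rightarrow> bool" where
  "positive_op T \<longleftrightarrow> T \<in> cbounded \<and> (\<forall>x. cinner (T x) x \<in> \<real>\<^sub>\<ge>\<^sub>0)"

definition op_le :: "('h :: complex_hilbert \<Rightarrow>\<^sub>L 'h) \<Rightarrow> ('h \<Rightarrow>\<^sub>L 'h) \<Rightarrow> bool" where
  "op_le S T \<longleftrightarrow> positive_op (T - S)"

definition spectrum :: "('h :: complex_hilbert \<Rightarrow>\<^sub>L 'h) \<Rightarrow> complex set" where
  "spectrum T = {z. \<not> (\<exists>S\<in>cbounded.
     S o\<^sub>L (T - z *\<^sub>C id_blinfun) = id_blinfun \<and> (T - z *\<^sub>C id_blinfun) o\<^sub>L S = id_blinfun)}"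

definition normal_op :: "('h :: complex_hilbert \<Rightarrow>\<^sub>L 'h) \<Rightarrow> bool" where
  "normal_op T \<longleftrightarrow> adj T o\<^sub>L T = T o\<^sub>L adj T"

definition unitary_op :: "('h :: complex_hilbert \<Rightarrow>\<^sub>L 'h) \<Rightarrow> bool" where
  "unitary_op U \<longleftrightarrow> adj U o\<^sub>L U = id_blinfun \<and> U o\<^sub>L adj U = id_blinfun"

definition projection_op :: "('h :: complex_hilbert \<Rightarrow>\<^sub>L 'h) \<Rightarrow> bool" where
  "projection_op P \<longleftrightarrow> adj P = P \<and> P o\<^sub>L P = P"


section \<open>Von Neumann algebras and type \<open>II\<^sub>1\<close> factors\<close>

definition commutant :: "('h :: complex_hilbert \<Rightarrow>\<^sub>L 'h) set \<Rightarrow> ('h \<Rightarrow>\<^sub>L 'h) set" where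
  "commutant S = {T \<in> cbounded. \<forall>X\<in>S. T o\<^sub>L X = X o\<^sub>L T}"

definition von_neumann_algebra :: "('h :: complex_hilbert \<Rightarrow>\<^sub>L 'h) set \<Rightarrow> bool" where
  "von_neumann_algebra M \<longleftrightarrow>
     M \<subseteq> cbounded \<and> (\<forall>T\<in>M. adj T \<in> M) \<and> commutant (commutant M) = M"

definition factor :: "('h :: complex_hilbert \<Rightarrow>\<^sub>L 'h) set \<Rightarrow> bool" where
  "factor M \<longleftrightarrow> von_neumann_algebra M \<and> (id_blinfun :: 'h \<Rightarrow>\<^sub>L 'h) \<noteq> 0 \<and>
     M \<inter> commutant M = range (\<lambda>c. c *\<^sub>C id_blinfun)"

definition finite_algebra :: "('h :: complex_hilbert \<Rightarrow>\<^sub>L 'h) set \<Rightarrow> bool" where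
  "finite_algebra M \<longleftrightarrow>
     (\<forall>V\<in>M. adj V o\<^sub>L V = id_blinfun \<longrightarrow> V o\<^sub>L adj V = id_blinfun)"

definition abelian_projection ::
  "('h :: complex_hilbert \<Rightarrow>\<^sub>L 'h) set \<Rightarrow> ('h \<Rightarrow>\<^sub>L 'h) \<Rightarrow> bool" where
  "abelian_projection M P \<longleftrightarrow> P \<in> M \<and> projection_op P \<and>
     (\<forall>X\<in>M. \<forall>Y\<in>M. (P o\<^sub>L X o\<^sub>L P) o\<^sub>L (P o\<^sub>L Y o\<^sub>L P) = (P o\<^sub>L Y o\<^sub>L P) o\<^sub>L (P o\<^sub>L X o\<^sub>L P))"

text \<open>Type \<open>II\<^sub>1\<close> means: finite, with no nonzero abelian projection.\<close>

definition type_II1_factor :: "('h :: complex_hilbert \<Rightarrow>\<^sub>L 'h) set \<Rightarrow> bool" where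
  "type_II1_factor M \<longleftrightarrow> factor M \<and> finite_algebra M \<and> (\<forall>P. abelian_projection M P \<longrightarrow> P = 0)"

definition abelian_star_subalgebra ::
  "('h :: complex_hilbert \<Rightarrow>\<^sub>L 'h) set \<Rightarrow> ('h \<Rightarrow>\<^sub>L 'h) set \<Rightarrow> bool" where
  "abelian_star_subalgebra M B \<longleftrightarrow> B \<subseteq> M \<and> 0 \<in> B \<and>
     (\<forall>X\<in>B. \<forall>Y\<in>B. X + Y \<in> B \<and> X o\<^sub>L Y \<in> B \<and> X o\<^sub>L Y = Y o\<^sub>L X) \<and>
     (\<forall>X\<in>B. adj X \<in> B \<and> (\<forall>c. c *\<^sub>C X \<in> B))"

definition masa :: "('h :: complex_hilbert \<Rightarrow>\<^sub>L 'h) set \<Rightarrow> ('h \<Rightarrow>\<^sub>L 'h) set \<Rightarrow> bool" where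
  "masa M A \<longleftrightarrow> abelian_star_subalgebra M A \<and>
     (\<forall>B. abelian_star_subalgebra M B \<and> A \<subseteq> B \<longrightarrow> B = A)"


section \<open>Traces and conditional expectations\<close>

definition complex_linear_on ::
  "('a :: {plus, scaleC}) set \<Rightarrow> ('a \<Rightarrow> 'b :: {plus, scaleC}) \<Rightarrow> bool" where
  "complex_linear_on M \<phi> \<longleftrightarrow> (\<forall>X\<in>M. \<forall>Y\<in>M. \<phi> (X + Y) = \<phi> X + \<phi> Y) \<and>
     (\<forall>c. \<forall>X\<in>M. \<phi> (c *\<^sub>C X) = c *\<^sub>C \<phi> X)"

text \<open>Normality is preservation of suprema of increasing nets of self-adjoint elements.
  A net only enters through its range, so upward directed sets are used instead.\<close>

definition directed_sa ::
  "('h :: complex_hilbert \<Rightarrow>\<^sub>L 'h) set \<Rightarrow> ('h \<Rightarrow>\<^sub>L 'h) set \<Rightarrow> bool" where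
  "directed_sa M S \<longleftrightarrow> S \<noteq> {} \<and> S \<subseteq> M \<and> (\<forall>X\<in>S. adj X = X) \<and>
     (\<forall>X\<in>S. \<forall>Y\<in>S. \<exists>Z\<in>S. op_le X Z \<and> op_le Y Z)"

definition op_lub ::
  "('h :: complex_hilbert \<Rightarrow>\<^sub>L 'h) set \<Rightarrow> ('h \<Rightarrow>\<^sub>L 'h) set \<Rightarrow> ('h \<Rightarrow>\<^sub>L 'h) \<Rightarrow> bool" where
  "op_lub M S T \<longleftrightarrow> T \<in> M \<and> (\<forall>X\<in>S. op_le X T) \<and>
     (\<forall>R\<in>M. (\<forall>X\<in>S. op_le X R) \<longrightarrow> op_le T R)"

definition state_on ::
  "('h :: complex_hilbert \<Rightarrow>\<^sub>L 'h) set \<Rightarrow> (('h \<Rightarrow>\<^sub>L 'h) \<Rightarrow> complex) \<Rightarrow> bool" where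
  "state_on M \<tau> \<longleftrightarrow> complex_linear_on M \<tau> \<and>
     (\<forall>X\<in>M. positive_op X \<longrightarrow> \<tau> X \<in> \<real>\<^sub>\<ge>\<^sub>0) \<and> \<tau> id_blinfun = 1"

text \<open>A state is real on self-adjoint elements, so the real part below is no restriction.\<close>

definition normal_state_on ::
  "('h :: complex_hilbert \<Rightarrow>\<^sub>L 'h) set \<Rightarrow> (('h \<Rightarrow>\<^sub>L 'h) \<Rightarrow> complex) \<Rightarrow> bool" where
  "normal_state_on M \<tau> \<longleftrightarrow> state_on M \<tau> \<and>
     (\<forall>S T. directed_sa M S \<and> op_lub M S T \<longrightarrow> Re (\<tau> T) = (SUP X\<in>S. Re (\<tau> X)))"

definition faithful_normal_tracial_state ::
  "('h :: complex_hilbert \<Rightarrow>\<^sub>L 'h) set \<Rightarrow> (('h \<Rightarrow>\<^sub>L 'h) \<Rightarrow> complex) \<Rightarrow> bool" where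
  "faithful_normal_tracial_state M \<tau> \<longleftrightarrow> normal_state_on M \<tau> \<and>
     (\<forall>X\<in>M. \<forall>Y\<in>M. \<tau> (X o\<^sub>L Y) = \<tau> (Y o\<^sub>L X)) \<and>
     (\<forall>X\<in>M. \<tau> (adj X o\<^sub>L X) = 0 \<longrightarrow> X = 0)"

definition conditional_expectation ::
  "('h :: complex_hilbert \<Rightarrow>\<^sub>L 'h) set \<Rightarrow> ('h \<Rightarrow>\<^sub>L 'h) set \<Rightarrow> (('h \<Rightarrow>\<^sub>L 'h) \<Rightarrow> ('h \<Rightarrow>\<^sub>L 'h)) \<Rightarrow> bool"
  where
  "conditional_expectation M A E \<longleftrightarrow> complex_linear_on M E \<and>
     (\<forall>X\<in>M. E X \<in> A \<and> (positive_op X \<longrightarrow> positive_op (E X))) \<and>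
     (\<forall>X\<in>A. E X = X) \<and>
     (\<forall>X\<in>M. \<forall>Y\<in>A. \<forall>Z\<in>A. E (Y o\<^sub>L X o\<^sub>L Z) = Y o\<^sub>L E X o\<^sub>L Z)"

definition normal_conditional_expectation ::
  "('h :: complex_hilbert \<Rightarrow>\<^sub>L 'h) set \<Rightarrow> ('h \<Rightarrow>\<^sub>L 'h) set \<Rightarrow> (('h \<Rightarrow>\<^sub>L 'h) \<Rightarrow> ('h \<Rightarrow>\<^sub>L 'h)) \<Rightarrow> bool"
  where
  "normal_conditional_expectation M A E \<longleftrightarrow> conditional_expectation M A E \<and>
     (\<forall>S T. directed_sa M S \<and> op_lub M S T \<longrightarrow> op_lub A (E ` S) (E T))"

definition trace_preserving ::
  "('h :: complex_hilbert \<Rightarrow>\<^sub>L 'h) set \<Rightarrow> (('h \<Rightarrow>\<^sub>L 'h) \<Rightarrow> complex) \<Rightarrow>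
    (('h \<Rightarrow>\<^sub>L 'h) \<Rightarrow> ('h \<Rightarrow>\<^sub>L 'h)) \<Rightarrow> bool" where
  "trace_preserving M \<tau> E \<longleftrightarrow> (\<forall>X\<in>M. \<tau> (E X) = \<tau> X)"

definition expected_orbit ::
  "('h :: complex_hilbert \<Rightarrow>\<^sub>L 'h) set \<Rightarrow> (('h \<Rightarrow>\<^sub>L 'h) \<Rightarrow> ('h \<Rightarrow>\<^sub>L 'h)) \<Rightarrow> ('h \<Rightarrow>\<^sub>L 'h) \<Rightarrow>
    ('h \<Rightarrow>\<^sub>L 'h) set" where
  "expected_orbit M E T = {E (adj U o\<^sub>L T o\<^sub>L U) | U. U \<in> M \<and> unitary_op U}"

end

theory Submission
  imports Defs
begin

text \<open>
  Write \<open>N = \<Sum>v. v P\<^sub>v\<close> with spectral projections \<open>P\<^sub>v\<close>. A compression \<open>E (U\<^sup>* N U)\<close> is then a convex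
  combination of the points of the spectrum with positive operator coefficients, so a half-plane
  containing the spectrum strictly makes \<open>E (U\<^sup>* N U) - z\<close> accretive, hence invertible, for \<open>z\<close>
  outside the hull.

  Conversely, an element \<open>X\<close> of the MASA with spectrum in the hull is close to \<open>\<Sum>e. l\<^sub>e e\<close> for a finite
  partition of unity into projections \<open>e\<close> of the MASA, and \<open>l\<^sub>e = \<tau> (X e) / \<tau> e\<close> may be taken, which lies
  in the hull and keeps the trace exact. For one \<open>e\<close> and barycentric weights \<open>a\<^sub>v\<close> of \<open>l\<^sub>e\<close>, cut \<open>e\<close> in the
  MASA into \<open>q\<close> blocks of equal trace and into pieces \<open>D\<^sub>v\<close> of trace \<open>a\<^sub>v \<tau> e\<close> such that all but three
  blocks lie inside some \<open>D\<^sub>v\<close>. Conjugation by a Fourier unitary of the corresponding matrix units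
  averages the blocks and turns the \<open>D\<^sub>v\<close> into projections \<open>Q\<^sub>v\<close> with \<open>E (\<Sum>v. v Q\<^sub>v)\<close> within \<open>O(1/q)\<close> of
  \<open>l\<^sub>e e\<close>. Since the three points are not collinear, equality of the traces of \<open>X\<close> and \<open>N\<close> forces the
  glued \<open>Q\<^sub>v\<close> to have the traces of the \<open>P\<^sub>v\<close>, and comparison of projections in the factor gives a
  unitary carrying \<open>P\<^sub>v\<close> to \<open>Q\<^sub>v\<close> for all three \<open>v\<close> at once.
\<close>


section \<open>Complex scalars and inner products\<close>

text \<open>Traces and norms play different parts. Projections of the factor are unitarily
  equivalent only when their traces agree exactly, so every cut is made with exact trace and all
  inexactness is put into the norm. Exact cuts exist because a minimal projection of the MASA would
  be an abelian projection of the factor. Norm errors sit on mutually orthogonal blocks and hence do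
  not add up, however fine the partition. The Fourier matrix is used because its entries have equal
  modulus: each diagonal block of the conjugate is the plain mean of the \<open>q\<close> blocks.
  Blocks inside one \<open>D v\<close> cause no error in this mean, and rounding the weights to
  multiples of \<open>1 / q\<close> leaves at most as many bad blocks as the spectrum has points, a
  number that stays fixed while \<open>q\<close> grows. No functional calculus is set up: square
  roots come from an iteration, and sign projections of self-adjoint elements take the place of
  spectral measures. Maximality arguments run along sequences steered by the trace, so strong limits
  of sequences suffice for them.\<close>

lemma cbounded_D: "T \<in> cbounded \<Longrightarrow> blinfun_apply T (c *\<^sub>C x) = c *\<^sub>C blinfun_apply T x"
  by (simp add: cbounded_def)

lemma scaleC_scaleR_commute: "c *\<^sub>C r *\<^sub>R y = r *\<^sub>R c *\<^sub>C (y :: 'a :: complex_hilbert)"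
  by (metis mult.commute scaleC_of_real scaleC_scaleC)

lemma scaleC_zero [simp]: "c *\<^sub>C (0 :: 'a :: complex_hilbert) = 0" "0 *\<^sub>C (x :: 'a :: complex_hilbert) = 0"
  using norm_scaleC [of c "0::'a"] norm_scaleC [of 0 x] by auto

lemma scaleC_one [simp]: "1 *\<^sub>C (x :: 'a :: complex_hilbert) = x"
  using scaleC_of_real[of 1 x] by simp

lemma scaleC_minus_right: "c *\<^sub>C (- x) = - (c *\<^sub>C (x :: 'a :: complex_hilbert))"
  using scaleC_add_right[of c x "-x"] by (simp add: eq_neg_iff_add_eq_0 add.commute)

lemma scaleC_minus_left: "(- c) *\<^sub>C x = - (c *\<^sub>C (x :: 'a :: complex_hilbert))"
  using scaleC_add_left[of c "-c" x] by (simp add: eq_neg_iff_add_eq_0 add.commute)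

lemma scaleC_diff_right: "c *\<^sub>C (x - y) = c *\<^sub>C x - c *\<^sub>C (y :: 'a :: complex_hilbert)"
  using scaleC_add_right[of c x "-y"] by (simp add: scaleC_minus_right)

lemma scaleC_diff_left: "(c - d) *\<^sub>C x = c *\<^sub>C x - d *\<^sub>C (x :: 'a :: complex_hilbert)"
  using scaleC_add_left[of c "-d" x] by (simp add: scaleC_minus_left)

lemma cinner_zero [simp]: "cinner 0 (x :: 'a :: complex_hilbert) = 0" "cinner x (0 :: 'a) = 0"
  using cinner_scaleC_left[of 0 x x] cinner_scaleC_right[of x 0 x] by auto

lemma cinner_minus_left: "cinner (- x) y = - cinner x (y :: 'a :: complex_hilbert)"
  using cinner_diff_left[of 0 x y] by simp

lemma cinner_minus_right: "cinner x (- y) = - cinner x (y :: 'a :: complex_hilbert)"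
  using cinner_diff_right[of x 0 y] by simp

lemma cinner_eq_0_iff: "cinner x x = 0 \<longleftrightarrow> x = (0 :: 'a :: complex_hilbert)"
  by (simp add: cinner_self)

text \<open>Multiplying \<open>x\<close> by the phase \<open>c\<close> makes the inner product equal
  to its modulus, so the bound for real parts applies.\<close>

lemma norm_cinner_le: "norm (cinner x y) \<le> norm x * norm (y :: 'a :: complex_hilbert)"
proof (cases "cinner x y = 0")
  case False
  define c where "c = cnj (cinner x y) / norm (cinner x y)"
  have c: "norm c = 1"
    using False by (simp add: c_def norm_divide)
  have "c * cinner x y = norm (cinner x y)"
    using False by (simp add: c_def complex_norm_square[symmetric] mult.commute power2_eq_square)
  then have "norm (cinner x y) = Re (cinner (c *\<^sub>C x) y)"
    by (simp add: cinner_scaleC_left)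
  also have "\<dots> \<le> norm (c *\<^sub>C x) * norm y"
    by (rule Re_cinner_le)
  finally show ?thesis by (simp add: norm_scaleC c)
qed simp

lemma bounded_bilinear_cinner: "bounded_bilinear (cinner :: 'a :: complex_hilbert \<Rightarrow> 'a \<Rightarrow> complex)"
proof
  show "\<exists>K. \<forall>a b :: 'a. norm (cinner a b) \<le> norm a * norm b * K"
    using norm_cinner_le by (intro exI[of _ 1]) auto
qed (simp_all add: cinner_add_left cinner_add_right cinner_scaleR_left cinner_scaleR_right
    scaleR_conv_of_real)

lemmas tendsto_cinner = bounded_bilinear.tendsto[OF bounded_bilinear_cinner]

lemma tendsto_scaleC: "(f \<longlongrightarrow> (a :: 'a :: complex_hilbert)) F \<Longrightarrow> ((\<lambda>n. c *\<^sub>C f n) \<longlongrightarrow> c *\<^sub>C a) F"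
proof -
  have "bounded_linear (\<lambda>x :: 'a. c *\<^sub>C x)"
    by (intro bounded_linear_intro[of _ "norm c"])
      (simp_all add: scaleC_add_right scaleC_scaleR_commute norm_scaleC)
  then show "(f \<longlongrightarrow> a) F \<Longrightarrow> ((\<lambda>n. c *\<^sub>C f n) \<longlongrightarrow> c *\<^sub>C a) F"
    by (rule bounded_linear.tendsto)
qed

lemma cinner_sum_left: "cinner (sum f I) (y :: 'a :: complex_hilbert) = (\<Sum>i\<in>I. cinner (f i) y)"
  by (induction I rule: infinite_finite_induct) (auto simp: cinner_add_left)

lemma cinner_sum_right: "cinner (y :: 'a :: complex_hilbert) (sum f I) = (\<Sum>i\<in>I. cinner y (f i))"
  by (induction I rule: infinite_finite_induct) (auto simp: cinner_add_right)


section \<open>The normed algebra of complex-linear operators\<close>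

text \<open>The complex-linear operators get a type of their own, so that products, sums, norms and
  limits come from type classes and no membership in \<open>cbounded\<close> has to be carried
  along.\<close>

typedef (overloaded) ('h :: complex_hilbert) cop = "cbounded :: ('h \<Rightarrow>\<^sub>L 'h) set"
  morphisms blinfun_of cop_of
  by (rule exI[of _ 0]) (simp add: cbounded_def)

setup_lifting type_definition_cop

lift_definition app :: "'h :: complex_hilbert cop \<Rightarrow> 'h \<Rightarrow> 'h"  (infixr "\<cdot>" 69) is blinfun_apply .

instantiation cop :: (complex_hilbert) "{real_normed_vector, scaleC}"
begin

lift_definition zero_cop :: "'a cop" is 0 by (simp add: cbounded_def)
lift_definition plus_cop :: "'a cop \<Rightarrow> 'a cop \<Rightarrow> 'a cop" is "(+)"
  by (simp add: cbounded_def blinfun.add_left scaleC_add_right)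
lift_definition minus_cop :: "'a cop \<Rightarrow> 'a cop \<Rightarrow> 'a cop" is "(-)"
  by (simp add: cbounded_def blinfun.diff_left scaleC_diff_right)
lift_definition uminus_cop :: "'a cop \<Rightarrow> 'a cop" is uminus
  by (simp add: cbounded_def blinfun.minus_left scaleC_minus_right)
lift_definition scaleR_cop :: "real \<Rightarrow> 'a cop \<Rightarrow> 'a cop" is scaleR
  by (simp add: cbounded_def blinfun.scaleR_left scaleC_scaleR_commute)
lift_definition scaleC_cop :: "complex \<Rightarrow> 'a cop \<Rightarrow> 'a cop" is scaleC
  by (simp add: cbounded_def scaleC_blinfun.rep_eq scaleC_scaleC mult.commute)
lift_definition norm_cop :: "'a cop \<Rightarrow> real" is norm .
definition dist_cop :: "'a cop \<Rightarrow> 'a cop \<Rightarrow> real" where "dist_cop S T = norm (S - T)"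
definition sgn_cop :: "'a cop \<Rightarrow> 'a cop" where "sgn_cop T = inverse (norm T) *\<^sub>R T"
definition uniformity_cop :: "('a cop \<times> 'a cop) filter"
  where "uniformity_cop = (INF e\<in>{0 <..}. principal {(x, y). dist x y < e})"
definition open_cop :: "'a cop set \<Rightarrow> bool"
  where "open_cop U = (\<forall>x\<in>U. eventually (\<lambda>(x', y). x' = x \<longrightarrow> y \<in> U) uniformity)"

instance
proof
  fix S T R :: "'a cop" and r s :: real
  show "S + T + R = S + (T + R)" "S + T = T + S" "0 + S = S" "- S + S = 0" "S - T = S + - T"
    "r *\<^sub>R (S + T) = r *\<^sub>R S + r *\<^sub>R T" "(r + s) *\<^sub>R S = r *\<^sub>R S + s *\<^sub>R S"
    "r *\<^sub>R s *\<^sub>R S = (r * s) *\<^sub>R S" "1 *\<^sub>R S = S" "norm (r *\<^sub>R S) = \<bar>r\<bar> * norm S"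
    by (transfer; simp add: algebra_simps)+
  show "norm S = 0 \<longleftrightarrow> S = 0" "norm (S + T) \<le> norm S + norm T"
    by (transfer; simp add: norm_triangle_ineq)+
qed (rule dist_cop_def sgn_cop_def uniformity_cop_def open_cop_def)+

end

text \<open>A class of unital algebras with \<open>0 \<noteq> 1\<close> is out of reach, since the
  Hilbert space may be zero.\<close>

instantiation cop :: (complex_hilbert) "{real_normed_algebra, monoid_mult}"
begin

lift_definition one_cop :: "'a cop" is id_blinfun by (simp add: cbounded_def)
lift_definition times_cop :: "'a cop \<Rightarrow> 'a cop \<Rightarrow> 'a cop" is blinfun_compose
  by (simp add: cbounded_def)

instance
proof
  fix S T R :: "'a cop" and r :: real
  show "S * T * R = S * (T * R)" "1 * S = S" "S * 1 = S"
    by (transfer; rule blinfun_eqI; simp)+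
  show "(S + T) * R = S * R + T * R" "S * (T + R) = S * T + S * R"
    "r *\<^sub>R S * T = r *\<^sub>R (S * T)" "S * r *\<^sub>R T = r *\<^sub>R (S * T)"
    by (transfer; rule blinfun_eqI; simp add: blinfun.bilinear_simps)+
  show "norm (S * T) \<le> norm S * norm T"
    by transfer (rule norm_blinfun_compose)
qed

end

lift_definition star :: "'h :: complex_hilbert cop \<Rightarrow> 'h cop" is adj by (rule adj_cbounded)

lemma app_simps [simp]:
  "(S * T) \<cdot> x = S \<cdot> T \<cdot> x" "1 \<cdot> x = x" "0 \<cdot> x = 0" "(S + T) \<cdot> x = (S \<cdot> x) + (T \<cdot> x)"
  "(S - T) \<cdot> x = (S \<cdot> x) - (T \<cdot> x)" "(- T) \<cdot> x = - (T \<cdot> x)" "(r *\<^sub>R T) \<cdot> x = r *\<^sub>R (T \<cdot> x)"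
  "(c *\<^sub>C T) \<cdot> x = c *\<^sub>C (T \<cdot> x)"
  "T \<cdot> (x + y) = (T \<cdot> x) + (T \<cdot> y)" "T \<cdot> (x - y) = (T \<cdot> x) - (T \<cdot> y)" "T \<cdot> (- x) = - (T \<cdot> x)"
  "T \<cdot> (r *\<^sub>R x) = r *\<^sub>R (T \<cdot> x)" "T \<cdot> (c *\<^sub>C x) = c *\<^sub>C (T \<cdot> x)" "T \<cdot> 0 = 0"
  by (transfer; simp add: blinfun.bilinear_simps cbounded_D scaleC_blinfun.rep_eq)+

lemma app_sum: "sum f I \<cdot> x = (\<Sum>i\<in>I. f i \<cdot> x)"
  by (induction I rule: infinite_finite_induct) auto

lemma cop_eqI: "(\<And>x. S \<cdot> x = T \<cdot> x) \<Longrightarrow> S = T"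
  by transfer (rule blinfun_eqI)

lemma norm_app: "norm (T \<cdot> x) \<le> norm T * norm x"
  by transfer (rule norm_blinfun)

lemma norm_cop_bound: "0 \<le> b \<Longrightarrow> (\<And>x. norm (T \<cdot> x) \<le> b * norm x) \<Longrightarrow> norm T \<le> b"
  by transfer (rule norm_blinfun_bound)

lemma cinner_star: "cinner (T \<cdot> x) y = cinner x (star T \<cdot> y)"
  by transfer (rule cinner_adj)

lemma star_eqI: "(\<And>x y. cinner (T \<cdot> x) y = cinner x (S \<cdot> y)) \<Longrightarrow> star T = S"
  by (rule cop_eqI, rule cinner_eqI) (simp add: cinner_star[symmetric])

lemma star_star [simp]: "star (star T) = T"
proof (rule star_eqI)
  fix x y
  have "cinner (star T \<cdot> x) y = cnj (cinner y (star T \<cdot> x))"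
    by (rule cinner_commute)
  also have "\<dots> = cnj (cinner (T \<cdot> y) x)"
    by (simp only: cinner_star)
  also have "\<dots> = cinner x (T \<cdot> y)"
    by (rule cinner_commute[symmetric])
  finally show "cinner (star T \<cdot> x) y = cinner x (T \<cdot> y)" .
qed

lemma star_simps [simp]:
  "star (S * T) = star T * star S" "star (S + T) = star S + star T" "star (S - T) = star S - star T"
  "star (- T) = - star T" "star (r *\<^sub>R T) = r *\<^sub>R star T" "star (c *\<^sub>C T) = cnj c *\<^sub>C star T"
  "star 1 = 1" "star 0 = 0"
  by (rule star_eqI; simp add: cinner_star cinner_add_left cinner_add_right cinner_diff_left
      cinner_diff_right cinner_minus_left cinner_minus_right cinner_scaleR_left cinner_scaleR_right
      cinner_scaleC_left cinner_scaleC_right)+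

lemma star_sum: "star (sum f I) = (\<Sum>i\<in>I. star (f i))"
  by (induction I rule: infinite_finite_induct) auto

lemma scaleC_cop_simps:
  fixes S T :: "'h :: complex_hilbert cop"
  shows "c *\<^sub>C (S + T) = c *\<^sub>C S + c *\<^sub>C T" "c *\<^sub>C (S - T) = c *\<^sub>C S - c *\<^sub>C T"
    "(c + d) *\<^sub>C S = c *\<^sub>C S + d *\<^sub>C S" "(c - d) *\<^sub>C S = c *\<^sub>C S - d *\<^sub>C S"
  by (rule cop_eqI; simp add: scaleC_add_right scaleC_add_left scaleC_diff_right scaleC_diff_left)+

lemma scaleC_cop [simp]:
  fixes S T :: "'h :: complex_hilbert cop"
  shows "c *\<^sub>C d *\<^sub>C S = (c * d) *\<^sub>C S" "1 *\<^sub>C S = S" "0 *\<^sub>C S = 0" "c *\<^sub>C (0 :: 'h cop) = 0"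
    "(c *\<^sub>C S) * T = c *\<^sub>C (S * T)" "S * (c *\<^sub>C T) = c *\<^sub>C (S * T)"
    "complex_of_real r *\<^sub>C S = r *\<^sub>R S" "(- c) *\<^sub>C S = - (c *\<^sub>C S)" "c *\<^sub>C (- S) = - (c *\<^sub>C S)"
  by (rule cop_eqI; simp add: scaleC_scaleC scaleC_of_real scaleC_minus_left scaleC_minus_right)+

lemma scaleC_sum_left: "(\<Sum>i\<in>I. f i) *\<^sub>C (T :: 'h :: complex_hilbert cop) = (\<Sum>i\<in>I. f i *\<^sub>C T)"
  by (induction I rule: infinite_finite_induct) (auto simp: scaleC_cop_simps)

lemma scaleC_sum_right: "c *\<^sub>C (\<Sum>i\<in>I. f i :: 'h :: complex_hilbert cop) = (\<Sum>i\<in>I. c *\<^sub>C f i)"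
  by (induction I rule: infinite_finite_induct) (auto simp: scaleC_cop_simps)

lemma norm_scaleC_cop: "norm (c *\<^sub>C (T :: 'h :: complex_hilbert cop)) = norm c * norm T"
proof -
  have le: "norm (c *\<^sub>C T) \<le> norm c * norm T" for c and T :: "'h cop"
    by (rule norm_cop_bound) (auto simp: norm_scaleC norm_app mult_left_mono mult.assoc)
  show ?thesis
  proof (cases "c = 0")
    case False
    have "norm T \<le> norm (inverse c) * norm (c *\<^sub>C T)"
      using le[of "inverse c" "c *\<^sub>C T"] False by simp
    then show ?thesis
      using le[of c T] False by (simp add: norm_inverse inverse_eq_divide norm_divide field_simps)
  qed simp
qed

lemma norm_star [simp]: "norm (star T) = norm T"
proof -
  have le: "norm (star T) \<le> norm T" for T :: "'h :: complex_hilbert cop"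
  proof (rule norm_cop_bound)
    fix x
    have "(norm (star T \<cdot> x))\<^sup>2 = Re (cinner (T \<cdot> star T \<cdot> x) x)"
      by (simp add: power2_norm_cinner cinner_star)
    also have "\<dots> \<le> norm (T \<cdot> star T \<cdot> x) * norm x"
      by (rule Re_cinner_le)
    also have "\<dots> \<le> (norm T * norm (star T \<cdot> x)) * norm x"
      by (intro mult_right_mono norm_app) auto
    finally show "norm (star T \<cdot> x) \<le> norm T * norm x"
      by (cases "star T \<cdot> x = 0") (auto simp: power2_eq_square ac_simps)
  qed simp
  show ?thesis
    using le[of T] le[of "star T"] by simp
qed

lemma tendsto_app: "(X \<longlongrightarrow> x) F \<Longrightarrow> ((\<lambda>n. T \<cdot> X n) \<longlongrightarrow> T \<cdot> x) F"
  by transfer (rule bounded_linear.tendsto[OF blinfun.bounded_linear_right])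

lemma cop_exists:
  assumes "\<And>x y. f (x + y) = f x + f y" "\<And>c x. f (c *\<^sub>C x) = c *\<^sub>C f x"
    "\<And>x :: 'h :: complex_hilbert. norm (f x) \<le> K * norm x"
  obtains T where "\<And>x. T \<cdot> x = f x"
proof -
  have "bounded_linear f"
    using assms by (intro bounded_linear_intro[of f K]) (simp_all add: scaleC_of_real[symmetric] mult.commute)
  then have "Blinfun f \<in> cbounded" "\<And>x. blinfun_apply (Blinfun f) x = f x"
    using assms(2) by (auto simp: cbounded_def bounded_linear_Blinfun_apply)
  then show ?thesis
    using that[of "cop_of (Blinfun f)"] by (simp add: app.rep_eq cop_of_inverse)
qed

text \<open>Complex linearity survives limits in operator norm, so completeness is inherited from
  the bounded real-linear maps.\<close>

instance cop :: (complex_hilbert) banach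
proof
  fix X :: "nat \<Rightarrow> 'a cop"
  assume X: "Cauchy X"
  have "dist (blinfun_of (X m)) (blinfun_of (X n)) = dist (X m) (X n)" for m n
    by (simp add: dist_norm norm_cop.rep_eq minus_cop.rep_eq)
  with X have "Cauchy (\<lambda>n. blinfun_of (X n))"
    by (simp add: Cauchy_def)
  then obtain L where L: "(\<lambda>n. blinfun_of (X n)) \<longlonglongrightarrow> L"
    using Cauchy_convergent_iff convergent_def by blast
  have "L \<in> cbounded"
    unfolding cbounded_def
  proof (intro CollectI allI)
    fix c x
    have "(\<lambda>n. blinfun_apply (blinfun_of (X n)) (c *\<^sub>C x)) \<longlonglongrightarrow> L (c *\<^sub>C x)"
      by (intro bounded_linear.tendsto[OF blinfun.bounded_linear_left] L)
    moreover have "(\<lambda>n. c *\<^sub>C blinfun_apply (blinfun_of (X n)) x) \<longlonglongrightarrow> c *\<^sub>C L x"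
      by (intro tendsto_scaleC bounded_linear.tendsto[OF blinfun.bounded_linear_left] L)
    ultimately show "L (c *\<^sub>C x) = c *\<^sub>C L x"
      using LIMSEQ_unique blinfun_of[of "X _"] by (auto simp: cbounded_D)
  qed
  then obtain T where T: "L = blinfun_of T"
    by (metis cop_of_inverse)
  have "dist (X n) T = dist (blinfun_of (X n)) L" for n
    by (simp add: T dist_norm norm_cop.rep_eq minus_cop.rep_eq)
  with L have "X \<longlonglongrightarrow> T"
    by (simp add: tendsto_iff)
  then show "convergent X"
    by (auto simp: convergent_def)
qed

section \<open>Positivity, inverses and square roots\<close>

definition pos :: "'h :: complex_hilbert cop \<Rightarrow> bool" where
  "pos T \<longleftrightarrow> (\<forall>x. cinner (T \<cdot> x) x \<in> \<real>\<^sub>\<ge>\<^sub>0)"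

definition proj :: "'h :: complex_hilbert cop \<Rightarrow> bool" where
  "proj P \<longleftrightarrow> star P = P \<and> P * P = P"

lemma proj_star: "proj P \<Longrightarrow> star P = P"
  and proj_idem: "proj P \<Longrightarrow> P * P = P"
  by (auto simp: proj_def)

lemma proj_idem_left: "proj P \<Longrightarrow> P * (P * X) = P * X"
  by (simp add: proj_idem flip: mult.assoc)

lemma norm_sq_proj: "proj P \<Longrightarrow> (norm (P \<cdot> x))\<^sup>2 = Re (cinner (P \<cdot> x) x)"
  by (metis app_simps(1) cinner_star power2_norm_cinner proj_def)

lemma proj_norm_app: "proj P \<Longrightarrow> norm (P \<cdot> x) \<le> norm x"
  using norm_sq_proj[of P x] Re_cinner_le[of "P \<cdot> x" x]
  by (cases "P \<cdot> x = 0") (auto simp: power2_eq_square intro: mult_left_le_imp_le[of "norm (P \<cdot> x)"])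

lemma proj_norm: "proj P \<Longrightarrow> norm P \<le> 1"
  by (rule norm_cop_bound) (auto simp: proj_norm_app)

lemma proj_compl: "proj P \<Longrightarrow> proj (1 - P)"
  by (simp add: proj_def algebra_simps)

lemma proj_0 [simp]: "proj 0" and proj_1 [simp]: "proj 1"
  by (auto simp: proj_def)

lemma proj_mult: "proj P \<Longrightarrow> proj Q \<Longrightarrow> P * Q = Q * P \<Longrightarrow> proj (P * Q)"
  by (simp add: proj_def) (metis mult.assoc)

text \<open>The usual way to prove \<open>X = 0\<close> below: \<open>star X * X\<close> can often
  be computed from algebraic relations alone.\<close>

lemma star_mult_self_eq_0: "star X * X = 0 \<Longrightarrow> X = 0"
proof (rule cop_eqI)
  fix x assume "star X * X = 0"
  then have "cinner (X \<cdot> x) (X \<cdot> x) = 0"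
    by (metis app_simps(1,3) cinner_star cinner_zero(2))
  then show "X \<cdot> x = 0 \<cdot> x"
    by (simp add: cinner_eq_0_iff)
qed

lemma pos_star_mult: "pos (star X * X)"
proof -
  have "cinner ((star X * X) \<cdot> x) x = of_real ((norm (X \<cdot> x))\<^sup>2)" for x
    by (simp add: cinner_star cinner_self)
  then show ?thesis by (simp only: pos_def nonneg_Reals_of_real_iff) simp
qed

lemma pos_proj: "proj P \<Longrightarrow> pos P"
  using pos_star_mult[of P] by (simp add: proj_def)

lemma pos_conj: "pos T \<Longrightarrow> pos (star X * T * X)"
  by (simp add: pos_def cinner_star[of "star X"])

lemma pos_scaleR: "pos T \<Longrightarrow> 0 \<le> r \<Longrightarrow> pos (r *\<^sub>R T)"
  by (simp add: pos_def cinner_scaleR_left nonneg_Reals_mult_I)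

lemma parallelogram:
  "(norm (x + y))\<^sup>2 + (norm (x - y))\<^sup>2 = 2 * (norm x)\<^sup>2 + 2 * (norm (y :: 'a :: complex_hilbert))\<^sup>2"
  by (simp add: power2_norm_cinner cinner_add_left cinner_add_right cinner_diff_left cinner_diff_right)

text \<open>Polarisation writes \<open>4 * cinner (T \<cdot> x) y\<close> through four values of the
  quadratic form, whose bounds add up by the parallelogram law. \<open>T\<close> is not assumed
  self-adjoint, which accounts for the factor 2.\<close>

lemma norm_le_of_quadratic_form:
  assumes c: "0 \<le> c" and q: "\<And>x. norm (cinner (T \<cdot> x) x) \<le> c * (norm x)\<^sup>2"
  shows "norm T \<le> 2 * c"
proof (rule norm_cop_bound)
  fix x
  have pol: "norm (4 * cinner (T \<cdot> x) y) \<le> 4 * (c * ((norm x)\<^sup>2 + (norm y)\<^sup>2))" for y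
  proof -
    let ?q = "\<lambda>z. cinner (T \<cdot> z) z"
    have "4 * cinner (T \<cdot> x) y = ?q (x + y) - ?q (x - y)
        + \<i> * ?q (x + \<i> *\<^sub>C y) - \<i> * ?q (x - \<i> *\<^sub>C y)"
      by (simp add: cinner_add_left cinner_add_right cinner_diff_left cinner_diff_right
          cinner_scaleC_left cinner_scaleC_right algebra_simps)
    also have "norm \<dots> \<le> norm (?q (x + y)) + norm (?q (x - y))
        + norm (?q (x + \<i> *\<^sub>C y)) + norm (?q (x - \<i> *\<^sub>C y))"
      by (rule order.trans[OF norm_triangle_ineq4] add_mono norm_triangle_ineq4
          order.trans[OF norm_triangle_ineq] order.refl | simp add: norm_mult)+
    also have "\<dots> \<le> c * (norm (x + y))\<^sup>2 + c * (norm (x - y))\<^sup>2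
        + c * (norm (x + \<i> *\<^sub>C y))\<^sup>2 + c * (norm (x - \<i> *\<^sub>C y))\<^sup>2"
      by (intro add_mono q)
    also have "\<dots> = c * (((norm (x + y))\<^sup>2 + (norm (x - y))\<^sup>2)
        + ((norm (x + \<i> *\<^sub>C y))\<^sup>2 + (norm (x - \<i> *\<^sub>C y))\<^sup>2))"
      by (simp add: algebra_simps)
    also have "\<dots> = 4 * (c * ((norm x)\<^sup>2 + (norm y)\<^sup>2))"
      unfolding parallelogram by (simp add: norm_scaleC algebra_simps)
    finally show ?thesis .
  qed
  show "norm (T \<cdot> x) \<le> 2 * c * norm x"
  proof (cases "T \<cdot> x = 0")
    case False
    \<comment> \<open>\<open>y\<close> points along \<open>T \<cdot> x\<close> and has the length of
      \<open>x\<close>, so the inner product becomes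
      \<open>norm x * norm (T \<cdot> x)\<close>.\<close>
    define y where "y = (norm x / norm (T \<cdot> x)) *\<^sub>R (T \<cdot> x)"
    have y: "norm y = norm x"
      using False by (simp add: y_def)
    have "cinner (T \<cdot> x) y = of_real (norm x * norm (T \<cdot> x))"
      using False by (simp add: y_def cinner_scaleR_right cinner_self power2_eq_square)
    then have "norm (cinner (T \<cdot> x) y) = norm x * norm (T \<cdot> x)"
      by (simp del: of_real_mult)
    then have "norm x * norm (T \<cdot> x) \<le> norm x * (2 * c * norm x)"
      using pol[of y] by (simp add: norm_mult y power2_eq_square algebra_simps)
    moreover have "x \<noteq> 0"
      using False by auto
    ultimately show ?thesis by simp
  qed (use c in simp)
qed (use c in simp)

lemma cop_eq_0_of_quadratic_form: "(\<And>x. cinner (T \<cdot> x) x = 0) \<Longrightarrow> T = 0"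
  using norm_le_of_quadratic_form[of 0 T] by simp

lemma cinner_self_adjoint_real: "star S = S \<Longrightarrow> cinner (S \<cdot> x) x = of_real (Re (cinner (S \<cdot> x) x))"
  by (metis Reals_cnj_iff cinner_commute cinner_star of_real_Re)

lemma pos_self_adjoint: "pos T \<Longrightarrow> star T = T"
proof -
  assume T: "pos T"
  have "cinner ((T - star T) \<cdot> x) x = 0" for x
  proof -
    have "cinner (star T \<cdot> x) x = cnj (cinner (T \<cdot> x) x)"
      by (metis cinner_commute cinner_star)
    also have "\<dots> = cinner (T \<cdot> x) x"
      using T unfolding pos_def by (meson Reals_cnj_iff nonneg_Reals_subset_Reals subsetD)
    finally show ?thesis by (simp add: cinner_diff_left)
  qed
  then have "T - star T = 0" by (rule cop_eq_0_of_quadratic_form)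
  then show ?thesis by simp
qed

lemma pos_iff_self_adjoint: "pos T \<longleftrightarrow> star T = T \<and> (\<forall>x. 0 \<le> Re (cinner (T \<cdot> x) x))"
proof
  assume "pos T"
  then show "star T = T \<and> (\<forall>x. 0 \<le> Re (cinner (T \<cdot> x) x))"
    using pos_self_adjoint by (auto simp: pos_def complex_nonneg_Reals_iff)
next
  assume T: "star T = T \<and> (\<forall>x. 0 \<le> Re (cinner (T \<cdot> x) x))"
  show "pos T"
    unfolding pos_def
  proof
    fix x
    show "cinner (T \<cdot> x) x \<in> \<real>\<^sub>\<ge>\<^sub>0"
      using T by (subst cinner_self_adjoint_real) auto
  qed
qed

lemma Re_cinner_bound: "\<bar>Re (cinner (T \<cdot> x) x)\<bar> \<le> norm T * (norm x)\<^sup>2"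
proof -
  have "\<bar>Re (cinner (T \<cdot> x) x)\<bar> \<le> norm (cinner (T \<cdot> x) x)"
    by (rule abs_Re_le_cmod)
  also have "\<dots> \<le> norm (T \<cdot> x) * norm x"
    by (rule norm_cinner_le)
  also have "\<dots> \<le> (norm T * norm x) * norm x"
    by (intro mult_right_mono norm_app) auto
  finally show ?thesis by (simp add: power2_eq_square ac_simps)
qed

text \<open>Positive linear maps see only the order; this converts a norm bound into the two order
  bounds to which the expectation and the trace can be applied.\<close>

lemma pos_norm_minus:
  assumes "star S = S" "norm S \<le> c"
  shows "pos (c *\<^sub>R 1 - S)" "pos (c *\<^sub>R 1 + S)"
proof -
  have "\<bar>Re (cinner (S \<cdot> x) x)\<bar> \<le> c * (norm x)\<^sup>2" for x
    using Re_cinner_bound[of S x] assms(2) mult_right_mono[of "norm S" c "(norm x)\<^sup>2"] by simp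
  then show "pos (c *\<^sub>R 1 - S)" "pos (c *\<^sub>R 1 + S)"
    using assms(1) by (auto simp: pos_iff_self_adjoint cinner_diff_left cinner_add_left
        cinner_scaleR_left cinner_self abs_le_iff minus_le_iff) (smt (verit))
qed

text \<open>Lax-Milgram by Banach's fixed point theorem: damped iteration of
  \<open>x - t *\<^sub>R ((T \<cdot> x) - y)\<close> solves \<open>T \<cdot> x = y\<close>. The
  lower bound on the form also gives injectivity and the bound on the inverse.\<close>

lemma inverse_of_strictly_accretive:
  assumes d: "0 < d" and T: "\<And>x. d * (norm x)\<^sup>2 \<le> Re (cinner (T \<cdot> x) x)"
  obtains S where "S * T = 1" "T * S = 1"
proof -
  define K where "K = norm T + d"
  have K: "0 < K" "norm T \<le> K" "d \<le> K" using d by (auto simp: K_def add_nonneg_pos)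
  \<comment> \<open>This value minimises \<open>1 - 2 * t * d + t\<^sup>2 * K\<^sup>2\<close>, the
    bound on the squared contraction factor, and the minimum is \<open>c\<^sup>2\<close>. The
    summand \<open>d\<close> in \<open>K\<close> ensures that \<open>K\<close> is positive and at
    least \<open>d\<close>.\<close>
  define t where "t = d / K\<^sup>2"
  define c where "c = sqrt (1 - d\<^sup>2 / K\<^sup>2)"
  have t: "0 < t" using d K by (simp add: t_def)
  have dK: "d\<^sup>2 / K\<^sup>2 \<le> 1" "0 < d\<^sup>2 / K\<^sup>2"
    using d K by (auto simp: power_mono)
  have c: "0 \<le> c" "c < 1" "c\<^sup>2 = 1 - d\<^sup>2 / K\<^sup>2"
    using dK unfolding c_def by (auto simp del: zero_less_divide_iff)
  have low: "d * norm x \<le> norm (T \<cdot> x)" for x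
  proof (cases "x = 0")
    case False
    have "(d * norm x) * norm x \<le> norm (T \<cdot> x) * norm x"
      using T[of x] Re_cinner_le[of "T \<cdot> x" x] by (simp add: power2_eq_square mult.assoc)
    then show ?thesis using False by simp
  qed simp
  have contr: "norm (x - t *\<^sub>R (T \<cdot> x)) \<le> c * norm x" for x
  proof -
    have "(norm (x - t *\<^sub>R (T \<cdot> x)))\<^sup>2 = (norm x)\<^sup>2 - 2 * t * Re (cinner (T \<cdot> x) x) + t\<^sup>2 * (norm (T \<cdot> x))\<^sup>2"
      by (simp add: power2_norm_cinner cinner_diff_left cinner_diff_right cinner_scaleR_left
          cinner_scaleR_right Re_cinner_commute[of x "T \<cdot> x"] algebra_simps) (simp add: power2_eq_square)
    also have "\<dots> \<le> (norm x)\<^sup>2 - 2 * t * (d * (norm x)\<^sup>2) + t\<^sup>2 * (K * norm x)\<^sup>2"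
    proof -
      have "norm (T \<cdot> x) \<le> K * norm x"
        using norm_app[of T x] K mult_right_mono[of "norm T" K "norm x"] by simp
      then have "(norm (T \<cdot> x))\<^sup>2 \<le> (K * norm x)\<^sup>2"
        by (intro power_mono) auto
      then show ?thesis
        using T[of x] t by (intro add_mono diff_mono mult_left_mono) auto
    qed
    also have "\<dots> = (1 - d\<^sup>2 / K\<^sup>2) * (norm x)\<^sup>2"
      using K by (simp add: power_mult_distrib t_def field_simps power2_eq_square)
    also have "\<dots> = (c * norm x)\<^sup>2"
      by (simp only: power_mult_distrib c(3))
    finally show ?thesis
      by (rule power2_le_imp_le) (use c(1) in auto)
  qed
  have "\<exists>x. T \<cdot> x = y" for y
  proof -
    have "\<exists>!x. x - t *\<^sub>R ((T \<cdot> x) - y) = x"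
    proof (rule banach_fix_type[OF c(1,2)], intro allI)
      fix u v
      have "(u - t *\<^sub>R ((T \<cdot> u) - y)) - (v - t *\<^sub>R ((T \<cdot> v) - y)) = (u - v) - t *\<^sub>R (T \<cdot> (u - v))"
        by (simp add: algebra_simps)
      then show "dist (u - t *\<^sub>R ((T \<cdot> u) - y)) (v - t *\<^sub>R ((T \<cdot> v) - y)) \<le> c * dist u v"
        using contr[of "u - v"] by (simp only: dist_norm)
    qed
    then show ?thesis using t by auto
  qed
  then obtain g where g: "\<And>y. T \<cdot> g y = y" by metis
  have inj: "u = v" if "T \<cdot> u = T \<cdot> v" for u v
    using low[of "u - v"] d that by (simp add: mult_le_0_iff)
  obtain S where S: "\<And>x. S \<cdot> x = g x"
  proof (rule cop_exists[of g "1 / d"])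
    show "g (x + y) = g x + g y" "g (a *\<^sub>C x) = a *\<^sub>C g x" for x y a
      by (rule inj; simp add: g)+
    show "norm (g x) \<le> 1 / d * norm x" for x
      using low[of "g x"] d by (simp add: g field_simps)
  qed blast
  have "S * T = 1"
    by (rule cop_eqI, rule inj) (simp add: S g)
  moreover have "T * S = 1"
    by (rule cop_eqI) (simp add: S g)
  ultimately show ?thesis using that by blast
qed

text \<open>Keeps inverses of elements of a von Neumann algebra inside it, through the
  bicommutant.\<close>

lemma inverse_commute:
  fixes S T X :: "'a :: monoid_mult"
  assumes "S * T = 1" "T * S = 1" "X * T = T * X"
  shows "X * S = S * X"
proof -
  have "S * X = S * (X * T) * S" using assms(2) by (simp add: mult.assoc)
  also have "\<dots> = X * S" using assms(1,3) by (simp flip: mult.assoc)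
  finally show ?thesis by simp
qed

text \<open>The iteration \<open>Y \<mapsto> (X + Y\<^sup>2) / 2\<close> started at \<open>0\<close> converges to \<open>1 - sqrt (1 - X)\<close>; it is dominated
  by the same iteration for the number \<open>1\<close> in place of \<open>X\<close>.\<close>

lemma one_minus_sqrt_exists:
  fixes X :: "'h :: complex_hilbert cop"
  assumes X: "norm X \<le> 1" "star X = X"
  obtains L where "norm L \<le> 1" "star L = L" "2 *\<^sub>R L = X + L * L"
    "\<And>Z. Z * X = X * Z \<Longrightarrow> Z * L = L * Z"
proof -
  define Y where "Y n = ((\<lambda>Y. (1/2) *\<^sub>R (X + Y * Y)) ^^ n) 0" for n
  define y :: "nat \<Rightarrow> real" where "y n = ((\<lambda>y. (1 + y * y) / 2) ^^ n) 0" for n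
  have Y: "Y 0 = 0" "Y (Suc n) = (1/2) *\<^sub>R (X + Y n * Y n)" for n
    by (auto simp: Y_def)
  have y: "y 0 = 0" "y (Suc n) = (1 + y n * y n) / 2" for n
    by (auto simp: y_def)
  have y01: "0 \<le> y n \<and> y n \<le> 1" for n
    by (induction n) (auto simp: y mult_le_one)
  have nY: "norm (Y n) \<le> y n" for n
  proof (induction n)
    case (Suc n)
    have "norm (X + Y n * Y n) \<le> 1 + y n * y n"
      using X(1) norm_triangle_ineq[of X "Y n * Y n"] norm_mult_ineq[of "Y n" "Y n"]
        mult_mono[OF Suc Suc] y01[of n] by simp
    then show ?case by (simp add: Y y)
  qed (simp add: Y y)
  have step: "norm (Y (Suc n) - Y n) \<le> y (Suc n) - y n" for n
  proof (induction n)
    case (Suc n)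
    \<comment> \<open>The difference of squares is split as
      \<open>a * (a - b) + (a - b) * b\<close>, which needs no commutation; the scalar sequence
      obeys the same identity.\<close>
    have "Y (Suc (Suc n)) - Y (Suc n) = (1/2) *\<^sub>R (Y (Suc n) * (Y (Suc n) - Y n) + (Y (Suc n) - Y n) * Y n)"
      by (simp only: Y(2)[of "Suc n"] Y(2)[of n, symmetric] diff_conv_add_uminus)
        (simp add: Y(2)[of n] algebra_simps)
    also have "norm \<dots> \<le> (1/2) * (y (Suc n) * (y (Suc n) - y n) + (y (Suc n) - y n) * y n)"
      using norm_triangle_ineq[of "Y (Suc n) * (Y (Suc n) - Y n)" "(Y (Suc n) - Y n) * Y n"]
        norm_mult_ineq[of "Y (Suc n)" "Y (Suc n) - Y n"] norm_mult_ineq[of "Y (Suc n) - Y n" "Y n"]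
        mult_mono[OF nY[of "Suc n"] Suc] mult_mono[OF Suc nY[of n]] y01[of "Suc n"] y01[of n]
        norm_ge_zero[of "Y (Suc n) - Y n"] norm_ge_zero[of "Y n"] Suc
      by (simp del: norm_ge_zero)
    also have "\<dots> = y (Suc (Suc n)) - y (Suc n)"
      by (simp add: y(2)[of "Suc n"]) (simp add: y(2)[of n] field_simps)
    finally show ?case .
  qed (use X y in \<open>simp add: Y\<close>)
  have mono: "norm (Y (n + k) - Y n) \<le> y (n + k) - y n" for n k
  proof (induction k)
    case (Suc k)
    have "norm (Y (n + Suc k) - Y n) \<le> norm (Y (Suc (n + k)) - Y (n + k)) + norm (Y (n + k) - Y n)"
      using norm_triangle_ineq[of "Y (Suc (n + k)) - Y (n + k)" "Y (n + k) - Y n"] by simp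
    then show ?case using step[of "n + k"] Suc by simp
  qed simp
  \<comment> \<open>Monotonicity of the scalar sequence is read off from the norm bound, whose left
    side is nonnegative.\<close>
  have inc: "y m \<le> y n" if "m \<le> n" for m n
    using mono[of m "n - m"] that norm_ge_zero[of "Y n - Y m"] by (simp del: norm_ge_zero)
  have "convergent y"
    by (rule Bseq_monoseq_convergent) (auto intro!: BseqI'[of _ 1] simp: y01 monoseq_def inc)
  then have cy: "Cauchy y" by (rule convergent_Cauchy)
  have "Cauchy Y"
  proof (rule metric_CauchyI)
    fix e :: real assume "0 < e"
    then obtain N where N: "\<And>m n. N \<le> m \<Longrightarrow> N \<le> n \<Longrightarrow> dist (y m) (y n) < e"
      using cy metric_CauchyD by blast
    have "dist (Y m) (Y n) < e" if "N \<le> n" "n \<le> m" for m n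
      using mono[of n "m - n"] N[of m n] that by (simp add: dist_norm)
    then show "\<exists>M. \<forall>m\<ge>M. \<forall>n\<ge>M. dist (Y m) (Y n) < e"
      by (metis dist_commute nle_le)
  qed
  then obtain L where L: "Y \<longlonglongrightarrow> L"
    using Cauchy_convergent_iff convergent_def by blast
  have "norm L \<le> 1"
    using nY y01 by (intro LIMSEQ_le_const2[OF tendsto_norm[OF L]]) (meson order.trans)
  moreover have sY: "star (Y n) = Y n" for n
    by (induction n) (auto simp: Y X)
  have "bounded_linear (star :: 'h cop \<Rightarrow> _)"
    by (rule bounded_linear_intro[of _ 1]) auto
  then have "(\<lambda>n. star (Y n)) \<longlonglongrightarrow> star L"
    using L by (rule bounded_linear.tendsto)
  then have "star L = L"
    using L LIMSEQ_unique by (auto simp: sY)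
  moreover have "2 *\<^sub>R L = X + L * L"
  proof -
    have "(\<lambda>n. 2 *\<^sub>R Y (Suc n)) \<longlonglongrightarrow> 2 *\<^sub>R L"
      by (intro tendsto_intros LIMSEQ_Suc L)
    moreover have "(\<lambda>n. 2 *\<^sub>R Y (Suc n)) \<longlonglongrightarrow> X + L * L"
      by (simp add: Y) (intro tendsto_intros L)
    ultimately show ?thesis by (rule LIMSEQ_unique)
  qed
  moreover have "Z * L = L * Z" if Z: "Z * X = X * Z" for Z
  proof -
    have "Z * Y n = Y n * Z" for n
    proof (induction n)
      case (Suc n)
      have "Z * (Y n * Y n) = Y n * Y n * Z"
        by (metis Suc mult.assoc)
      then show ?case by (simp add: Y algebra_simps Z)
    qed (simp add: Y)
    moreover have "(\<lambda>n. Z * Y n) \<longlonglongrightarrow> Z * L" "(\<lambda>n. Y n * Z) \<longlonglongrightarrow> L * Z"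
      by (intro tendsto_intros L)+
    ultimately show ?thesis by (simp add: LIMSEQ_unique)
  qed
  ultimately show ?thesis using that by blast
qed

text \<open>The root is taken of \<open>star Y * Y\<close> because for a contraction
  \<open>W\<close> the estimate \<open>norm (1 - star W * W) \<le> 1\<close> is a direct
  computation. The commutation clause puts \<open>R\<close> into every von Neumann algebra
  containing \<open>star Y * Y\<close>; with it the lemma takes the place of a continuous functional
  calculus.\<close>

lemma sqrt_exists:
  fixes Y :: "'h :: complex_hilbert cop"
  obtains R where "pos R" "R * R = star Y * Y"
    "\<And>Z. Z * (star Y * Y) = star Y * Y * Z \<Longrightarrow> Z * R = R * Z"
proof -
  define c where "c = norm Y + 1"
  have c: "0 < c" by (simp add: c_def add_nonneg_pos)
  define W where "W = (1 / c) *\<^sub>R Y"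
  have W: "norm W \<le> 1"
    using c by (simp add: W_def c_def field_simps add_nonneg_pos)
  have Wx: "norm (W \<cdot> x) \<le> norm x" "norm (star W \<cdot> x) \<le> norm x" for x
    using norm_app[of W x] norm_app[of "star W" x] W mult_right_mono[OF W, of "norm x"] by auto
  have n: "norm (1 - star W * W) \<le> 1"
  proof (rule norm_cop_bound)
    fix x
    have "(norm ((1 - star W * W) \<cdot> x))\<^sup>2
        = (norm x)\<^sup>2 - 2 * (norm (W \<cdot> x))\<^sup>2 + (norm (star W \<cdot> W \<cdot> x))\<^sup>2"
      using cinner_star[of "star W" "W \<cdot> x" x] cinner_star[of W x "W \<cdot> x"]
      by (simp add: power2_norm_cinner cinner_diff_left cinner_diff_right del: cinner_self)
    also have "\<dots> \<le> (norm x)\<^sup>2"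
      using power_mono[OF Wx(2)[of "W \<cdot> x"], of 2] zero_le_power2[of "norm (W \<cdot> x)"] norm_ge_zero[of "star W \<cdot> W \<cdot> x"]
      by linarith
    finally show "norm ((1 - star W * W) \<cdot> x) \<le> 1 * norm x"
      unfolding mult_1 by (rule power2_le_imp_le) simp
  qed simp
  have "star (1 - star W * W) = 1 - star W * W"
    by simp
  with n obtain L where L: "norm L \<le> 1" "star L = L" "2 *\<^sub>R L = (1 - star W * W) + L * L"
    "\<And>Z. Z * (1 - star W * W) = (1 - star W * W) * Z \<Longrightarrow> Z * L = L * Z"
    by (rule one_minus_sqrt_exists) blast
  define R where "R = c *\<^sub>R (1 - L)"
  have "pos R"
    unfolding R_def using pos_norm_minus(1)[OF L(2,1)] c by (intro pos_scaleR) auto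
  moreover have "(1 - L) * (1 - L) = star W * W"
    using L(3) by (simp add: algebra_simps scaleR_2)
  then have "R * R = star Y * Y"
    using c by (simp add: R_def W_def)
  moreover have "Z * R = R * Z" if "Z * (star Y * Y) = star Y * Y * Z" for Z
  proof -
    have "Z * (star W * W) = star W * W * Z"
      using that by (simp add: W_def)
    then have "Z * L = L * Z"
      by (intro L(4)) (simp add: algebra_simps)
    then show ?thesis by (simp add: R_def algebra_simps)
  qed
  ultimately show ?thesis using that by blast
qed

section \<open>Projections onto closed subspaces\<close>

text \<open>A minimising sequence for the distance is Cauchy by the parallelogram law, and comparing
  its limit with shifts along \<open>u\<close> gives orthogonality.\<close>

lemma nearest_point_exists:
  fixes S :: "'h :: complex_hilbert set"
  assumes S0: "0 \<in> S" and add: "\<And>x y. x \<in> S \<Longrightarrow> y \<in> S \<Longrightarrow> x + y \<in> S"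
    and scale: "\<And>c x. x \<in> S \<Longrightarrow> c *\<^sub>C x \<in> S" and cl: "closed S"
  obtains s where "s \<in> S" "\<And>u. u \<in> S \<Longrightarrow> cinner (x - s) u = 0"
proof -
  define Q where "Q s = (norm (x - s))\<^sup>2" for s
  define m where "m = (INF s\<in>S. Q s)"
  have bdd: "bdd_below (Q ` S)"
    by (intro bdd_belowI[of _ 0]) (auto simp: Q_def)
  have m_le: "m \<le> Q s" if "s \<in> S" for s
    unfolding m_def using bdd that by (intro cINF_lower) auto
  have "\<exists>s\<in>S. Q s < m + 1 / Suc n" for n
  proof -
    have "Inf (Q ` S) < m + 1 / Suc n" by (simp add: m_def)
    then show ?thesis using cINF_less_iff[OF _ bdd] S0 by auto
  qed
  then obtain X where XS: "\<And>n. X n \<in> S" and X: "\<And>n. Q (X n) < m + 1 / Suc n" by metis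
  have par: "(norm (s - t))\<^sup>2 \<le> 2 * (Q s - m) + 2 * (Q t - m)" if st: "s \<in> S" "t \<in> S" for s t
  proof -
    have h: "complex_of_real (1/2) *\<^sub>C (s + t) \<in> S"
      using st add scale by blast
    have e1: "(x - s) + (x - t) = 2 *\<^sub>R (x - complex_of_real (1/2) *\<^sub>C (s + t))"
      unfolding scaleC_of_real by (simp add: scaleR_2 algebra_simps)
    have "(norm ((x - s) + (x - t)))\<^sup>2 = 4 * Q (complex_of_real (1/2) *\<^sub>C (s + t))"
      unfolding e1 Q_def by (simp add: power_mult_distrib)
    moreover have "norm ((x - s) - (x - t)) = norm (s - t)"
      by (simp add: norm_minus_commute)
    ultimately show ?thesis
      using parallelogram[of "x - s" "x - t"] m_le[OF h] by (simp add: Q_def)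
  qed
  have "Cauchy X"
  proof (rule metric_CauchyI)
    fix e :: real assume e: "0 < e"
    then obtain M where M: "1 / Suc M < e\<^sup>2 / 4"
      using nat_approx_posE[of "e\<^sup>2 / 4"] by auto
    have "dist (X i) (X j) < e" if "M \<le> i" "M \<le> j" for i j
    proof -
      have "1 / Suc i \<le> 1 / Suc M" "1 / Suc j \<le> 1 / Suc M"
        using that by (auto simp: field_simps)
      then have "(norm (X i - X j))\<^sup>2 < e\<^sup>2"
        using par[OF XS XS, of i j] X[of i] X[of j] M by argo
      then show ?thesis
        using e by (simp add: dist_norm power_less_imp_less_base)
    qed
    then show "\<exists>M. \<forall>i\<ge>M. \<forall>j\<ge>M. dist (X i) (X j) < e" by blast
  qed
  then obtain z where z: "X \<longlonglongrightarrow> z"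
    using Cauchy_convergent_iff convergent_def by blast
  have zS: "z \<in> S"
    using cl XS z closed_sequentially by blast
  have "(\<lambda>n. Q (X n)) \<longlonglongrightarrow> Q z"
    unfolding Q_def by (intro tendsto_intros z)
  moreover have "(\<lambda>n. m + 1 / Suc n) \<longlonglongrightarrow> m + 0"
    by (intro tendsto_intros LIMSEQ_Suc lim_1_over_n)
  ultimately have "Q z \<le> m + 0"
    using X by (intro LIMSEQ_le[of "\<lambda>n. Q (X n)" _ "\<lambda>n. m + 1 / Suc n"]) (auto intro: less_imp_le)
  then have min: "Q z \<le> Q s" if "s \<in> S" for s using m_le[OF that] by simp
  have "cinner (x - z) u = 0" if u: "u \<in> S" for u
  proof (cases "u = 0")
    case False
    define w where "w = x - z"
    \<comment> \<open>\<open>c *\<^sub>C u\<close> is the component of \<open>w\<close> along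
      \<open>u\<close>; subtracting it would shorten \<open>w\<close> unless
      \<open>c = 0\<close>.\<close>
    define c where "c = cinner w u / of_real ((norm u)\<^sup>2)"
    have cu: "c * of_real ((norm u)\<^sup>2) = cinner w u"
      using False by (simp add: c_def)
    have "cinner (w - c *\<^sub>C u) u = 0"
      by (simp add: cinner_diff_left cinner_scaleC_left cinner_self cu del: of_real_power)
    then have "cinner (w - c *\<^sub>C u) (w - c *\<^sub>C u) = cinner (w - c *\<^sub>C u) w"
      by (simp add: cinner_diff_right[of _ w] cinner_scaleC_right)
    also have "\<dots> = cinner w w - c * cnj (cinner w u)"
      by (simp add: cinner_diff_left cinner_scaleC_left cinner_commute[of u w])
    also have "\<dots> = cinner w w - (c * cnj c) * of_real ((norm u)\<^sup>2)"
      by (simp add: cu[symmetric])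
    finally have "of_real ((norm (w - c *\<^sub>C u))\<^sup>2)
        = complex_of_real ((norm w)\<^sup>2 - (norm c)\<^sup>2 * (norm u)\<^sup>2)"
      by (simp only: cinner_self complex_norm_square[symmetric] of_real_diff of_real_mult)
    then have "(norm (w - c *\<^sub>C u))\<^sup>2 = (norm w)\<^sup>2 - (norm c)\<^sup>2 * (norm u)\<^sup>2"
      by (simp only: of_real_eq_iff)
    moreover have "(norm w)\<^sup>2 \<le> (norm (w - c *\<^sub>C u))\<^sup>2"
      using min[OF add[OF zS scale[OF u, of c]]] by (simp add: Q_def w_def algebra_simps)
    ultimately have "(norm c)\<^sup>2 * (norm u)\<^sup>2 \<le> 0" by simp
    then have "c = 0" using False by (simp add: mult_le_0_iff)
    then show ?thesis using cu by (simp add: w_def)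
  qed simp
  then show ?thesis using that zS by blast
qed

text \<open>Subspaces are given as common kernels, which makes closedness automatic. The families
  used later are a single operator and all products \<open>q * X\<close> with \<open>X\<close> in
  the factor.\<close>

lemma proj_exists:
  fixes KK :: "'h :: complex_hilbert cop set"
  obtains P where "proj P" "\<And>x. P \<cdot> x = x \<longleftrightarrow> (\<forall>K\<in>KK. K \<cdot> x = 0)"
proof -
  define S where "S = {x. \<forall>K\<in>KK. K \<cdot> x = 0}"
  have S: "0 \<in> S" "\<And>x y. x \<in> S \<Longrightarrow> y \<in> S \<Longrightarrow> x + y \<in> S" "\<And>c x. x \<in> S \<Longrightarrow> c *\<^sub>C x \<in> S"
    by (auto simp: S_def)
  have diff: "x - y \<in> S" if "x \<in> S" "y \<in> S" for x y
    using that by (auto simp: S_def)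
  have "closed S"
  proof -
    have "closed {x. K \<cdot> x = 0}" for K :: "'h cop"
      unfolding closed_sequential_limits
    proof (intro allI impI, elim conjE)
      fix x l assume x: "\<forall>n. x n \<in> {x. K \<cdot> x = 0}" and l: "x \<longlonglongrightarrow> l"
      then have "(\<lambda>n. 0) \<longlonglongrightarrow> K \<cdot> l"
        using tendsto_app[OF l, of K] by simp
      then show "l \<in> {x. K \<cdot> x = 0}"
        by (simp add: LIMSEQ_const_iff)
    qed
    moreover have "S = (\<Inter>K\<in>KK. {x. K \<cdot> x = 0})"
      by (auto simp: S_def)
    ultimately show ?thesis by auto
  qed
  then have "\<exists>s\<in>S. \<forall>u\<in>S. cinner (x - s) u = 0" for x
    using nearest_point_exists[of S x] S by metis
  then obtain p where pS: "\<And>x. p x \<in> S" and p: "\<And>x u. u \<in> S \<Longrightarrow> cinner (x - p x) u = 0"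
    by metis
  have uniq: "p x = s" if "s \<in> S" "\<And>u. u \<in> S \<Longrightarrow> cinner (x - s) u = 0" for x s
  proof -
    have "cinner (p x - s) (p x - s) = cinner (x - s) (p x - s) - cinner (x - p x) (p x - s)"
      by (simp add: cinner_diff_left)
    also have "\<dots> = 0"
      using that p pS diff by simp
    finally show ?thesis by (simp add: cinner_eq_0_iff)
  qed
  have p': "cinner (p x) u = cinner x u" if "u \<in> S" for x u
    using p[OF that, of x] by (simp add: cinner_diff_left)
  obtain P where P: "\<And>x. P \<cdot> x = p x"
  proof (rule cop_exists[of p 1])
    show "p (x + y) = p x + p y" for x y
      by (rule uniq) (auto simp: S pS cinner_diff_left cinner_add_left p')
    show "p (c *\<^sub>C x) = c *\<^sub>C p x" for c x
      by (rule uniq) (auto simp: S pS cinner_diff_left cinner_scaleC_left p')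
    show "norm (p x) \<le> 1 * norm x" for x
    proof -
      have "(norm (p x))\<^sup>2 = Re (cinner x (p x))"
        by (simp add: power2_norm_cinner p' pS)
      also have "\<dots> \<le> norm x * norm (p x)" by (rule Re_cinner_le)
      finally show ?thesis
        by (cases "p x = 0") (auto simp: power2_eq_square)
    qed
  qed blast
  have fix_iff: "p x = x \<longleftrightarrow> x \<in> S" for x
    using uniq[of x x] pS[of x] by auto
  have "P * P = P"
    by (rule cop_eqI) (simp add: P fix_iff pS)
  moreover have "star P = P"
  proof (rule star_eqI)
    fix x y
    have "cinner x (p y) = cinner (p x) (p y)" by (simp add: p' pS)
    also have "\<dots> = cnj (cinner (p y) (p x))" by (rule cinner_commute)
    also have "\<dots> = cnj (cinner y (p x))" by (simp add: p' pS)
    also have "\<dots> = cinner (p x) y" by (rule cinner_commute[symmetric])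
    finally show "cinner (P \<cdot> x) y = cinner x (P \<cdot> y)" by (simp add: P)
  qed
  ultimately show ?thesis
    using that[of P] fix_iff by (simp add: proj_def P S_def)
qed

text \<open>Invariance of the range under \<open>X\<close> gives \<open>P * X * P = X * P\<close>;
  the same for \<open>star X\<close>, after taking adjoints, gives
  \<open>P * X * P = P * X\<close>.\<close>

lemma proj_commute_of_invariant:
  assumes P: "proj P" and "\<And>x. P \<cdot> x = x \<Longrightarrow> P \<cdot> X \<cdot> x = X \<cdot> x"
    and "\<And>x. P \<cdot> x = x \<Longrightarrow> P \<cdot> star X \<cdot> x = star X \<cdot> x"
  shows "X * P = P * X"
proof -
  have PP: "P \<cdot> P \<cdot> x = P \<cdot> x" for x
    using P by (metis app_simps(1) proj_def)
  have 1: "P * (X * P) = X * P" and 2: "P * (star X * P) = star X * P"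
    using assms(2,3) by (auto intro!: cop_eqI simp: PP)
  have "star (P * (star X * P)) = star (star X * P)"
    using 2 by simp
  then show ?thesis
    using 1 P by (simp add: proj_def mult.assoc)
qed


section \<open>Commutants and spectral projections\<close>

text \<open>Complex linearity is part of the type, so it does not appear as a condition.\<close>

definition cmt :: "'h :: complex_hilbert cop set \<Rightarrow> 'h cop set" where
  "cmt S = {T. \<forall>X\<in>S. T * X = X * T}"

definition vna :: "'h :: complex_hilbert cop set \<Rightarrow> bool" where
  "vna M \<longleftrightarrow> (\<forall>T\<in>M. star T \<in> M) \<and> cmt (cmt M) = M"

lemma cmt_anti: "S \<subseteq> T \<Longrightarrow> cmt T \<subseteq> cmt S"
  by (auto simp: cmt_def)

lemma subset_cmt_cmt: "S \<subseteq> cmt (cmt S)"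
  by (auto simp: cmt_def)

lemma cmt3: "cmt (cmt (cmt S)) = cmt S"
  by (intro equalityI cmt_anti subset_cmt_cmt)

lemma star_cmt:
  assumes S: "\<And>T. T \<in> S \<Longrightarrow> star T \<in> S" and X: "X \<in> cmt S"
  shows "star X \<in> cmt S"
  unfolding cmt_def
proof (intro CollectI ballI)
  fix T assume "T \<in> S"
  then have "star (X * star T) = star (star T * X)"
    using S X by (simp add: cmt_def)
  then show "star X * T = T * star X" by simp
qed

lemma
  shows cmt_0: "0 \<in> cmt S" and cmt_1: "1 \<in> cmt S"
    and cmt_add: "X \<in> cmt S \<Longrightarrow> Y \<in> cmt S \<Longrightarrow> X + Y \<in> cmt S"
    and cmt_diff: "X \<in> cmt S \<Longrightarrow> Y \<in> cmt S \<Longrightarrow> X - Y \<in> cmt S"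
    and cmt_scaleC: "X \<in> cmt S \<Longrightarrow> c *\<^sub>C X \<in> cmt S"
    and cmt_scaleR: "X \<in> cmt S \<Longrightarrow> r *\<^sub>R X \<in> cmt S"
  by (auto simp: cmt_def algebra_simps)

lemma cmt_mult: "X \<in> cmt S \<Longrightarrow> Y \<in> cmt S \<Longrightarrow> X * Y \<in> cmt S"
  by (simp add: cmt_def) (metis mult.assoc)

lemma cmt_sum: "(\<And>i. i \<in> I \<Longrightarrow> f i \<in> cmt S) \<Longrightarrow> sum f I \<in> cmt S"
  by (induction I rule: infinite_finite_induct) (auto simp: cmt_0 cmt_add)

lemma closed_cmt: "closed (cmt S)"
proof -
  have "closed {T. T * X = X * T}" for X :: "'h :: complex_hilbert cop"
    by (intro closed_Collect_eq continuous_intros)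
  moreover have "cmt S = (\<Inter>X\<in>S. {T. T * X = X * T})"
    by (auto simp: cmt_def)
  ultimately show ?thesis by auto
qed

lemma cmt_strong_limit:
  assumes "\<And>n. W n \<in> cmt S" "\<And>x. (\<lambda>n. W n \<cdot> x) \<longlonglongrightarrow> T \<cdot> x"
  shows "T \<in> cmt S"
  unfolding cmt_def
proof (intro CollectI ballI cop_eqI)
  fix X x assume X: "X \<in> S"
  have "(\<lambda>n. W n \<cdot> X \<cdot> x) \<longlonglongrightarrow> T \<cdot> X \<cdot> x" "(\<lambda>n. X \<cdot> W n \<cdot> x) \<longlonglongrightarrow> X \<cdot> T \<cdot> x"
    by (intro assms tendsto_app)+
  moreover have "W n \<cdot> X \<cdot> x = X \<cdot> W n \<cdot> x" for n
    using assms(1)[of n] X by (simp add: cmt_def flip: app_simps(1))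
  ultimately show "(T * X) \<cdot> x = (X * T) \<cdot> x"
    by (simp add: LIMSEQ_unique)
qed

text \<open>A von Neumann algebra is itself a commutant, so each closure property is inherited from
  commutants.\<close>

lemma
  assumes "vna M"
  shows vna_0: "0 \<in> M" and vna_1: "1 \<in> M"
    and vna_add: "X \<in> M \<Longrightarrow> Y \<in> M \<Longrightarrow> X + Y \<in> M"
    and vna_diff: "X \<in> M \<Longrightarrow> Y \<in> M \<Longrightarrow> X - Y \<in> M"
    and vna_mult: "X \<in> M \<Longrightarrow> Y \<in> M \<Longrightarrow> X * Y \<in> M"
    and vna_scaleC: "X \<in> M \<Longrightarrow> c *\<^sub>C X \<in> M"
    and vna_scaleR: "X \<in> M \<Longrightarrow> r *\<^sub>R X \<in> M"
    and vna_star: "X \<in> M \<Longrightarrow> star X \<in> M"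
    and vna_sum: "(\<And>i. i \<in> I \<Longrightarrow> f i \<in> M) \<Longrightarrow> sum f I \<in> M"
    and vna_strong_limit: "(\<And>n. W n \<in> M) \<Longrightarrow> (\<And>x. (\<lambda>n. W n \<cdot> x) \<longlonglongrightarrow> T \<cdot> x) \<Longrightarrow> T \<in> M"
    and vna_closed: "closed M"
proof -
  obtain S where M: "M = cmt S" using assms by (auto simp: vna_def)
  show "0 \<in> M" "1 \<in> M" "X \<in> M \<Longrightarrow> Y \<in> M \<Longrightarrow> X + Y \<in> M" "X \<in> M \<Longrightarrow> Y \<in> M \<Longrightarrow> X - Y \<in> M"
    "X \<in> M \<Longrightarrow> Y \<in> M \<Longrightarrow> X * Y \<in> M" "X \<in> M \<Longrightarrow> c *\<^sub>C X \<in> M" "X \<in> M \<Longrightarrow> r *\<^sub>R X \<in> M"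
    "(\<And>i. i \<in> I \<Longrightarrow> f i \<in> M) \<Longrightarrow> sum f I \<in> M" "closed M"
    unfolding M by (fact cmt_0 cmt_1 cmt_add cmt_diff cmt_mult cmt_scaleC cmt_scaleR cmt_sum closed_cmt)+
  show "(\<And>n. W n \<in> M) \<Longrightarrow> (\<And>x. (\<lambda>n. W n \<cdot> x) \<longlonglongrightarrow> T \<cdot> x) \<Longrightarrow> T \<in> M"
    unfolding M by (rule cmt_strong_limit)
  show "X \<in> M \<Longrightarrow> star X \<in> M"
    using assms by (simp add: vna_def)
qed

text \<open>Membership by the bicommutant: operators built from elements of \<open>M\<close>, with
  control over what commutes with them, are placed in \<open>M\<close> this way.\<close>

lemma vna_memI: "vna M \<Longrightarrow> (\<And>X. X \<in> cmt M \<Longrightarrow> X * T = T * X) \<Longrightarrow> T \<in> M"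
  by (force simp: vna_def cmt_def[of "cmt M"])

lemma vna_bicommutant:
  assumes "\<And>T. T \<in> S \<Longrightarrow> star T \<in> S"
  shows "vna (cmt (cmt S))"
  using assms by (auto simp: vna_def cmt3 intro: star_cmt)

lemma abelian_bicommutant:
  assumes "S \<subseteq> cmt S" "X \<in> cmt (cmt S)" "Y \<in> cmt (cmt S)"
  shows "X * Y = Y * X"
proof -
  have "cmt (cmt S) \<subseteq> cmt S"
    using assms(1) by (rule cmt_anti)
  then have "X \<in> cmt S" using assms(2) by blast
  then show ?thesis using assms(3) by (simp add: cmt_def[of "cmt S"])
qed

text \<open>The projection onto the kernel of \<open>\<bar>S\<bar> + S\<close>.\<close>

lemma spectral_split:
  fixes S :: "'h :: complex_hilbert cop"
  assumes S: "star S = S"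
  obtains P where "proj P" "\<And>X. X * S = S * X \<Longrightarrow> X * P = P * X"
    "\<And>x. Re (cinner (S \<cdot> P \<cdot> x) (P \<cdot> x)) \<le> 0"
    "\<And>x. 0 \<le> Re (cinner (S \<cdot> (1 - P) \<cdot> x) ((1 - P) \<cdot> x))"
proof -
  obtain R where R: "pos R" "R * R = star S * S"
    and Rc: "\<And>Z. Z * (star S * S) = star S * S * Z \<Longrightarrow> Z * R = R * Z"
    by (rule sqrt_exists[of S]) blast
  have sR: "star R = R" using R(1) by (rule pos_self_adjoint)
  have RX: "X * R = R * X" if "X * S = S * X" for X
    by (rule Rc) (simp add: S, metis mult.assoc that)
  have SR: "S * R = R * S" by (rule RX) simp
  define H where "H = R + S"
  define G where "G = R - S"
  \<comment> \<open>\<open>H\<close> and \<open>G\<close> are twice the positive and the negative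
    part of \<open>S\<close>. Since \<open>R\<close> and \<open>S\<close> commute and have equal
    squares, the product is a vanishing difference of squares.\<close>
  have HG: "H * G = 0"
    using R(2) SR by (simp add: H_def G_def S algebra_simps)
  obtain P where P: "proj P" "\<And>x. P \<cdot> x = x \<longleftrightarrow> (\<forall>K\<in>{H}. K \<cdot> x = 0)"
    by (rule proj_exists[of "{H}"]) blast
  have PP: "P \<cdot> P \<cdot> x = P \<cdot> x" for x
    using P(1) by (metis app_simps(1) proj_def)
  have "X * P = P * X" if X: "X * S = S * X" for X
  proof (rule proj_commute_of_invariant[OF P(1)])
    have inv: "P \<cdot> Y \<cdot> x = Y \<cdot> x" if "P \<cdot> x = x" "Y * S = S * Y" for x Y
    proof -
      have "H * Y = Y * H"
        using RX[OF that(2)] that(2) by (simp add: H_def algebra_simps)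
      then have "H \<cdot> Y \<cdot> x = Y \<cdot> H \<cdot> x"
        by (metis app_simps(1))
      then show ?thesis using that(1) by (simp add: P(2))
    qed
    have "star (X * S) = star (S * X)" using X by simp
    then have X': "star X * S = S * star X" by (simp add: S)
    show "P \<cdot> x = x \<Longrightarrow> P \<cdot> X \<cdot> x = X \<cdot> x" "P \<cdot> x = x \<Longrightarrow> P \<cdot> star X \<cdot> x = star X \<cdot> x" for x
      using inv X X' by blast+
  qed
  \<comment> \<open>On the range of \<open>P\<close> the operator \<open>H\<close> vanishes, so
    \<open>S\<close> acts as \<open>- R\<close> there.\<close>
  moreover have "Re (cinner (S \<cdot> P \<cdot> x) (P \<cdot> x)) \<le> 0" for x
  proof -
    have "H \<cdot> P \<cdot> x = 0" using P(2) PP by blast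
    then have "S \<cdot> P \<cdot> x = - (R \<cdot> P \<cdot> x)"
      by (simp add: H_def eq_neg_iff_add_eq_0 add.commute)
    then show ?thesis
      using R(1) by (simp add: cinner_minus_left pos_iff_self_adjoint)
  qed
  \<comment> \<open>The range of \<open>G\<close> lies in the kernel of \<open>H\<close>; hence
    \<open>G\<close> vanishes on the complement of \<open>P\<close>, and \<open>S\<close> acts as
    \<open>R\<close> there.\<close>
  moreover have "0 \<le> Re (cinner (S \<cdot> (1 - P) \<cdot> x) ((1 - P) \<cdot> x))" for x
  proof -
    have "P \<cdot> G \<cdot> y = G \<cdot> y" for y
      using HG by (simp add: P(2)) (metis app_simps(1,3))
    then have "P * G = G" by (intro cop_eqI) simp
    then have "star (P * G) = star G" by simp
    then have "G * P = G"
      using P(1) by (simp add: G_def sR S proj_def)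
    then have "G * (1 - P) = 0" by (simp add: algebra_simps)
    then have "G \<cdot> (1 - P) \<cdot> x = 0" by (metis app_simps(1,3))
    then have "S \<cdot> (1 - P) \<cdot> x = R \<cdot> (1 - P) \<cdot> x"
      by (simp add: G_def algebra_simps)
    then show ?thesis
      using R(1) by (simp only: pos_iff_self_adjoint)
  qed
  ultimately show ?thesis using that P(1) by blast
qed

text \<open>Finite orthogonal families are encoded as sets of projections; such a set may contain \<open>0\<close>.\<close>

definition ortho :: "'h :: complex_hilbert cop set \<Rightarrow> bool" where
  "ortho F \<longleftrightarrow> finite F \<and> (\<forall>e\<in>F. proj e) \<and> (\<forall>e\<in>F. \<forall>f\<in>F. e \<noteq> f \<longrightarrow> e * f = 0)"

lemma
  assumes "ortho F" "e \<in> F"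
  shows ortho_mult_sum: "e * \<Sum>F = e" and ortho_sum_mult: "\<Sum>F * e = e"
proof -
  have F: "finite F" "e * e = e" "\<And>f. f \<in> F - {e} \<Longrightarrow> e * f = 0 \<and> f * e = 0"
    using assms by (auto simp: ortho_def proj_idem)
  show "e * \<Sum>F = e" "\<Sum>F * e = e"
    using F assms(2) by (simp_all add: sum_distrib_left sum_distrib_right distrib_left distrib_right sum.remove[of F e])
qed

lemma proj_ortho_sum: "ortho F \<Longrightarrow> proj (\<Sum>F)"
proof -
  assume F: "ortho F"
  have "\<Sum>F * \<Sum>F = (\<Sum>e\<in>F. e * \<Sum>F)" by (rule sum_distrib_right)
  also have "\<dots> = \<Sum>F" using F by (simp add: ortho_mult_sum)
  finally show ?thesis
    using F by (simp add: proj_def star_sum ortho_def)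
qed

text \<open>Families are sets, so two of the new products may coincide. A product arising in two
  ways annihilates itself and is therefore 0, which leaves the sum unaffected.\<close>

lemma ortho_refine:
  assumes F: "ortho F" and p: "proj p" and comm: "\<And>e. e \<in> F \<Longrightarrow> e * p = p * e"
  defines "F' \<equiv> (\<lambda>e. e * p) ` F \<union> (\<lambda>e. e * (1 - p)) ` F"
  shows "ortho F'" "\<Sum>F' = \<Sum>F"
proof -
  have comm': "e * q = q * e" if "e \<in> F" "q \<in> {p, 1 - p}" for e q
    using that(2) comm[OF that(1)] by (elim insertE emptyE; simp only: right_diff_distrib left_diff_distrib mult_1_left mult_1_right)
  have q: "proj q" if "q \<in> {p, 1 - p}" for q
    using that p proj_compl by auto
  have prod: "(e * q) * (f * r) = (e * f) * (q * r)" if "e \<in> F" "f \<in> F" "q \<in> {p, 1 - p}" "r \<in> {p, 1 - p}" for e f q r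
    using comm'[OF that(2,3)] by (metis mult.assoc)
  have zero: "(e * q) * (f * r) = 0" if "e \<in> F" "f \<in> F" "q \<in> {p, 1 - p}" "r \<in> {p, 1 - p}" "e \<noteq> f \<or> q \<noteq> r" for e f q r
  proof -
    have "p * (1 - p) = 0" "(1 - p) * p = 0"
      using p by (simp_all add: algebra_simps proj_idem)
    then have "q * r = 0" if "q \<noteq> r"
      using that \<open>q \<in> _\<close> \<open>r \<in> _\<close> by (metis empty_iff insertE)
    moreover have "e * f = 0" if "e \<noteq> f"
      using that \<open>e \<in> F\<close> \<open>f \<in> F\<close> F by (auto simp: ortho_def)
    ultimately have "e * f = 0 \<or> q * r = 0"
      using that(5) by blast
    then show ?thesis using prod[OF that(1-4)] by auto
  qed
  have fin: "finite F" using F by (simp add: ortho_def)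
  have elem: "\<exists>e\<in>F. \<exists>q\<in>{p, 1 - p}. x = e * q" if "x \<in> F'" for x
    using that by (auto simp: F'_def)
  have pr: "proj x" if "x \<in> F'" for x
    using elem[OF that] F q comm' by (auto simp: ortho_def intro!: proj_mult)
  have finF': "finite F'" using fin by (simp add: F'_def)
  have "x * y = 0" if "x \<in> F'" "y \<in> F'" "x \<noteq> y" for x y
  proof -
    obtain e q f r where *: "e \<in> F" "q \<in> {p, 1 - p}" "x = e * q" "f \<in> F" "r \<in> {p, 1 - p}" "y = f * r"
      using elem[OF \<open>x \<in> F'\<close>] elem[OF \<open>y \<in> F'\<close>] by blast
    then have "e \<noteq> f \<or> q \<noteq> r" using \<open>x \<noteq> y\<close> by blast
    then show ?thesis using zero[OF *(1,4,2,5)] * by simp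
  qed
  then show "ortho F'"
    unfolding ortho_def using finF' pr by blast
  have self0: "e * q = 0" if "e \<in> F" "f \<in> F" "q \<in> {p, 1 - p}" "r \<in> {p, 1 - p}" "e \<noteq> f \<or> q \<noteq> r" "e * q = f * r" for e f q r
  proof -
    have "proj (e * q)" using that F q comm' by (auto simp: ortho_def intro!: proj_mult)
    then have "e * q = (e * q) * (e * q)" by (simp add: proj_idem)
    also have "\<dots> = (e * q) * (f * r)" using that(6) by simp
    also have "\<dots> = 0" using that zero by blast
    finally show ?thesis .
  qed
  have re: "\<Sum>((\<lambda>e. e * q) ` F) = (\<Sum>e\<in>F. e * q)" if "q \<in> {p, 1 - p}" for q
    using self0[where q = q and r = q] that fin
    by (subst sum.reindex_nontrivial) auto
  \<comment> \<open>The two halves can only be the same projection on the zero space, where every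
    product vanishes.\<close>
  have eq: "p \<noteq> 1 - p \<or> p = 0 \<and> (1 :: 'a cop) = 0"
  proof (rule disjCI)
    assume "\<not> (p = 0 \<and> (1 :: 'a cop) = 0)"
    show "p \<noteq> 1 - p"
    proof
      assume a: "p = 1 - p"
      then have "p * p = p * (1 - p)" by simp
      then have "p = 0" using p by (simp add: proj_idem algebra_simps)
      with a \<open>\<not> _\<close> show False by simp
    qed
  qed
  have "\<Sum>F' = \<Sum>((\<lambda>e. e * p) ` F) + \<Sum>((\<lambda>e. e * (1 - p)) ` F)"
    unfolding F'_def
  proof (rule sum.union_inter_neutral)
    show "\<forall>x\<in>(\<lambda>e. e * p) ` F \<inter> (\<lambda>e. e * (1 - p)) ` F. x = 0"
      using self0[where q = p and r = "1 - p"] eq by (elim disjE) auto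
  qed (use fin in auto)
  also have "\<dots> = \<Sum>F"
    by (simp add: re flip: sum.distrib) (simp add: algebra_simps)
  finally show "\<Sum>F' = \<Sum>F" .
qed

text \<open>Pythagoras on both sides: a block-diagonal operator is bounded by its largest block.
  Errors on orthogonal blocks therefore do not accumulate.\<close>

lemma norm_ortho_sum_le:
  fixes X :: "'h :: complex_hilbert cop \<Rightarrow> 'h cop"
  assumes F: "ortho F" and X: "\<And>e. e \<in> F \<Longrightarrow> e * X e = X e" "\<And>e. e \<in> F \<Longrightarrow> X e * e = X e"
    and c: "0 \<le> c" "\<And>e. e \<in> F \<Longrightarrow> norm (X e) \<le> c"
  shows "norm (\<Sum>e\<in>F. X e) \<le> c"
proof (rule norm_cop_bound[OF c(1)])
  fix x
  have fin: "finite F" using F by (simp add: ortho_def)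
  have pyth: "(norm (\<Sum>e\<in>F. e \<cdot> v e))\<^sup>2 = (\<Sum>e\<in>F. (norm (e \<cdot> v e))\<^sup>2)" for v
  proof -
    have "cinner (e \<cdot> v e) (f \<cdot> v f) = 0" if "e \<in> F" "f \<in> F" "e \<noteq> f" for e f
    proof -
      have "cinner (e \<cdot> v e) (f \<cdot> v f) = cinner (v e) ((star e * f) \<cdot> v f)"
        by (simp add: cinner_star)
      also have "star e * f = 0" using that F by (simp add: ortho_def proj_def)
      finally show ?thesis by simp
    qed
    then have "cinner (\<Sum>e\<in>F. e \<cdot> v e) (\<Sum>e\<in>F. e \<cdot> v e)
        = (\<Sum>e\<in>F. \<Sum>f\<in>F. if f = e then cinner (e \<cdot> v e) (e \<cdot> v e) else 0)"
      unfolding cinner_sum_left cinner_sum_right by (intro sum.cong refl) auto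
    also have "\<dots> = (\<Sum>e\<in>F. cinner (e \<cdot> v e) (e \<cdot> v e))"
      using fin by simp
    finally show ?thesis by (simp add: power2_norm_cinner)
  qed
  have "(norm ((\<Sum>e\<in>F. X e) \<cdot> x))\<^sup>2 = (norm (\<Sum>e\<in>F. e \<cdot> X e \<cdot> x))\<^sup>2"
    by (simp add: app_sum X flip: app_simps(1))
  also have "\<dots> = (\<Sum>e\<in>F. (norm (X e \<cdot> e \<cdot> x))\<^sup>2)"
    unfolding pyth by (simp add: X flip: app_simps(1))
  also have "\<dots> \<le> (\<Sum>e\<in>F. (c * norm (e \<cdot> x))\<^sup>2)"
    using c by (intro sum_mono power_mono order.trans[OF norm_app] mult_right_mono) auto
  also have "\<dots> = c\<^sup>2 * (norm (\<Sum>e\<in>F. e \<cdot> x))\<^sup>2"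
    unfolding pyth by (simp add: power_mult_distrib sum_distrib_left)
  also have "(\<Sum>e\<in>F. e \<cdot> x) = \<Sum>F \<cdot> x"
    by (simp add: app_sum)
  also have "c\<^sup>2 * (norm (\<Sum>F \<cdot> x))\<^sup>2 \<le> c\<^sup>2 * (norm x)\<^sup>2"
    using F by (intro mult_left_mono power_mono proj_norm_app proj_ortho_sum) auto
  finally have "(norm ((\<Sum>e\<in>F. X e) \<cdot> x))\<^sup>2 \<le> (c * norm x)\<^sup>2"
    by (simp add: power_mult_distrib)
  then show "norm ((\<Sum>e\<in>F. X e) \<cdot> x) \<le> c * norm x"
    by (rule power2_le_imp_le) (use c in auto)
qed

text \<open>The partition is refined by the sign projection of one operator of \<open>L\<close> at a
  time. A definite sign on \<open>e\<close> passes to smaller projections, because their range lies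
  in that of \<open>e\<close>.\<close>

lemma sign_partition_exists:
  assumes C: "vna C" "\<And>X Y. X \<in> C \<Longrightarrow> Y \<in> C \<Longrightarrow> X * Y = Y * X"
    and L: "finite L" "L \<subseteq> C" "\<And>S. S \<in> L \<Longrightarrow> star S = S"
  shows "\<exists>F\<subseteq>C. ortho F \<and> \<Sum>F = 1 \<and> (\<forall>e\<in>F. \<forall>S\<in>L.
    (\<forall>x. Re (cinner (S \<cdot> e \<cdot> x) (e \<cdot> x)) \<le> 0) \<or> (\<forall>x. 0 \<le> Re (cinner (S \<cdot> e \<cdot> x) (e \<cdot> x))))"
  using L
proof (induction L rule: finite_induct)
  case empty
  show ?case
    by (rule exI[of _ "{1}"]) (simp add: ortho_def vna_1[OF C(1)])
next
  case (insert S L)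
  then obtain F where F: "F \<subseteq> C" "ortho F" "\<Sum>F = 1"
    and sgn: "\<And>e S. e \<in> F \<Longrightarrow> S \<in> L \<Longrightarrow>
      (\<forall>x. Re (cinner (S \<cdot> e \<cdot> x) (e \<cdot> x)) \<le> 0) \<or> (\<forall>x. 0 \<le> Re (cinner (S \<cdot> e \<cdot> x) (e \<cdot> x)))"
    by (metis insert_subset insertCI)
  have S: "star S = S" "S \<in> C" using insert by auto
  obtain p where p: "proj p" and pc: "\<And>X. X * S = S * X \<Longrightarrow> X * p = p * X"
    and neg: "\<And>x. Re (cinner (S \<cdot> p \<cdot> x) (p \<cdot> x)) \<le> 0"
    and nonneg: "\<And>x. 0 \<le> Re (cinner (S \<cdot> (1 - p) \<cdot> x) ((1 - p) \<cdot> x))"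
    by (rule spectral_split[OF S(1)]) blast
  have pC: "p \<in> C"
    by (rule vna_memI[OF C(1)]) (simp add: pc S(2) cmt_def)
  have ep: "e * p = p * e" if "e \<in> F" for e
    using that F(1) pC C(2) by auto
  define F' where "F' = (\<lambda>e. e * p) ` F \<union> (\<lambda>e. e * (1 - p)) ` F"
  have "F' \<subseteq> C"
    using F(1) pC vna_1[OF C(1)] by (auto simp: F'_def intro!: vna_mult[OF C(1)] vna_diff[OF C(1)])
  moreover have "ortho F'" "\<Sum>F' = 1"
    using ortho_refine[OF F(2) p ep] F(3) by (auto simp: F'_def)
  moreover have "(\<forall>x. Re (cinner (T \<cdot> f \<cdot> x) (f \<cdot> x)) \<le> 0) \<or> (\<forall>x. 0 \<le> Re (cinner (T \<cdot> f \<cdot> x) (f \<cdot> x)))"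
    if "f \<in> F'" "T \<in> insert S L" for f T
  proof -
    obtain e q where e: "e \<in> F" "q \<in> {p, 1 - p}" "f = e * q"
      using \<open>f \<in> F'\<close> by (auto simp: F'_def)
    have "e * q = q * e"
      using e(2) ep[OF e(1)] by (elim insertE emptyE; simp only: right_diff_distrib left_diff_distrib mult_1_left mult_1_right)
    then have f: "f = q * e" using e(3) by simp
    show ?thesis
    proof (cases "T \<in> L")
      case True
      then show ?thesis using sgn[OF e(1), of T] unfolding e(3) app_simps(1) by blast
    next
      case False
      then have "T = S" using that by auto
      then show ?thesis using e(2) neg nonneg unfolding f app_simps(1) by blast
    qed
  qed
  ultimately show ?case by blast
qed

text \<open>Take the least grid point \<open>t\<close> that bounds \<open>H\<close> from above on
  \<open>e\<close>. By the definite signs the grid point before it is a lower bound, so on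
  \<open>e\<close> the form of \<open>H\<close> differs from \<open>t\<close> by at most
  \<open>d\<close>, and the norm by at most \<open>2 * d\<close>.\<close>

lemma grid_approx:
  fixes H :: "'h :: complex_hilbert cop"
  assumes H: "star H = H" "norm H \<le> c" and e: "proj e" "e * H = H * e" and d: "0 < d" "2 * c \<le> real n * d"
    and sgn: "\<And>k. k \<le> n \<Longrightarrow>
      (\<forall>x. Re (cinner ((H - (real k * d - c) *\<^sub>R 1) \<cdot> e \<cdot> x) (e \<cdot> x)) \<le> 0) \<or>
      (\<forall>x. 0 \<le> Re (cinner ((H - (real k * d - c) *\<^sub>R 1) \<cdot> e \<cdot> x) (e \<cdot> x)))"
  shows "\<exists>t::real. norm (H * e - t *\<^sub>R e) \<le> 2 * d"
proof -
  define q where "q x = Re (cinner (H \<cdot> e \<cdot> x) (e \<cdot> x))" for x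
  define m where "m x = (norm (e \<cdot> x))\<^sup>2" for x
  have form: "Re (cinner ((H - t *\<^sub>R 1) \<cdot> e \<cdot> x) (e \<cdot> x)) = q x - t * m x" for t x
    by (simp add: cinner_diff_left cinner_scaleR_left q_def m_def cinner_self)
  have m0: "0 \<le> m x" for x by (simp add: m_def)
  have q: "- c * m x \<le> q x \<and> q x \<le> c * m x" for x
    using Re_cinner_bound[of H "e \<cdot> x"] mult_right_mono[OF H(2) m0, of x]
    by (simp add: q_def m_def abs_le_iff)
  define neg where "neg k \<longleftrightarrow> (\<forall>x. q x - (real k * d - c) * m x \<le> 0)" for k
  have "neg n"
    unfolding neg_def
  proof
    fix x
    have "c * m x \<le> (real n * d - c) * m x"
      using d by (intro mult_right_mono) (auto simp: m0)
    then show "q x - (real n * d - c) * m x \<le> 0" using q[of x] by simp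
  qed
  define k where "k = (LEAST k. neg k)"
  have k: "neg k" "k \<le> n"
    unfolding k_def using \<open>neg n\<close> by (rule LeastI, rule Least_le)
  define t where "t = real k * d - c"
  have up: "q x \<le> t * m x" for x
    using k(1) by (simp add: neg_def t_def)
  have low: "(t - d) * m x \<le> q x" for x
  proof (cases k)
    \<comment> \<open>There is no earlier grid point; here \<open>t = - c\<close>, and the norm
      bound on \<open>H\<close> serves as lower bound.\<close>
    case 0
    have "(t - d) * m x \<le> - c * m x"
      using d 0 by (intro mult_right_mono) (auto simp: t_def m0)
    then show ?thesis using q[of x] by simp
  next
    case (Suc j)
    then have "\<not> neg j" by (intro not_less_Least) (simp flip: k_def)
    then have "0 \<le> q x - (real j * d - c) * m x"
      using sgn[of j] k Suc unfolding form neg_def by auto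
    then show ?thesis by (simp add: t_def Suc algebra_simps)
  qed
  have "norm (cinner ((H * e - t *\<^sub>R e) \<cdot> x) x) \<le> d * (norm x)\<^sup>2" for x
  proof -
    have ee: "(H * e - t *\<^sub>R e) = e * (H - t *\<^sub>R 1) * e"
      using e by (simp add: algebra_simps proj_idem proj_idem_left)
    have "cinner ((H * e - t *\<^sub>R e) \<cdot> x) x = cinner ((H - t *\<^sub>R 1) \<cdot> e \<cdot> x) (e \<cdot> x)"
      unfolding ee app_simps(1) using cinner_star[of e "(H - t *\<^sub>R 1) \<cdot> e \<cdot> x" x] proj_star[OF e(1)]
      by simp
    also have "\<dots> = of_real (q x - t * m x)"
      unfolding form[symmetric] by (rule cinner_self_adjoint_real) (simp add: H)
    also have "norm \<dots> \<le> d * m x"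
      using up[of x] low[of x] m0[of x] d mult_nonneg_nonneg[of d "m x"]
      by (simp only: norm_of_real abs_le_iff) (simp add: algebra_simps)
    also have "\<dots> \<le> d * (norm x)\<^sup>2"
      using d e by (auto simp: m_def intro!: mult_left_mono power_mono proj_norm_app)
    finally show ?thesis .
  qed
  then show ?thesis
    using norm_le_of_quadratic_form[of d "H * e - t *\<^sub>R e"] d by auto
qed


section \<open>Normal elements as approximate and exact sums over spectral projections\<close>

lemma scaleC_decomp:
  fixes T :: "'h :: complex_hilbert cop"
  shows "T = (1/2) *\<^sub>R (T + star T) + \<i> *\<^sub>C ((- \<i> / 2) *\<^sub>C (T - star T))"
proof -
  have "\<i> *\<^sub>C ((- \<i> / 2) *\<^sub>C (T - star T)) = complex_of_real (1/2) *\<^sub>C (T - star T)"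
    by (simp only: scaleC_cop(1)) (rule arg_cong2[where f = scaleC], simp_all add: complex_eq_iff)
  then show ?thesis
    unfolding scaleC_cop(7) by (simp only:) (simp add: algebra_simps flip: scaleR_left_distrib)
qed

text \<open>One partition, sign-definite for all grid shifts of the real part \<open>H\<close> and
  the imaginary part \<open>K\<close>, serves both parts.\<close>

lemma normal_approx:
  assumes C: "vna C" "\<And>X Y. X \<in> C \<Longrightarrow> Y \<in> C \<Longrightarrow> X * Y = Y * X" and T: "T \<in> C" and eps: "0 < \<epsilon>"
  shows "\<exists>F\<subseteq>C. ortho F \<and> \<Sum>F = 1 \<and> (\<forall>e\<in>F. \<exists>l. norm (T * e - l *\<^sub>C e) \<le> \<epsilon>)"
proof -
  define H where "H = (1/2) *\<^sub>R (T + star T)"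
  define K where "K = (- \<i> / 2) *\<^sub>C (T - star T)"
  have TC: "star T \<in> C" by (rule vna_star[OF C(1) T])
  have HC: "H \<in> C" unfolding H_def by (intro vna_scaleR[OF C(1)] vna_add[OF C(1)] T TC)
  have KC: "K \<in> C" unfolding K_def by (intro vna_scaleC[OF C(1)] vna_diff[OF C(1)] T TC)
  have sH: "star H = H" by (simp add: H_def add.commute)
  have sK: "star K = K"
    by (simp add: K_def scaleC_cop_simps)
  have decomp: "T = H + \<i> *\<^sub>C K" unfolding H_def K_def by (rule scaleC_decomp)
  \<comment> \<open>Real and imaginary part each cost \<open>2 * d\<close>.\<close>
  define d where "d = \<epsilon> / 4"
  define c where "c = max (norm H) (norm K)"
  have d: "0 < d" using eps by (simp add: d_def)
  obtain n where n: "2 * c / d < real n" using reals_Archimedean2 by blast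
  then have n: "2 * c \<le> real n * d" using d by (simp add: field_simps)
  define G where "G S = (\<lambda>k. S - (real k * d - c) *\<^sub>R 1) ` {..n}" for S :: "'a cop"
  have "\<exists>F\<subseteq>C. ortho F \<and> \<Sum>F = 1 \<and> (\<forall>e\<in>F. \<forall>S\<in>G H \<union> G K.
    (\<forall>x. Re (cinner (S \<cdot> e \<cdot> x) (e \<cdot> x)) \<le> 0) \<or> (\<forall>x. 0 \<le> Re (cinner (S \<cdot> e \<cdot> x) (e \<cdot> x))))"
    by (rule sign_partition_exists[OF C])
      (auto simp: G_def sH sK intro!: vna_diff[OF C(1)] vna_scaleR[OF C(1)] vna_1[OF C(1)] HC KC)
  then obtain F where F: "F \<subseteq> C" "ortho F" "\<Sum>F = 1" and
    sgn: "\<And>e S. e \<in> F \<Longrightarrow> S \<in> G H \<union> G K \<Longrightarrow>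
      (\<forall>x. Re (cinner (S \<cdot> e \<cdot> x) (e \<cdot> x)) \<le> 0) \<or> (\<forall>x. 0 \<le> Re (cinner (S \<cdot> e \<cdot> x) (e \<cdot> x)))"
    by blast
  have "\<exists>l. norm (T * e - l *\<^sub>C e) \<le> \<epsilon>" if e: "e \<in> F" for e
  proof -
    have pe: "proj e" and eC: "e \<in> C" using e F by (auto simp: ortho_def)
    have "\<exists>t::real. norm (H * e - t *\<^sub>R e) \<le> 2 * d"
      by (rule grid_approx[OF sH _ pe C(2)[OF eC HC] d n], simp add: c_def, rule sgn[OF e])
        (auto simp: G_def)
    then obtain t where t: "norm (H * e - t *\<^sub>R e) \<le> 2 * d" by blast
    have "\<exists>s::real. norm (K * e - s *\<^sub>R e) \<le> 2 * d"
      by (rule grid_approx[OF sK _ pe C(2)[OF eC KC] d n], simp add: c_def, rule sgn[OF e])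
        (auto simp: G_def)
    then obtain s where s: "norm (K * e - s *\<^sub>R e) \<le> 2 * d" by blast
    have "T * e - (of_real t + \<i> * of_real s) *\<^sub>C e = (H * e - t *\<^sub>R e) + \<i> *\<^sub>C (K * e - s *\<^sub>R e)"
      by (simp add: decomp scaleC_cop_simps algebra_simps flip: scaleC_cop(1,7))
    also have "norm \<dots> \<le> 2 * d + 2 * d"
      using t s by (intro order.trans[OF norm_triangle_ineq] add_mono) (auto simp: norm_scaleC_cop)
    finally show ?thesis by (auto simp: d_def)
  qed
  then show ?thesis using F by blast
qed

definition spec :: "'h :: complex_hilbert cop \<Rightarrow> complex set" where
  "spec T = {z. \<not> (\<exists>S. S * (T - z *\<^sub>C 1) = 1 \<and> (T - z *\<^sub>C 1) * S = 1)}"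

lemma proj_norm_eq_1: "proj p \<Longrightarrow> p \<noteq> 0 \<Longrightarrow> norm p = 1"
  using norm_mult_ineq[of p p] proj_norm[of p] by (simp add: proj_idem)

text \<open>On the nonzero projection \<open>e * g\<close>, which has norm 1, both scalars
  approximate \<open>T\<close>.\<close>

lemma approx_eigenvalues_close:
  assumes p: "proj e" "proj g" "e * g = g * e" "e * g \<noteq> 0"
    and "norm (T * e - l *\<^sub>C e) \<le> a" "norm (T * g - m *\<^sub>C g) \<le> b"
  shows "norm (l - m) \<le> a + b"
proof -
  have le: "norm (X * q) \<le> norm X" if "proj q" for X q :: "'a cop"
    using norm_mult_ineq[of X q] mult_left_mono[OF proj_norm[OF that], of "norm X"] by simp
  have "(m - l) *\<^sub>C (e * g) = (T * e - l *\<^sub>C e) * g - (T * g - m *\<^sub>C g) * e"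
    by (simp add: algebra_simps scaleC_cop_simps p(3))
  then have "norm ((m - l) *\<^sub>C (e * g)) \<le> norm ((T * e - l *\<^sub>C e) * g) + norm ((T * g - m *\<^sub>C g) * e)"
    by (simp add: norm_triangle_ineq4)
  also have "\<dots> \<le> a + b"
    using assms le by (meson add_mono order.trans)
  finally show ?thesis
    using proj_norm_eq_1[OF proj_mult[OF p(1-3)] p(4)] by (simp add: norm_scaleC_cop norm_minus_commute)
qed

lemma partition_meets:
  assumes "\<Sum>G = 1" "e \<noteq> (0 :: 'h :: complex_hilbert cop)"
  obtains g where "g \<in> G" "e * g \<noteq> 0"
proof -
  have "e = (\<Sum>g\<in>G. e * g)"
    using assms(1) by (simp flip: sum_distrib_left)
  then show ?thesis using assms(2) that by (metis sum.neutral)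
qed

text \<open>The scalar \<open>l\<close> of a block is replaced by a nearby spectral value. Ever
  finer partitions all have a block meeting \<open>e\<close>; the scalars of these blocks stay
  within \<open>2 * d\<close> of \<open>l\<close>, and a cluster point \<open>z\<close> of them lies
  in the spectrum. The total error is \<open>d + 2 * d\<close>.\<close>

lemma normal_approx_in_spec:
  assumes C: "vna C" "\<And>X Y. X \<in> C \<Longrightarrow> Y \<in> C \<Longrightarrow> X * Y = Y * X" and T: "T \<in> C" and eps: "0 < \<epsilon>"
  shows "\<exists>F\<subseteq>C. ortho F \<and> \<Sum>F = 1 \<and> (\<forall>e\<in>F. e \<noteq> 0 \<longrightarrow> (\<exists>l\<in>spec T. norm (T * e - l *\<^sub>C e) \<le> \<epsilon>))"
proof -
  define d where "d = \<epsilon> / 3"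
  have d: "0 < d" using eps by (simp add: d_def)
  obtain F where F: "F \<subseteq> C" "ortho F" "\<Sum>F = 1" "\<forall>e\<in>F. \<exists>l. norm (T * e - l *\<^sub>C e) \<le> d"
    using normal_approx[OF C T d] by blast
  have "\<exists>m\<in>spec T. norm (T * e - m *\<^sub>C e) \<le> \<epsilon>" if e: "e \<in> F" "e \<noteq> 0" for e
  proof -
    obtain l where l: "norm (T * e - l *\<^sub>C e) \<le> d" using F e by blast
    have pe: "proj e" and eC: "e \<in> C" using e F by (auto simp: ortho_def)
    have "\<exists>m p. proj p \<and> p \<noteq> 0 \<and> dist l m \<le> d + d \<and> norm (T * p - m *\<^sub>C p) \<le> d / Suc n" for n
    proof -
      have dn: "0 < d / Suc n" "d / Suc n \<le> d" using d by (auto simp: field_simps)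
      obtain G where G: "G \<subseteq> C" "ortho G" "\<Sum>G = 1" "\<forall>g\<in>G. \<exists>l. norm (T * g - l *\<^sub>C g) \<le> d / Suc n"
        using normal_approx[OF C T dn(1)] by blast
      obtain g where g: "g \<in> G" "e * g \<noteq> 0" using partition_meets[OF G(3) e(2)] .
      then obtain m where m: "norm (T * g - m *\<^sub>C g) \<le> d / Suc n" using G by blast
      have pg: "proj g" and eg: "e * g = g * e" using g G eC C(2) by (auto simp: ortho_def)
      have "norm (l - m) \<le> d + d / Suc n"
        using approx_eigenvalues_close[OF pe pg eg g(2) l m] .
      then show ?thesis
        using dn(2) m pg g by (intro exI[of _ m] exI[of _ g]) (auto simp: dist_norm)
    qed
    then obtain m p where p: "\<And>n. proj (p n)" "\<And>n. p n \<noteq> 0"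
      and m: "\<And>n. dist l (m n) \<le> d + d" "\<And>n. norm (T * p n - m n *\<^sub>C p n) \<le> d / Suc n"
      by metis
    have "\<forall>n. m n \<in> cball l (d + d)" using m(1) by simp
    then obtain z r where z: "z \<in> cball l (d + d)" "strict_mono r" "(m \<circ> r) \<longlonglongrightarrow> z"
      using compact_cball unfolding compact_def by metis
    have "z \<in> spec T"
    proof (rule ccontr)
      assume "z \<notin> spec T"
      then obtain S where S: "S * (T - z *\<^sub>C 1) = 1" by (auto simp: spec_def)
      \<comment> \<open>The projection \<open>p (r n)\<close> has norm 1, and an inverse
        \<open>S\<close> would have to recover it from an operator whose norm tends to 0.\<close>
      have "1 \<le> norm S * (d / Suc (r n) + dist (m (r n)) z)" for n
      proof -
        let ?p = "p (r n)" and ?m = "m (r n)"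
        have "?p = S * ((T - z *\<^sub>C 1) * ?p)" using S by (simp flip: mult.assoc)
        also have "(T - z *\<^sub>C 1) * ?p = (T * ?p - ?m *\<^sub>C ?p) + (?m - z) *\<^sub>C ?p"
          by (simp add: algebra_simps scaleC_cop_simps)
        finally have "norm ?p \<le> norm S * norm ((T * ?p - ?m *\<^sub>C ?p) + (?m - z) *\<^sub>C ?p)"
          by (metis norm_mult_ineq)
        also have "\<dots> \<le> norm S * (d / Suc (r n) + norm (?m - z))"
          using m(2)[of "r n"] proj_norm_eq_1[OF p]
          by (intro mult_left_mono order.trans[OF norm_triangle_ineq] add_mono) (auto simp: norm_scaleC_cop)
        finally show ?thesis using proj_norm_eq_1[OF p] by (simp add: dist_norm)
      qed
      moreover have "(\<lambda>n. norm S * (d / Suc (r n) + dist (m (r n)) z)) \<longlonglongrightarrow> norm S * (0 + 0)"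
      proof (intro tendsto_intros)
        have "(\<lambda>n. d / Suc n) \<longlonglongrightarrow> 0"
          using LIMSEQ_Suc[OF lim_const_over_n[of d]] by simp
        then show "(\<lambda>n. d / Suc (r n)) \<longlonglongrightarrow> 0"
          using LIMSEQ_subseq_LIMSEQ[OF _ z(2)] by (fastforce simp: o_def)
        show "(\<lambda>n. dist (m (r n)) z) \<longlonglongrightarrow> 0"
          using z(3) by (simp add: tendsto_dist_iff[symmetric] o_def)
      qed
      ultimately have "1 \<le> norm S * (0 + 0)"
        by (intro LIMSEQ_le_const) auto
      then show False by simp
    qed
    moreover have "norm (T * e - z *\<^sub>C e) \<le> \<epsilon>"
    proof -
      have "T * e - z *\<^sub>C e = (T * e - l *\<^sub>C e) + (l - z) *\<^sub>C e"
        by (simp add: scaleC_cop_simps)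
      also have "norm \<dots> \<le> d + (d + d)"
        using l z(1) proj_norm_eq_1[OF pe e(2)]
        by (intro order.trans[OF norm_triangle_ineq] add_mono) (auto simp: norm_scaleC_cop dist_norm)
      finally show ?thesis by (simp add: d_def)
    qed
    ultimately show ?thesis by blast
  qed
  then show ?thesis using F by blast
qed

lemma finite_gap:
  assumes "finite (S :: 'a :: metric_space set)"
  obtains d where "0 < d" "\<And>v w. v \<in> S \<Longrightarrow> w \<in> S \<Longrightarrow> dist v w < d \<Longrightarrow> v = w"
proof -
  \<comment> \<open>The 1 keeps \<open>D\<close> nonempty when \<open>S\<close> has at most one
    point.\<close>
  define D where "D = insert 1 ((\<lambda>(v, w). dist v w) ` {(v, w). v \<in> S \<and> w \<in> S \<and> v \<noteq> w})"
  have fin: "finite D"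
    unfolding D_def by (intro finite.insertI finite_imageI finite_subset[OF _ finite_cartesian_product[OF assms assms]]) auto
  have "0 < Min D"
    using fin by (auto simp: D_def)
  moreover have "v = w" if "v \<in> S" "w \<in> S" "dist v w < Min D" for v w
  proof (rule ccontr)
    assume "v \<noteq> w"
    then have "dist v w \<in> D" using that by (force simp: D_def)
    then show False using that Min_le[OF fin] by fastforce
  qed
  ultimately show ?thesis using that by blast
qed

text \<open>With isolated spectral values the approximation becomes exact: a block of a finer
  partition that meets \<open>e\<close> carries a spectral value closer to \<open>l\<close> than the
  gap \<open>d\<close>, hence \<open>l\<close> itself, so the error on \<open>e\<close> is below any
  given precision. \<open>P v\<close> collects the blocks with value \<open>v\<close> and is 0 off
  the spectrum.\<close>

lemma normal_finite_spec:
  assumes C: "vna C" "\<And>X Y. X \<in> C \<Longrightarrow> Y \<in> C \<Longrightarrow> X * Y = Y * X" and T: "T \<in> C" and fin: "finite (spec T)"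
  shows "\<exists>P. (\<forall>v. proj (P v) \<and> P v \<in> C) \<and> (\<forall>v w. v \<noteq> w \<longrightarrow> P v * P w = 0) \<and>
    (\<Sum>v\<in>spec T. P v) = 1 \<and> T = (\<Sum>v\<in>spec T. v *\<^sub>C P v)"
proof -
  obtain d where d: "0 < d" "\<And>v w. v \<in> spec T \<Longrightarrow> w \<in> spec T \<Longrightarrow> dist v w < d \<Longrightarrow> v = w"
    by (rule finite_gap[OF fin]) blast
  have d4: "0 < d / 4" using d by simp
  obtain F where F: "F \<subseteq> C" "ortho F" "\<Sum>F = 1"
    "\<forall>e\<in>F. e \<noteq> 0 \<longrightarrow> (\<exists>l\<in>spec T. norm (T * e - l *\<^sub>C e) \<le> d / 4)"
    using normal_approx_in_spec[OF C T d4] by blast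
  have exact: "\<exists>l\<in>spec T. T * e = l *\<^sub>C e" if e: "e \<in> F" "e \<noteq> 0" for e
  proof -
    have pe: "proj e" and eC: "e \<in> C" using e F by (auto simp: ortho_def)
    obtain l where l: "l \<in> spec T" "norm (T * e - l *\<^sub>C e) \<le> d / 4" using F e by blast
    have "norm (T * e - l *\<^sub>C e) \<le> \<eta>" if \<eta>: "0 < \<eta>" "\<eta> \<le> d / 4" for \<eta>
    proof -
      obtain G where G: "G \<subseteq> C" "ortho G" "\<Sum>G = 1"
        "\<forall>g\<in>G. g \<noteq> 0 \<longrightarrow> (\<exists>l\<in>spec T. norm (T * g - l *\<^sub>C g) \<le> \<eta>)"
        using normal_approx_in_spec[OF C T \<eta>(1)] by blast
      define X where "X g = (T * e - l *\<^sub>C e) * g" for g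
      have XC: "T * e - l *\<^sub>C e \<in> C"
        by (intro vna_diff[OF C(1)] vna_mult[OF C(1)] vna_scaleC[OF C(1)] T eC)
      have "norm (\<Sum>g\<in>G. X g) \<le> \<eta>"
      proof (rule norm_ortho_sum_le[OF G(2)])
        fix g assume g: "g \<in> G"
        have pg: "proj g" and gC: "g \<in> C" using g G by (auto simp: ortho_def)
        show "X g * g = X g" using pg by (simp add: X_def proj_idem mult.assoc)
        show "g * X g = X g"
          unfolding X_def C(2)[OF XC gC] using pg by (rule proj_idem_left)
        show "norm (X g) \<le> \<eta>"
        proof (cases "e * g = 0")
          case True
          then show ?thesis using \<eta> by (simp add: X_def algebra_simps)
        next
          case False
          then have "g \<noteq> 0" by auto
          then obtain m where m: "m \<in> spec T" "norm (T * g - m *\<^sub>C g) \<le> \<eta>" using G g by blast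
          have eg: "e * g = g * e" using C(2) eC gC by blast
          have "norm (l - m) \<le> d / 4 + \<eta>"
            by (rule approx_eigenvalues_close[OF pe pg eg False l(2) m(2)])
          then have "dist l m < d" using \<eta> d by (simp add: dist_norm)
          then have "l = m" using d l m by blast
          then have "X g = (T * g - m *\<^sub>C g) * e"
            by (simp add: X_def algebra_simps eg)
          also have "norm \<dots> \<le> \<eta> * 1"
            using m(2) proj_norm[OF pe] \<eta>
            by (intro order.trans[OF norm_mult_ineq] mult_mono) auto
          finally show ?thesis by simp
        qed
      qed (use \<eta> in simp)
      then show ?thesis by (simp add: X_def G(3) flip: sum_distrib_left)
    qed
    note small = this
    have "norm (T * e - l *\<^sub>C e) \<le> 0 + \<eta>" if "0 < \<eta>" for \<eta>
      using small[of "min \<eta> (d / 4)"] that d4 by simp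
    then have "norm (T * e - l *\<^sub>C e) \<le> 0"
      by (rule field_le_epsilon)
    then show ?thesis using l by auto
  qed
  define l where "l e = (SOME l. l \<in> spec T \<and> T * e = l *\<^sub>C e)" for e
  have l: "l e \<in> spec T" "T * e = l e *\<^sub>C e" if "e \<in> F" "e \<noteq> 0" for e
  proof -
    have "l e \<in> spec T \<and> T * e = l e *\<^sub>C e"
      unfolding l_def by (rule someI_ex) (use exact[OF that] in blast)
    then show "l e \<in> spec T" "T * e = l e *\<^sub>C e" by blast+
  qed
  \<comment> \<open>The zero projection is left out, since every scalar is an eigenvalue on
    it.\<close>
  define D where "D v = {e \<in> F. e \<noteq> 0 \<and> l e = v}" for v
  define P where "P v = \<Sum>(D v)" for v
  have finF: "finite F" using F by (simp add: ortho_def)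
  have D: "ortho (D v)" for v using F(2) by (auto simp: ortho_def D_def)
  have "P v * P w = 0" if "v \<noteq> w" for v w
    unfolding P_def sum_distrib_left sum_distrib_right
    using that F(2) by (intro sum.neutral ballI) (auto simp: D_def ortho_def)
  moreover have "proj (P v) \<and> P v \<in> C" for v
    unfolding P_def using F(1) by (intro conjI proj_ortho_sum D vna_sum[OF C(1)]) (auto simp: D_def)
  moreover have grp: "(\<Sum>v\<in>spec T. \<Sum>e\<in>D v. h e) = sum h F" if "h 0 = 0" for h :: "'a cop \<Rightarrow> 'a cop"
  proof -
    have "(\<Sum>v\<in>spec T. \<Sum>e\<in>D v. h e) = sum h {e \<in> F. e \<noteq> 0}"
      using sum.group[of "{e \<in> F. e \<noteq> 0}" "spec T" l h] finF fin l by (auto simp: D_def conj_assoc)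
    also have "\<dots> = sum h F" using that finF by (intro sum.mono_neutral_left) auto
    finally show ?thesis .
  qed
  have "(\<Sum>v\<in>spec T. P v) = 1"
    unfolding P_def using grp[of "\<lambda>e. e"] F(3) by simp
  moreover have "T = (\<Sum>v\<in>spec T. v *\<^sub>C P v)"
  proof -
    have "T = (\<Sum>e\<in>F. T * e)" by (simp add: F(3) flip: sum_distrib_left)
    also have "\<dots> = (\<Sum>v\<in>spec T. \<Sum>e\<in>D v. T * e)" by (rule grp[symmetric]) simp
    also have "\<dots> = (\<Sum>v\<in>spec T. v *\<^sub>C P v)"
      unfolding P_def scaleC_sum_right by (intro sum.cong refl) (auto simp: D_def l(2))
    finally show ?thesis .
  qed
  ultimately show ?thesis by blast
qed

section \<open>Strong limits\<close>

lemma proj_le: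
  assumes "proj p" "proj q" "q * p = p"
  shows "p * q = p" "proj (q - p)"
proof -
  have "star (q * p) = star p" using assms(3) by simp
  then show pq: "p * q = p" using assms(1,2) by (simp add: proj_def)
  show "proj (q - p)" using assms pq by (simp add: proj_def algebra_simps)
qed

text \<open>For \<open>X = (1 - q) * p\<close> the square \<open>star X * X\<close> is
  \<open>p - p * q * p\<close>, which vanishes.\<close>

lemma proj_le_of_compression:
  assumes p: "proj p" "proj q" "p * q * p = p"
  shows "q * p = p"
proof -
  have "star ((1 - q) * p) * ((1 - q) * p) = 0"
    using p by (simp add: proj_def algebra_simps proj_idem_left mult.assoc)
  then have "(1 - q) * p = 0" by (rule star_mult_self_eq_0)
  then show ?thesis by (simp add: algebra_simps)
qed

lemma strong_limit_exists:
  fixes W :: "nat \<Rightarrow> 'h :: complex_hilbert cop"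
  assumes W: "\<And>n. norm (W n) \<le> 1" and C: "\<And>x. Cauchy (\<lambda>n. W n \<cdot> x)"
  obtains T where "\<And>x. (\<lambda>n. W n \<cdot> x) \<longlonglongrightarrow> T \<cdot> x"
proof -
  have "\<exists>l. (\<lambda>n. W n \<cdot> x) \<longlonglongrightarrow> l" for x
    using C[of x] Cauchy_convergent_iff convergent_def by blast
  then obtain f where f: "\<And>x. (\<lambda>n. W n \<cdot> x) \<longlonglongrightarrow> f x" by metis
  have eq: "f z = l" if "(\<lambda>n. W n \<cdot> z) \<longlonglongrightarrow> l" for z l
    using LIMSEQ_unique[OF f that] .
  obtain T where "\<And>x. T \<cdot> x = f x"
  proof (rule cop_exists[of f 1])
    show "f (x + y) = f x + f y" for x y
      by (rule eq) (simp add: tendsto_add f)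
    show "f (c *\<^sub>C x) = c *\<^sub>C f x" for c x
      by (rule eq) (simp add: tendsto_scaleC f)
    show "norm (f x) \<le> 1 * norm x" for x
    proof (rule LIMSEQ_le_const2[OF tendsto_norm[OF f]])
      have "norm (W n \<cdot> x) \<le> 1 * norm x" for n
        using norm_app[of "W n" x] mult_right_mono[OF W, of "norm x"] by (meson norm_ge_zero order.trans)
      then show "\<exists>N. \<forall>n\<ge>N. norm (W n \<cdot> x) \<le> 1 * norm x" by blast
    qed
  qed blast
  then show ?thesis using that[of T] f by simp
qed

lemma increasing_proj_le:
  fixes f :: "nat \<Rightarrow> 'h :: complex_hilbert cop"
  assumes "\<And>n. proj (f n)" "\<And>n. f n * f (Suc n) = f n" "m \<le> n"
  shows "f m * f n = f m"
  using assms(3)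
proof (induction n rule: dec_induct)
  case base
  then show ?case using assms(1) by (simp add: proj_idem)
next
  case (step n)
  then show ?case by (metis assms(2) mult.assoc)
qed

text \<open>The numbers \<open>(norm (f n \<cdot> x))\<^sup>2\<close> increase and are bounded, and
  by Pythagoras their differences are squared distances, so \<open>f n \<cdot> x\<close> is
  Cauchy.\<close>

lemma increasing_proj_limit:
  fixes f :: "nat \<Rightarrow> 'h :: complex_hilbert cop"
  assumes p: "\<And>n. proj (f n)" and inc: "\<And>n. f n * f (Suc n) = f n"
  obtains P where "proj P" "\<And>x. (\<lambda>n. f n \<cdot> x) \<longlonglongrightarrow> P \<cdot> x" "\<And>n. f n * P = f n"
proof -
  have le: "f m * f n = f m" if "m \<le> n" for m n
    by (rule increasing_proj_le[of f, OF p inc that])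
  have diff: "(norm ((f n \<cdot> x) - (f m \<cdot> x)))\<^sup>2 = (norm (f n \<cdot> x))\<^sup>2 - (norm (f m \<cdot> x))\<^sup>2" if "m \<le> n" for m n x
  proof -
    have "star (f m * f n) = star (f m)" using le[OF that] by simp
    then have "f n * f m = f m" using p by (simp add: proj_def)
    then have "proj (f n - f m)" using p proj_le by blast
    then show ?thesis
      using norm_sq_proj[of "f n - f m" x] norm_sq_proj[OF p] by (simp add: cinner_diff_left)
  qed
  have Cau: "Cauchy (\<lambda>n. f n \<cdot> x)" for x
  proof -
    define a where "a n = (norm (f n \<cdot> x))\<^sup>2" for n
    have "incseq a"
      using diff unfolding incseq_def a_def by (metis diff_ge_0_iff_ge zero_le_power2)
    moreover have "a n \<le> (norm x)\<^sup>2" for n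
      unfolding a_def by (intro power_mono proj_norm_app p) simp
    ultimately have "convergent a"
      using incseq_convergent[of a "(norm x)\<^sup>2"] convergent_def by blast
    then have Ca: "Cauchy a" by (rule convergent_Cauchy)
    show ?thesis
    proof (rule metric_CauchyI)
      fix e :: real assume e: "0 < e"
      then have "0 < e\<^sup>2" by simp
      then obtain N where N: "\<And>m n. N \<le> m \<Longrightarrow> N \<le> n \<Longrightarrow> dist (a m) (a n) < e\<^sup>2"
        using Ca metric_CauchyD by blast
      have "dist (f m \<cdot> x) (f n \<cdot> x) < e" if "N \<le> n" "n \<le> m" for m n
      proof -
        have "(norm ((f m \<cdot> x) - (f n \<cdot> x)))\<^sup>2 < e\<^sup>2"
          using diff[OF that(2), of x] N[of m n] that by (simp add: a_def dist_real_def)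
        then show ?thesis using e by (simp add: dist_norm power_less_imp_less_base)
      qed
      then show "\<exists>M. \<forall>m\<ge>M. \<forall>n\<ge>M. dist (f m \<cdot> x) (f n \<cdot> x) < e"
        by (metis dist_commute nle_le)
    qed
  qed
  obtain P where P: "\<And>x. (\<lambda>n. f n \<cdot> x) \<longlonglongrightarrow> P \<cdot> x"
    by (rule strong_limit_exists[OF proj_norm[OF p] Cau]) blast
  have fP: "f m * P = f m" for m
  proof (rule cop_eqI)
    fix x
    have "(\<lambda>n. f m \<cdot> f n \<cdot> x) \<longlonglongrightarrow> f m \<cdot> P \<cdot> x"
      by (intro tendsto_app P)
    moreover have "\<forall>\<^sub>F n in sequentially. f m \<cdot> f n \<cdot> x = f m \<cdot> x"
      using le by (auto simp: eventually_sequentially simp flip: app_simps(1) intro!: exI[of _ m])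
    ultimately show "(f m * P) \<cdot> x = f m \<cdot> x"
      using LIMSEQ_unique tendsto_eventually by (metis app_simps(1))
  qed
  have "star P = P"
  proof (rule star_eqI)
    fix x y
    have "(\<lambda>n. cinner (f n \<cdot> x) y) \<longlonglongrightarrow> cinner (P \<cdot> x) y" "(\<lambda>n. cinner x (f n \<cdot> y)) \<longlonglongrightarrow> cinner x (P \<cdot> y)"
      by (intro tendsto_cinner tendsto_const P)+
    moreover have "cinner (f n \<cdot> x) y = cinner x (f n \<cdot> y)" for n
      using p[of n] by (simp add: cinner_star proj_def)
    ultimately show "cinner (P \<cdot> x) y = cinner x (P \<cdot> y)" using LIMSEQ_unique by simp
  qed
  moreover have "P * P = P"
  proof (rule cop_eqI)
    fix x
    have "(\<lambda>n. f n \<cdot> P \<cdot> x) \<longlonglongrightarrow> P \<cdot> P \<cdot> x" by (rule P)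
    moreover have "f n \<cdot> P \<cdot> x = f n \<cdot> x" for n by (metis app_simps(1) fP)
    ultimately show "(P * P) \<cdot> x = P \<cdot> x" using LIMSEQ_unique P by (metis (no_types, lifting) LIMSEQ_unique P app_simps(1) ext)
  qed
  ultimately show ?thesis using that P fP by (auto simp: proj_def)
qed

text \<open>Each step of the chain recovers at least half of what can still be gained.\<close>

lemma greedy_maximal:
  fixes \<phi> :: "'a \<Rightarrow> real"
  assumes x0: "x0 \<in> C" and refl: "\<And>x. x \<in> C \<Longrightarrow> R x x"
    and trans: "\<And>x y z. x \<in> C \<Longrightarrow> y \<in> C \<Longrightarrow> z \<in> C \<Longrightarrow> R x y \<Longrightarrow> R y z \<Longrightarrow> R x z"
    and mono: "\<And>x y. x \<in> C \<Longrightarrow> y \<in> C \<Longrightarrow> R x y \<Longrightarrow> \<phi> x \<le> \<phi> y"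
    and bound: "\<And>x. x \<in> C \<Longrightarrow> \<phi> x \<le> B"
    and chain: "\<And>s :: nat \<Rightarrow> 'a. (\<And>n. s n \<in> C) \<Longrightarrow> (\<And>n. R (s n) (s (Suc n))) \<Longrightarrow> \<exists>u\<in>C. \<forall>n. R (s n) u"
  obtains m where "m \<in> C" "\<And>y. y \<in> C \<Longrightarrow> R m y \<Longrightarrow> \<phi> y = \<phi> m"
proof -
  define up where "up x = {y \<in> C. R x y}" for x
  define S where "S x = Sup (\<phi> ` up x)" for x
  have bdd: "bdd_above (\<phi> ` up x)" for x
    using bound by (auto simp: up_def intro!: bdd_aboveI[of _ B])
  have le_S: "\<phi> y \<le> S x" if "y \<in> C" "R x y" for x y
    unfolding S_def using bdd that by (intro cSup_upper) (auto simp: up_def)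
  \<comment> \<open>The midpoint between the present value and the supremum is reached or exceeded
    above \<open>x\<close>; when the supremum adds nothing, \<open>x\<close> itself serves.\<close>
  have "\<exists>y. y \<in> C \<and> R x y \<and> (\<phi> x + S x) / 2 \<le> \<phi> y" if x: "x \<in> C" for x
  proof (cases "S x \<le> \<phi> x")
    case True
    then show ?thesis using x refl by (intro exI[of _ x]) auto
  next
    case False
    then have "(\<phi> x + S x) / 2 < Sup (\<phi> ` up x)" by (simp add: S_def)
    then obtain v where "v \<in> \<phi> ` up x" "(\<phi> x + S x) / 2 < v"
      using x refl by (elim less_cSupE) (auto simp: up_def)
    then show ?thesis by (auto simp: up_def intro: less_imp_le)
  qed
  then obtain g where g: "\<And>x. x \<in> C \<Longrightarrow> g x \<in> C \<and> R x (g x) \<and> (\<phi> x + S x) / 2 \<le> \<phi> (g x)"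
    by metis
  define s where "s n = (g ^^ n) x0" for n
  have s: "s n \<in> C" for n by (induction n) (auto simp: s_def x0 g)
  have sS: "s (Suc n) = g (s n)" for n by (simp add: s_def)
  obtain u where u: "u \<in> C" "\<And>n. R (s n) u"
    using chain[of s] s g by (auto simp: sS)
  have "\<phi> y = \<phi> u" if y: "y \<in> C" "R u y" for y
  proof -
    \<comment> \<open>Whatever lies above \<open>u\<close> lies above every \<open>s n\<close>, so
      its advantage over \<open>s n\<close> is halved at each step.\<close>
    have *: "\<phi> y - \<phi> (s n) \<le> \<bar>\<phi> y - \<phi> x0\<bar> * (1/2) ^ n" for n
    proof (induction n)
      case 0
      then show ?case by (simp add: s_def)
    next
      case (Suc n)
      have "\<phi> y \<le> S (s n)" using le_S[OF y(1)] trans[OF s u(1) y(1) u(2) y(2)] by blast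
      then have "\<phi> y - \<phi> (s (Suc n)) \<le> (\<phi> y - \<phi> (s n)) / 2"
        using g[OF s, of n] by (simp add: sS field_simps)
      then show ?case using Suc by simp
    qed
    have "\<phi> y - \<phi> u \<le> \<bar>\<phi> y - \<phi> x0\<bar> * (1/2) ^ n" for n
      using *[of n] mono[OF s u(1) u(2), of n] by simp
    moreover have "(\<lambda>n. \<bar>\<phi> y - \<phi> x0\<bar> * (1/2) ^ n) \<longlonglongrightarrow> \<bar>\<phi> y - \<phi> x0\<bar> * 0"
      by (intro tendsto_mult tendsto_const LIMSEQ_realpow_zero) auto
    ultimately have "\<phi> y - \<phi> u \<le> \<bar>\<phi> y - \<phi> x0\<bar> * 0"
      by (intro LIMSEQ_le_const) auto
    then show ?thesis using mono[OF u(1) y] by simp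
  qed
  then show ?thesis using that u(1) by blast
qed


section \<open>Comparison of projections in a factor with a trace\<close>

text \<open>Normality takes the form in which chains of projections use it: an upper bound for the
  traces of an increasing sequence passes to the strong limit.\<close>

locale tracial_factor =
  fixes M :: "'h :: complex_hilbert cop set" and \<tau> :: "'h cop \<Rightarrow> complex"
  assumes vna_M: "vna M"
    and center: "X \<in> M \<Longrightarrow> X \<in> cmt M \<Longrightarrow> \<exists>c. X = c *\<^sub>C 1"
    and tau_add: "X \<in> M \<Longrightarrow> Y \<in> M \<Longrightarrow> \<tau> (X + Y) = \<tau> X + \<tau> Y"
    and tau_scaleC: "X \<in> M \<Longrightarrow> \<tau> (c *\<^sub>C X) = c * \<tau> X"
    and tau_pos: "X \<in> M \<Longrightarrow> pos X \<Longrightarrow> \<tau> X \<in> \<real>\<^sub>\<ge>\<^sub>0"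
    and tau_1: "\<tau> 1 = 1"
    and tau_commute: "X \<in> M \<Longrightarrow> Y \<in> M \<Longrightarrow> \<tau> (X * Y) = \<tau> (Y * X)"
    and tau_faithful: "X \<in> M \<Longrightarrow> \<tau> (star X * X) = 0 \<Longrightarrow> X = 0"
    and tau_normal: "(\<And>n. f n \<in> M) \<Longrightarrow> (\<And>n. proj (f n)) \<Longrightarrow> (\<And>n. f n * f (Suc n) = f n) \<Longrightarrow>
      P \<in> M \<Longrightarrow> proj P \<Longrightarrow> (\<And>x. (\<lambda>n. f n \<cdot> x) \<longlonglongrightarrow> P \<cdot> x) \<Longrightarrow> (\<And>n. Re (\<tau> (f n)) \<le> t) \<Longrightarrow> Re (\<tau> P) \<le> t"
begin

lemmas M_closed = vna_0[OF vna_M] vna_1[OF vna_M] vna_add[OF vna_M] vna_diff[OF vna_M]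
  vna_mult[OF vna_M] vna_scaleC[OF vna_M] vna_scaleR[OF vna_M] vna_star[OF vna_M] vna_sum[OF vna_M]

lemma tau_0: "\<tau> 0 = 0"
  using tau_scaleC[of 0 0] M_closed by simp

lemma tau_diff: "X \<in> M \<Longrightarrow> Y \<in> M \<Longrightarrow> \<tau> (X - Y) = \<tau> X - \<tau> Y"
  using tau_add[of "X - Y" Y] M_closed by simp

lemma tau_scaleR: "X \<in> M \<Longrightarrow> \<tau> (r *\<^sub>R X) = of_real r * \<tau> X"
  using tau_scaleC[of X "of_real r"] by simp

lemma tau_sum: "(\<And>i. i \<in> I \<Longrightarrow> f i \<in> M) \<Longrightarrow> \<tau> (\<Sum>i\<in>I. f i) = (\<Sum>i\<in>I. \<tau> (f i))"
proof (induction I rule: infinite_finite_induct)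
  case (insert i I)
  then show ?case by (simp add: tau_add M_closed)
qed (auto simp: tau_0)

definition tr :: "'h cop \<Rightarrow> real" where "tr X = Re (\<tau> X)"

lemma tau_proj: "p \<in> M \<Longrightarrow> proj p \<Longrightarrow> \<tau> p = of_real (tr p)"
  using tau_pos[OF _ pos_proj, of p] by (auto simp: tr_def complex_nonneg_Reals_iff complex_eq_iff)

lemma tr_nonneg: "p \<in> M \<Longrightarrow> proj p \<Longrightarrow> 0 \<le> tr p"
  using tau_pos[OF _ pos_proj, of p] by (auto simp: tr_def complex_nonneg_Reals_iff)

lemma tr_eq_0: "p \<in> M \<Longrightarrow> proj p \<Longrightarrow> tr p = 0 \<Longrightarrow> p = 0"
  using tau_faithful[of p] tau_proj[of p] by (simp add: proj_def)

lemma tr_diff: "X \<in> M \<Longrightarrow> Y \<in> M \<Longrightarrow> tr (X - Y) = tr X - tr Y"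
  by (simp add: tr_def tau_diff)

lemma tr_add: "X \<in> M \<Longrightarrow> Y \<in> M \<Longrightarrow> tr (X + Y) = tr X + tr Y"
  by (simp add: tr_def tau_add)

lemma tr_sum: "(\<And>i. i \<in> I \<Longrightarrow> f i \<in> M) \<Longrightarrow> tr (\<Sum>i\<in>I. f i) = (\<Sum>i\<in>I. tr (f i))"
  by (simp add: tr_def tau_sum)

lemma tr_mono: "p \<in> M \<Longrightarrow> q \<in> M \<Longrightarrow> proj p \<Longrightarrow> proj q \<Longrightarrow> q * p = p \<Longrightarrow> tr p \<le> tr q"
  using tr_nonneg[of "q - p"] proj_le(2)[of p q] M_closed by (simp add: tr_diff)

text \<open>If all \<open>q * X * p\<close> vanished, the common kernel of the operators
  \<open>q * X\<close> would be invariant under \<open>M\<close> and under its commutant. Its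
  projection \<open>z\<close> would be central, hence scalar; it fixes \<open>p \<noteq> 0\<close>,
  so \<open>z = 1\<close>, which forces \<open>q = 0\<close>.\<close>

lemma connecting_element:
  assumes p: "p \<in> M" "proj p" "p \<noteq> 0" and q: "q \<in> M" "proj q" "q \<noteq> 0"
  obtains X where "X \<in> M" "q * X * p \<noteq> 0"
proof -
  have "\<exists>X\<in>M. q * X * p \<noteq> 0"
  proof (rule ccontr)
    assume "\<not> (\<exists>X\<in>M. q * X * p \<noteq> 0)"
    then have *: "q * X * p = 0" if "X \<in> M" for X using that by blast
    obtain z where z: "proj z" "\<And>x. z \<cdot> x = x \<longleftrightarrow> (\<forall>K\<in>(\<lambda>X. q * X) ` M. K \<cdot> x = 0)"
      by (rule proj_exists) blast
    then have zx: "z \<cdot> x = x \<longleftrightarrow> (\<forall>X\<in>M. q \<cdot> X \<cdot> x = 0)" for x by simp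
    have "Y * z = z * Y" if Y: "Y \<in> M" for Y
    proof (rule proj_commute_of_invariant[OF z(1)])
      have "z \<cdot> Z \<cdot> x = Z \<cdot> x" if "Z \<in> M" "z \<cdot> x = x" for Z x
        unfolding zx
      proof
        fix X assume "X \<in> M"
        then have "X * Z \<in> M" using that by (intro M_closed) auto
        then show "q \<cdot> X \<cdot> Z \<cdot> x = 0" using that(2) unfolding zx by (metis app_simps(1))
      qed
      then show "z \<cdot> x = x \<Longrightarrow> z \<cdot> Y \<cdot> x = Y \<cdot> x" "z \<cdot> x = x \<Longrightarrow> z \<cdot> star Y \<cdot> x = star Y \<cdot> x" for x
        using Y vna_star[OF vna_M Y] by blast+
    qed
    then have "z \<in> cmt M" by (simp add: cmt_def)
    moreover have "z \<in> M"
    proof (rule vna_memI[OF vna_M], rule proj_commute_of_invariant[OF z(1)])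
      fix Y assume Y: "Y \<in> cmt M"
      have sY: "star Y \<in> cmt M" using star_cmt[OF _ Y] vna_star[OF vna_M] by blast
      have "z \<cdot> Z \<cdot> x = Z \<cdot> x" if "Z \<in> cmt M" "z \<cdot> x = x" for Z x
        unfolding zx
      proof
        fix X assume X: "X \<in> M"
        have "q * X * Z = Z * (q * X)"
          using that(1) X q(1) M_closed by (simp add: cmt_def)
        then have "q \<cdot> X \<cdot> Z \<cdot> x = Z \<cdot> q \<cdot> X \<cdot> x" by (metis app_simps(1))
        then show "q \<cdot> X \<cdot> Z \<cdot> x = 0" using that(2) X unfolding zx by simp
      qed
      then show "z \<cdot> x = x \<Longrightarrow> z \<cdot> Y \<cdot> x = Y \<cdot> x" "z \<cdot> x = x \<Longrightarrow> z \<cdot> star Y \<cdot> x = star Y \<cdot> x" for x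
        using Y sY by blast+
    qed
    ultimately obtain c where c: "z = c *\<^sub>C 1" using center by blast
    have "q = 0" if "\<And>x. z \<cdot> x = x"
    proof (rule cop_eqI)
      fix x
      have "q \<cdot> 1 \<cdot> x = 0" using that M_closed(2) unfolding zx by blast
      then show "q \<cdot> x = 0 \<cdot> x" by simp
    qed
    then obtain y where y: "z \<cdot> y \<noteq> y" using q(3) by blast
    have "c *\<^sub>C p = p"
    proof -
      have "z * p = p"
      proof (rule cop_eqI)
        fix y
        have "q \<cdot> X \<cdot> p \<cdot> y = 0" if "X \<in> M" for X
          using *[OF that] by (metis app_simps(1,3))
        then show "(z * p) \<cdot> y = p \<cdot> y" by (simp add: zx)
      qed
      then show ?thesis by (simp add: c)
    qed
    then have "(c - 1) *\<^sub>C p = 0" by (simp add: scaleC_cop_simps)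
    then have "c = 1" using p(3) by (metis norm_scaleC_cop eq_iff_diff_eq_0 mult_eq_0_iff norm_eq_zero)
    then show False using y c by simp
  qed
  then show ?thesis using that by blast
qed

lemma M_memI: "(\<And>X. X \<in> cmt M \<Longrightarrow> X * T = T * X) \<Longrightarrow> T \<in> M"
  by (rule vna_memI[OF vna_M])

text \<open>A truncated polar decomposition: \<open>Y = q * X * p\<close> is divided by its modulus
  \<open>R\<close>, but only on the spectral projection \<open>f\<close> where \<open>R\<close> is
  at least \<open>d\<close> and the inverse is bounded.\<close>

lemma connecting_partial_isometry:
  assumes p: "p \<in> M" "proj p" "p \<noteq> 0" and q: "q \<in> M" "proj q" "q \<noteq> 0"
  obtains W where "W \<in> M" "W \<noteq> 0" "proj (star W * W)" "W * p = W" "q * W = W"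
proof -
  obtain X where X: "X \<in> M" "q * X * p \<noteq> 0"
    by (rule connecting_element[OF p q]) blast
  define Y where "Y = q * X * p"
  have Y: "Y \<in> M" "Y \<noteq> 0" using X p q M_closed by (auto simp: Y_def)
  have Yp: "Y * p = Y" and qY: "q * Y = Y"
    using p q by (auto simp: Y_def mult.assoc proj_idem proj_idem_left)
  obtain R where R: "pos R" "R * R = star Y * Y"
    "\<And>Z. Z * (star Y * Y) = star Y * Y * Z \<Longrightarrow> Z * R = R * Z"
    by (rule sqrt_exists[of Y]) blast
  have sR: "star R = R" using R(1) by (rule pos_self_adjoint)
  have "star Y * Y \<in> M" by (intro M_closed Y)
  then have RM: "R \<in> M" by (intro M_memI R(3)) (simp add: cmt_def)
  have "R \<noteq> 0" using R(2) Y star_mult_self_eq_0 by force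
  \<comment> \<open>If \<open>f\<close> were 0, the form bound would give
    \<open>norm R \<le> 2 * d\<close>; any divisor above 2 excludes this.\<close>
  define d where "d = norm R / 3"
  have d: "0 < d" using \<open>R \<noteq> 0\<close> by (simp add: d_def)
  have "star (R - d *\<^sub>R 1) = R - d *\<^sub>R 1" by (simp add: sR)
  then obtain e where e: "proj e" "\<And>X. X * (R - d *\<^sub>R 1) = (R - d *\<^sub>R 1) * X \<Longrightarrow> X * e = e * X"
    "\<And>x. Re (cinner ((R - d *\<^sub>R 1) \<cdot> e \<cdot> x) (e \<cdot> x)) \<le> 0"
    "\<And>x. 0 \<le> Re (cinner ((R - d *\<^sub>R 1) \<cdot> (1 - e) \<cdot> x) ((1 - e) \<cdot> x))"
    by (rule spectral_split) blast
  define f where "f = 1 - e"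
  have f: "proj f" unfolding f_def using e(1) by (rule proj_compl)
  have comm: "X * f = f * X" if "X * R = R * X" for X
    using e(2)[of X] that by (simp add: f_def algebra_simps)
  have Rf: "R * f = f * R" by (rule comm) simp
  have fM: "f \<in> M" by (intro M_memI comm) (simp add: cmt_def RM)
  have "f \<noteq> 0"
  proof
    assume "f = 0"
    then have "e = 1" by (simp add: f_def)
    then have "Re (cinner (R \<cdot> x) x) \<le> d * (norm x)\<^sup>2" for x
      using e(3)[of x] by (simp add: cinner_diff_left cinner_scaleR_left cinner_self)
    moreover have "norm (cinner (R \<cdot> x) x) = Re (cinner (R \<cdot> x) x)" for x
      using R(1) cinner_self_adjoint_real[OF sR, of x] unfolding pos_iff_self_adjoint
      by (metis abs_of_nonneg norm_of_real)
    ultimately have "norm R \<le> 2 * d"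
      using d by (intro norm_le_of_quadratic_form) auto
    then show False using d by (simp add: d_def)
  qed
  \<comment> \<open>\<open>T\<close> agrees with \<open>R\<close> on the range of \<open>f\<close>
    and with \<open>d\<close> on the complement. It is thus invertible, and its inverse
    \<open>G\<close> inverts \<open>R\<close> on the range of \<open>f\<close>.\<close>
  define T where "T = f * R * f + d *\<^sub>R (1 - f)"
  have "d * (norm x)\<^sup>2 \<le> Re (cinner (T \<cdot> x) x)" for x
  proof -
    have "cinner (T \<cdot> x) x = cinner (R \<cdot> f \<cdot> x) (f \<cdot> x) + of_real d * cinner ((1 - f) \<cdot> x) x"
      using cinner_star[of f "R \<cdot> f \<cdot> x" x] proj_star[OF f]
      by (simp add: T_def cinner_add_left cinner_diff_left cinner_scaleR_left)
    then have "Re (cinner (T \<cdot> x) x) = Re (cinner (R \<cdot> f \<cdot> x) (f \<cdot> x)) + d * Re (cinner ((1 - f) \<cdot> x) x)"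
      by simp
    moreover have "d * (norm (f \<cdot> x))\<^sup>2 \<le> Re (cinner (R \<cdot> f \<cdot> x) (f \<cdot> x))"
      using e(4)[of x, folded f_def] by (simp add: cinner_diff_left cinner_scaleR_left cinner_self)
    moreover have "(norm x)\<^sup>2 = (norm (f \<cdot> x))\<^sup>2 + Re (cinner ((1 - f) \<cdot> x) x)"
      using norm_sq_proj[OF f, of x] by (simp add: cinner_diff_left cinner_self)
    ultimately show ?thesis by (simp add: algebra_simps)
  qed
  then obtain G where G: "G * T = 1" "T * G = 1"
    using inverse_of_strictly_accretive[OF d] by blast
  have TM: "T \<in> M" unfolding T_def by (intro M_closed fM RM)
  have GM: "G \<in> M"
    using inverse_commute[OF G] TM by (intro M_memI) (simp add: cmt_def)
  have sT: "star T = T" using f by (simp add: T_def sR proj_def mult.assoc)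
  have sG: "star G = G"
  proof -
    have "star (G * T) = 1" using G by simp
    then have "T * star G = 1" by (simp add: sT)
    then have "G * (T * star G) = G" by simp
    then show ?thesis using G by (simp flip: mult.assoc)
  qed
  have RT: "R * T = T * R"
    by (simp add: T_def algebra_simps) (metis Rf mult.assoc)
  have RG: "R * G = G * R" using inverse_commute[OF G RT] .
  have "T * f = R * f"
    using f Rf by (simp add: T_def algebra_simps proj_idem proj_idem_left mult.assoc)
  then have GRf: "G * (R * f) = f"
    using G(1) by (metis mult.assoc mult_1)
  define W where "W = Y * G * f"
  have WW: "star W * W = f"
  proof -
    have "star W * W = f * G * (star Y * Y) * G * f"
      using f by (simp add: W_def sG proj_def mult.assoc)
    also have "\<dots> = f * G * R * (R * G) * f"
      by (simp add: R(2)[symmetric] mult.assoc)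
    also have "\<dots> = f * (G * (R * (G * (R * f))))"
      by (simp add: RG mult.assoc)
    also have "\<dots> = f" using f by (simp add: GRf proj_idem)
    finally show ?thesis .
  qed
  \<comment> \<open>\<open>R\<close> vanishes off \<open>p\<close> because \<open>Y\<close> does,
    and \<open>f\<close> factors through \<open>R\<close> as \<open>f = f * (G * R)\<close>.\<close>
  have fp: "f * p = f"
  proof -
    have "star (R * (1 - p)) * (R * (1 - p)) = star (1 - p) * (star Y * (Y * (1 - p)))"
      by (simp add: sR mult.assoc) (metis R(2) mult.assoc)
    also have "\<dots> = 0" by (simp add: algebra_simps Yp)
    finally have "R * (1 - p) = 0" by (rule star_mult_self_eq_0)
    then have Rp: "R * p = R" by (simp add: algebra_simps)
    have "f = G * R * f" by (simp add: GRf mult.assoc)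
    also have "G * R * f = f * (G * R)"
    proof -
      have "f * T = T * f" using f by (simp add: T_def algebra_simps proj_idem proj_idem_left mult.assoc)
      then have "f * G = G * f" by (rule inverse_commute[OF G])
      then show ?thesis by (metis Rf mult.assoc)
    qed
    finally have ff: "f = f * (G * R)" .
    have "f * (G * R) * p = f * (G * R)" by (simp add: mult.assoc Rp)
    then show ?thesis using ff by simp
  qed
  have "W \<in> M" unfolding W_def by (intro M_closed Y GM fM)
  moreover have "W \<noteq> 0" using WW \<open>f \<noteq> 0\<close> by auto
  moreover have "proj (star W * W)" using WW f by simp
  moreover have "W * p = W" by (simp add: W_def mult.assoc fp)
  moreover have "q * W = W" by (simp add: W_def qY flip: mult.assoc)
  ultimately show ?thesis using that by blast
qed

end

section \<open>Partial isometries and their increasing limits\<close>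

lemma partial_isometry_mult:
  assumes "proj (star W * W)"
  shows "W * (star W * W) = W" "star W * W * star W = star W"
proof -
  have "star (W * (1 - star W * W)) * (W * (1 - star W * W)) = 0"
    using proj_idem[OF assms] by (simp add: algebra_simps)
  then have "W * (1 - star W * W) = 0" by (rule star_mult_self_eq_0)
  then show 1: "W * (star W * W) = W" by (simp add: algebra_simps)
  have "star (W * (star W * W)) = star W" using 1 by simp
  then show "star W * W * star W = star W" by (simp add: mult.assoc)
qed

lemma proj_range: "proj (star W * W) \<Longrightarrow> proj (W * star W)"
  using partial_isometry_mult[of W] by (simp add: proj_def mult.assoc)

lemma partial_isometry_norm:
  assumes "proj (star W * W)"
  shows "norm (W \<cdot> x) \<le> norm x"
proof -
  have "(norm (W \<cdot> x))\<^sup>2 = Re (cinner ((star W * W) \<cdot> x) x)"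
    by (simp add: power2_norm_cinner cinner_star)
  also have "\<dots> = (norm ((star W * W) \<cdot> x))\<^sup>2"
    by (rule norm_sq_proj[OF assms, symmetric])
  also have "\<dots> \<le> (norm x)\<^sup>2"
    by (intro power_mono proj_norm_app assms norm_ge_zero)
  finally show ?thesis by (rule power2_le_imp_le) simp
qed

text \<open>For \<open>n \<le> m\<close>, \<open>W m - W n\<close> is \<open>W m\<close> times the
  difference of the initial projections \<open>f m\<close> and \<open>f n\<close>, so strong
  convergence of the increasing \<open>f n\<close> carries over.\<close>

lemma partial_isometry_chain_limit:
  fixes W :: "nat \<Rightarrow> 'h :: complex_hilbert cop"
  assumes p: "\<And>n. proj (star (W n) * W n)" and inc: "\<And>n. W (Suc n) * (star (W n) * W n) = W n"
  obtains V where "proj (star V * V)" "\<And>x. (\<lambda>n. W n \<cdot> x) \<longlonglongrightarrow> V \<cdot> x"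
    "\<And>n. V * (star (W n) * W n) = W n"
proof -
  define f where "f n = star (W n) * W n" for n
  have pf: "proj (f n)" for n using p by (simp add: f_def)
  have inc': "W (Suc n) * f n = W n" for n using inc by (simp add: f_def)
  have ff: "f n * f (Suc n) = f n" for n
  proof -
    have "f n = star (W (Suc n) * f n) * (W (Suc n) * f n)" by (simp add: inc') (simp add: f_def)
    also have "\<dots> = f n * f (Suc n) * f n"
      using pf[of n] by (simp add: proj_def f_def mult.assoc)
    finally have "f (Suc n) * f n = f n" by (intro proj_le_of_compression[OF pf pf]) simp
    then show ?thesis by (rule proj_le(1)[OF pf pf])
  qed
  have le: "f m * f n = f m" "f n * f m = f m" if "m \<le> n" for m n
  proof -
    show 1: "f m * f n = f m" by (rule increasing_proj_le[of f, OF pf ff that])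
    show "f n * f m = f m" using arg_cong[OF 1, of star] pf by (simp add: proj_def)
  qed
  have Wle: "W n * f m = W m" if "m \<le> n" for m n
    using that
  proof (induction n rule: dec_induct)
    case base
    then show ?case unfolding f_def by (rule partial_isometry_mult[OF p])
  next
    case (step n)
    then show ?case using inc'[of n] le(2)[of m n] by (metis mult.assoc)
  qed
  obtain P where P: "proj P" "\<And>x. (\<lambda>n. f n \<cdot> x) \<longlonglongrightarrow> P \<cdot> x" "\<And>n. f n * P = f n"
    by (rule increasing_proj_limit[of f, OF pf ff]) blast
  have "Cauchy (\<lambda>n. W n \<cdot> x)" for x
  proof (rule metric_CauchyI)
    fix e :: real assume e: "0 < e"
    have "Cauchy (\<lambda>n. f n \<cdot> x)" using P(2) LIMSEQ_imp_Cauchy by blast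
    then obtain N where N: "\<And>m n. N \<le> m \<Longrightarrow> N \<le> n \<Longrightarrow> dist (f m \<cdot> x) (f n \<cdot> x) < e"
      using e metric_CauchyD by blast
    have "dist (W m \<cdot> x) (W n \<cdot> x) < e" if "N \<le> n" "n \<le> m" for m n
    proof -
      have "W m \<cdot> ((f m \<cdot> x) - (f n \<cdot> x)) = (W m * f m) \<cdot> x - (W m * f n) \<cdot> x" by simp
      also have "\<dots> = (W m \<cdot> x) - (W n \<cdot> x)" using Wle that by simp
      finally have "norm ((W m \<cdot> x) - (W n \<cdot> x)) \<le> norm ((f m \<cdot> x) - (f n \<cdot> x))"
        by (metis partial_isometry_norm p)
      then show ?thesis using N[of m n] that by (simp add: dist_norm)
    qed
    then show "\<exists>M. \<forall>m\<ge>M. \<forall>n\<ge>M. dist (W m \<cdot> x) (W n \<cdot> x) < e"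
      by (metis dist_commute nle_le)
  qed
  moreover have "norm (W n) \<le> 1" for n
    using partial_isometry_norm[OF p] by (intro norm_cop_bound) auto
  ultimately obtain V where V: "\<And>x. (\<lambda>n. W n \<cdot> x) \<longlonglongrightarrow> V \<cdot> x"
    using strong_limit_exists[of W] by blast
  have "star V * V = P"
  proof (rule cop_eqI, rule cinner_eqI)
    fix x y
    have "(\<lambda>n. cinner (W n \<cdot> x) (W n \<cdot> y)) \<longlonglongrightarrow> cinner (V \<cdot> x) (V \<cdot> y)"
      "(\<lambda>n. cinner x (f n \<cdot> y)) \<longlonglongrightarrow> cinner x (P \<cdot> y)"
      by (intro tendsto_cinner tendsto_const V P)+
    moreover have "cinner (W n \<cdot> x) (W n \<cdot> y) = cinner x (f n \<cdot> y)" for n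
      by (simp add: f_def cinner_star)
    ultimately show "cinner x ((star V * V) \<cdot> y) = cinner x (P \<cdot> y)"
      using LIMSEQ_unique by (simp add: cinner_star)
  qed
  moreover have "V * f m = W m" for m
  proof (rule cop_eqI)
    fix x
    have "(\<lambda>n. W n \<cdot> f m \<cdot> x) \<longlonglongrightarrow> V \<cdot> f m \<cdot> x" by (rule V)
    moreover have "\<forall>\<^sub>F n in sequentially. W n \<cdot> f m \<cdot> x = W m \<cdot> x"
      using Wle by (auto simp: eventually_sequentially simp flip: app_simps(1) intro!: exI[of _ m])
    ultimately show "(V * f m) \<cdot> x = W m \<cdot> x"
      using LIMSEQ_unique tendsto_eventually by (metis app_simps(1))
  qed
  ultimately show ?thesis using that[of V] V P(1) unfolding f_def by metis
qed

context tracial_factor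
begin

text \<open>Take partial isometries from below \<open>p\<close> into \<open>q\<close>, ordered by
  extension, and among them one of maximal initial trace. If it left a part of \<open>p\<close>
  over, equality of the traces would leave a part of \<open>q\<close> over as well, and a partial
  isometry between the remainders would extend it.\<close>

lemma comparison:
  assumes p: "p \<in> M" "proj p" and q: "q \<in> M" "proj q" and eq: "tr p = tr q"
  obtains W where "W \<in> M" "star W * W = p" "W * star W = q"
proof -
  define C where "C = {W \<in> M. proj (star W * W) \<and> W * p = W \<and> q * W = W}"
  \<comment> \<open>\<open>W'\<close> extends \<open>W\<close>: the two agree on the initial space
    of \<open>W\<close>.\<close>
  define R where "R W W' \<longleftrightarrow> W' * (star W * W) = W" for W W' :: "'h cop"
  define f where "f W = star W * W" for W :: "'h cop"
  have fM: "f W \<in> M" "proj (f W)" if "W \<in> C" for W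
    using that M_closed by (auto simp: C_def f_def)
  have Rf: "f W' * f W = f W" if "W \<in> C" "W' \<in> C" "R W W'" for W W'
  proof -
    have "f W = star (W' * f W) * (W' * f W)"
      using that(3) by (simp add: R_def f_def)
    also have "\<dots> = f W * f W' * f W"
      using fM(2)[OF that(1)] by (simp add: proj_def f_def mult.assoc)
    finally show ?thesis by (intro proj_le_of_compression[OF fM(2)[OF that(1)] fM(2)[OF that(2)]]) simp
  qed
  have fp: "p * f W = f W" "f W * p = f W" if "W \<in> C" for W
  proof -
    show 1: "f W * p = f W" using that by (simp add: f_def C_def mult.assoc)
    have "star (f W * p) = star (f W)" using 1 by simp
    then show "p * f W = f W" using fM(2)[OF that] p by (simp add: proj_def)
  qed
  obtain W where W: "W \<in> C" and max: "\<And>Z. Z \<in> C \<Longrightarrow> R W Z \<Longrightarrow> tr (f Z) = tr (f W)"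
  proof (rule greedy_maximal[of 0 C R "\<lambda>W. tr (f W)" "tr p"])
    show "0 \<in> C" using M_closed by (simp add: C_def)
    show "R W W" if "W \<in> C" for W
      using that partial_isometry_mult(1)[of W] by (simp add: R_def C_def)
    show "R W Z" if "W \<in> C" "V \<in> C" "Z \<in> C" "R W V" "R V Z" for W V Z
      using that Rf[of W V] by (simp add: R_def f_def) (metis mult.assoc)
    show "tr (f W) \<le> tr (f V)" if "W \<in> C" "V \<in> C" "R W V" for W V
      using that by (intro tr_mono fM Rf)
    show "tr (f W) \<le> tr p" if "W \<in> C" for W
      using that p by (intro tr_mono fM fp) auto
    show "\<exists>u\<in>C. \<forall>n. R (s n) u" if s: "\<And>n. s n \<in> C" "\<And>n. R (s n) (s (Suc n))" for s
    proof -
      have "\<And>n. proj (star (s n) * s n)" "\<And>n. s (Suc n) * (star (s n) * s n) = s n"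
        using s by (auto simp: C_def R_def)
      then obtain V where V: "proj (star V * V)" "\<And>x. (\<lambda>n. s n \<cdot> x) \<longlonglongrightarrow> V \<cdot> x"
        "\<And>n. V * (star (s n) * s n) = s n"
        by (rule partial_isometry_chain_limit[of s]) blast
      have "V \<in> M" by (rule vna_strong_limit[OF vna_M _ V(2)]) (use s in \<open>auto simp: C_def\<close>)
      moreover have "V * p = V"
      proof (rule cop_eqI)
        fix x
        have "s n \<cdot> p \<cdot> x = s n \<cdot> x" for n using s(1)[of n] by (simp add: C_def flip: app_simps(1))
        then have "(\<lambda>n. s n \<cdot> x) \<longlonglongrightarrow> V \<cdot> p \<cdot> x" using V(2)[of "p \<cdot> x"] by simp
        then show "(V * p) \<cdot> x = V \<cdot> x" using V(2) LIMSEQ_unique by (metis app_simps(1))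
      qed
      moreover have "q * V = V"
      proof (rule cop_eqI)
        fix x
        have "q \<cdot> s n \<cdot> x = s n \<cdot> x" for n using s(1)[of n] by (simp add: C_def flip: app_simps(1))
        then have "(\<lambda>n. s n \<cdot> x) \<longlonglongrightarrow> q \<cdot> V \<cdot> x" using tendsto_app[OF V(2), of q x] by simp
        then show "(q * V) \<cdot> x = V \<cdot> x" using V(2) LIMSEQ_unique by (metis app_simps(1))
      qed
      ultimately show ?thesis using V by (auto simp: C_def R_def)
    qed
  qed blast
  have WM: "W \<in> M" and Wpi: "proj (star W * W)" and Wp: "W * p = W" and qW: "q * W = W"
    using W by (auto simp: C_def)
  have g: "proj (W * star W)" by (rule proj_range[OF Wpi])
  have gq: "q * (W * star W) = W * star W" using qW by (simp flip: mult.assoc)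
  have Wsq: "star W * q = star W"
    using q(2) arg_cong[OF qW, of star] by (simp add: proj_def)
  define p0 where "p0 = p - f W"
  define q0 where "q0 = q - W * star W"
  have p0: "p0 \<in> M" "proj p0" and q0: "q0 \<in> M" "proj q0"
    unfolding p0_def q0_def using proj_le(2)[OF fM(2)[OF W] p(2) fp(1)[OF W]] proj_le(2)[OF g q(2) gq]
    by (auto intro!: M_closed WM p q fM[OF W])
  \<comment> \<open>By traciality initial and final projection have equal trace, so the remainders
    \<open>p0\<close> and \<open>q0\<close> do as well.\<close>
  have "tr (W * star W) = tr (f W)"
    using tau_commute[of W "star W"] M_closed WM by (simp add: tr_def f_def)
  then have tr0: "tr q0 = tr p0"
    unfolding p0_def q0_def using eq WM M_closed p q fM[OF W] by (simp add: tr_diff)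
  have "p0 = 0"
  proof (rule ccontr)
    assume n: "p0 \<noteq> 0"
    then have n': "q0 \<noteq> 0" using tr0 tr_eq_0[OF p0] by (auto simp: tr_def tau_0)
    obtain V where V: "V \<in> M" "V \<noteq> 0" "proj (star V * V)" "V * p0 = V" "q0 * V = V"
      by (rule connecting_partial_isometry[OF p0 n q0 n']) blast
    \<comment> \<open>The final spaces of \<open>W\<close> and \<open>V\<close> are orthogonal, and
      below also the initial spaces; this makes \<open>W + V\<close> a partial isometry.\<close>
    have "star W * q0 = 0"
      using Wsq partial_isometry_mult(2)[OF Wpi] by (simp add: q0_def algebra_simps)
    then have WV: "star W * V = 0" using V(5) by (metis mult.assoc mult_zero_left)
    have VW: "star V * W = 0" using arg_cong[OF WV, of star] by simp
    have "p0 * f W = 0" using fp(1)[OF W] proj_idem[OF fM(2)[OF W]] by (simp add: p0_def algebra_simps)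
    then have Vf: "V * f W = 0" using V(4) by (metis mult.assoc mult_zero_right)
    have fV: "f W * star V = 0" using arg_cong[OF Vf, of star] proj_star[OF fM(2)[OF W]] by simp
    define Z where "Z = W + V"
    have fZ: "f Z = f W + f V" by (simp add: f_def Z_def algebra_simps WV VW)
    have "f W * f V = 0" "f V * f W = 0"
      using fV Vf by (simp_all add: f_def[of V]) (simp_all add: mult.assoc flip: mult.assoc[of "f W"])
    then have "proj (f Z)"
      using fM(2)[OF W] V(3) unfolding fZ by (simp add: proj_def algebra_simps f_def[of V])
    moreover have "p0 * p = p0" using fp(2)[OF W] p by (simp add: p0_def algebra_simps proj_idem)
    then have "V * p = V" using V(4) by (metis mult.assoc)
    moreover have "q * q0 = q0" using gq q by (simp add: q0_def algebra_simps proj_idem)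
    then have "q * V = V" using V(5) by (metis mult.assoc)
    ultimately have "Z \<in> C"
      using WM V M_closed Wp qW by (simp add: C_def Z_def f_def algebra_simps)
    moreover have "R W Z"
      using Vf partial_isometry_mult(1)[OF Wpi] by (simp add: R_def Z_def f_def algebra_simps)
    ultimately have "tr (f Z) = tr (f W)" by (rule max)
    then have "tr (f V) = 0"
      unfolding fZ using fM[OF W] V M_closed by (simp add: tr_add f_def)
    then have "star V * V = 0" using V M_closed by (intro tr_eq_0) (auto simp: f_def)
    then show False using V(2) star_mult_self_eq_0 by blast
  qed
  moreover from this have "q0 = 0"
    using tr0 tr_eq_0[OF q0] by (simp add: tr_def tau_0)
  ultimately show ?thesis using that WM by (auto simp: p0_def q0_def f_def)
qed

end

section \<open>Projections of prescribed trace in a maximal abelian subalgebra\<close>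

context tracial_factor
begin

text \<open>Order bounds for the compressed real and imaginary part contribute
  \<open>norm X * tr e\<close> each. The factor \<open>tr e\<close> is what makes traces normalised
  over a small projection comparable with norms.\<close>

lemma norm_tau_mult_proj:
  assumes X: "X \<in> M" and e: "e \<in> M" "proj e"
  shows "norm (\<tau> (X * e)) \<le> 2 * norm X * tr e"
proof -
  have sa: "norm (\<tau> (e * H * e)) \<le> c * tr e" if H: "H \<in> M" "star H = H" "norm H \<le> c" for H c
  proof -
    have M: "e * H * e \<in> M" "c *\<^sub>R e \<in> M" using H e by (intro M_closed; simp)+
    have "pos (star e * (c *\<^sub>R 1 - H) * e)" "pos (star e * (c *\<^sub>R 1 + H) * e)"
      using pos_norm_minus[OF H(2,3)] by (auto intro: pos_conj)
    then have "pos (c *\<^sub>R e - e * H * e)" "pos (c *\<^sub>R e + e * H * e)"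
      using e by (simp_all add: proj_def algebra_simps)
    then have "\<tau> (c *\<^sub>R e - e * H * e) \<in> \<real>\<^sub>\<ge>\<^sub>0" "\<tau> (c *\<^sub>R e + e * H * e) \<in> \<real>\<^sub>\<ge>\<^sub>0"
      using M by (auto intro!: tau_pos M_closed)
    moreover have "\<tau> (c *\<^sub>R e) = of_real (c * tr e)" using e by (simp add: tau_scaleR tau_proj)
    ultimately have "Im (\<tau> (e * H * e)) = 0" "\<bar>Re (\<tau> (e * H * e))\<bar> \<le> c * tr e"
      using M by (auto simp: tau_diff tau_add complex_nonneg_Reals_iff abs_le_iff)
    then show ?thesis by (simp add: cmod_eq_Re)
  qed
  define H where "H = (1/2) *\<^sub>R (X + star X)"
  define K where "K = (- \<i> / 2) *\<^sub>C (X - star X)"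
  have M: "H \<in> M" "K \<in> M" unfolding H_def K_def using X by (intro M_closed; simp)+
  have s: "star H = H" "star K = K" by (simp_all add: H_def K_def add.commute scaleC_cop_simps)
  have n: "norm H \<le> norm X" "norm K \<le> norm X"
    using norm_triangle_ineq[of X "star X"] norm_triangle_ineq4[of X "star X"]
    by (simp_all add: H_def K_def norm_scaleC_cop)
  have decomp: "X = H + \<i> *\<^sub>C K" unfolding H_def K_def by (rule scaleC_decomp)
  have "\<tau> (X * e) = \<tau> (e * X * e)"
    using tau_commute[of "X * e" e] X e M_closed by (simp add: mult.assoc proj_idem)
  also have "e * X * e = e * H * e + \<i> *\<^sub>C (e * K * e)"
    using decomp by (simp add: algebra_simps)
  also have "\<tau> \<dots> = \<tau> (e * H * e) + \<i> * \<tau> (e * K * e)"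
    using M e by (simp add: tau_add tau_scaleC M_closed)
  also have "norm \<dots> \<le> norm X * tr e + norm X * tr e"
    using sa[OF M(1) s(1) n(1)] sa[OF M(2) s(2) n(2)]
    by (intro order.trans[OF norm_triangle_ineq] add_mono) (auto simp: norm_mult)
  finally show ?thesis by simp
qed

end

text \<open>Maximality of the abelian algebra enters as \<open>A = M \<inter> cmt A\<close>, and the
  type of the factor as the absence of nonzero abelian projections.\<close>

locale masa_factor = tracial_factor M \<tau>
  for M :: "'h :: complex_hilbert cop set" and \<tau> +
  fixes A :: "'h cop set" and E :: "'h cop \<Rightarrow> 'h cop"
  assumes A_sub: "A \<subseteq> M"
    and A_masa: "A = M \<inter> cmt A"
    and A_star: "X \<in> A \<Longrightarrow> star X \<in> A"
    and no_abelian_projection: "p \<in> M \<Longrightarrow> proj p \<Longrightarrow>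
      (\<And>X Y. X \<in> M \<Longrightarrow> Y \<in> M \<Longrightarrow> (p * X * p) * (p * Y * p) = (p * Y * p) * (p * X * p)) \<Longrightarrow> p = 0"
    and E_add: "X \<in> M \<Longrightarrow> Y \<in> M \<Longrightarrow> E (X + Y) = E X + E Y"
    and E_scaleC: "X \<in> M \<Longrightarrow> E (c *\<^sub>C X) = c *\<^sub>C E X"
    and E_in: "X \<in> M \<Longrightarrow> E X \<in> A"
    and E_pos: "X \<in> M \<Longrightarrow> pos X \<Longrightarrow> pos (E X)"
    and E_id: "X \<in> A \<Longrightarrow> E X = X"
    and E_module: "X \<in> M \<Longrightarrow> Y \<in> A \<Longrightarrow> Z \<in> A \<Longrightarrow> E (Y * X * Z) = Y * E X * Z"
    and E_tau: "X \<in> M \<Longrightarrow> \<tau> (E X) = \<tau> X"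
begin

lemma A_commute: "X \<in> A \<Longrightarrow> Y \<in> A \<Longrightarrow> X * Y = Y * X"
  using A_masa by (auto simp: cmt_def)

text \<open>The bicommutant of \<open>A\<close> lies in \<open>cmt A\<close>, since \<open>A\<close>
  is commutative, and in the bicommutant of \<open>M\<close>; hence it lies in
  \<open>M \<inter> cmt A = A\<close>.\<close>

lemma vna_A: "vna A"
proof -
  have "A \<subseteq> cmt A" using A_masa by blast
  then have "cmt (cmt A) \<subseteq> cmt A" by (rule cmt_anti)
  moreover have "cmt (cmt A) \<subseteq> cmt (cmt M)" by (intro cmt_anti A_sub)
  ultimately have "cmt (cmt A) \<subseteq> A" using A_masa vna_M by (auto simp: vna_def)
  then show ?thesis using A_star subset_cmt_cmt by (auto simp: vna_def)
qed

lemmas A_closed = vna_0[OF vna_A] vna_1[OF vna_A] vna_add[OF vna_A] vna_diff[OF vna_A]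
  vna_mult[OF vna_A] vna_scaleC[OF vna_A] vna_scaleR[OF vna_A] vna_star[OF vna_A] vna_sum[OF vna_A]

lemma A_M: "X \<in> A \<Longrightarrow> X \<in> M"
  using A_sub by blast

lemma A_memI: "X \<in> M \<Longrightarrow> (\<And>Y. Y \<in> A \<Longrightarrow> X * Y = Y * X) \<Longrightarrow> X \<in> A"
  using A_masa by (auto simp: cmt_def)

lemma E_diff: "X \<in> M \<Longrightarrow> Y \<in> M \<Longrightarrow> E (X - Y) = E X - E Y"
  using E_add[of "X - Y" Y] M_closed by simp

lemma E_sum: "(\<And>i. i \<in> I \<Longrightarrow> f i \<in> M) \<Longrightarrow> E (\<Sum>i\<in>I. f i) = (\<Sum>i\<in>I. E (f i))"
proof (induction I rule: infinite_finite_induct)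
  case (insert i I)
  then show ?case by (simp add: E_add M_closed)
qed (auto simp: E_id A_closed)

text \<open>Real and imaginary part give a factor 2, and passing from the quadratic form to the norm
  gives another. The constant is not sharp, but any fixed one serves.\<close>

lemma norm_E:
  assumes X: "X \<in> M"
  shows "norm (E X) \<le> 4 * norm X"
proof -
  have sa: "norm (cinner (E H \<cdot> x) x) \<le> c * (norm x)\<^sup>2" if H: "H \<in> M" "star H = H" "norm H \<le> c" for H c x
  proof -
    have M: "c *\<^sub>R 1 \<in> M" by (intro M_closed)
    have c1: "E (c *\<^sub>R 1) = c *\<^sub>R 1" by (intro E_id A_closed)
    have "pos (E (c *\<^sub>R 1 - H))" "pos (E (c *\<^sub>R 1 + H))"
      using pos_norm_minus[OF H(2,3)] by (auto intro!: E_pos M_closed H M)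
    then have p: "pos (c *\<^sub>R 1 - E H)" "pos (c *\<^sub>R 1 + E H)"
      using M H by (simp_all add: E_diff E_add c1)
    then have "cinner ((c *\<^sub>R 1 - E H) \<cdot> x) x \<in> \<real>\<^sub>\<ge>\<^sub>0" "cinner ((c *\<^sub>R 1 + E H) \<cdot> x) x \<in> \<real>\<^sub>\<ge>\<^sub>0"
      by (simp_all add: pos_def)
    then have "Im (cinner (E H \<cdot> x) x) = 0" "\<bar>Re (cinner (E H \<cdot> x) x)\<bar> \<le> c * (norm x)\<^sup>2"
      by (simp_all add: cinner_diff_left cinner_add_left cinner_scaleR_left cinner_self
          complex_nonneg_Reals_iff abs_le_iff flip: of_real_power)
    then show ?thesis by (simp add: cmod_eq_Re)
  qed
  define H where "H = (1/2) *\<^sub>R (X + star X)"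
  define K where "K = (- \<i> / 2) *\<^sub>C (X - star X)"
  have M: "H \<in> M" "K \<in> M" unfolding H_def K_def using X by (intro M_closed; simp)+
  have s: "star H = H" "star K = K" by (simp_all add: H_def K_def add.commute scaleC_cop_simps)
  have n: "norm H \<le> norm X" "norm K \<le> norm X"
    using norm_triangle_ineq[of X "star X"] norm_triangle_ineq4[of X "star X"]
    by (simp_all add: H_def K_def norm_scaleC_cop)
  have "X = H + \<i> *\<^sub>C K" unfolding H_def K_def by (rule scaleC_decomp)
  then have EX: "E X = E H + \<i> *\<^sub>C E K" using M M_closed(6) by (simp add: E_add E_scaleC)
  have "norm (cinner (E X \<cdot> x) x) \<le> (2 * norm X) * (norm x)\<^sup>2" for x
  proof -
    have "cinner (E X \<cdot> x) x = cinner (E H \<cdot> x) x + \<i> * cinner (E K \<cdot> x) x"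
      by (simp add: EX cinner_add_left cinner_scaleC_left)
    also have "norm \<dots> \<le> norm X * (norm x)\<^sup>2 + norm X * (norm x)\<^sup>2"
      using sa[OF M(1) s(1) n(1), of x] sa[OF M(2) s(2) n(2), of x]
      by (intro order.trans[OF norm_triangle_ineq] add_mono) (auto simp: norm_mult)
    finally show ?thesis by simp
  qed
  then have "norm (E X) \<le> 2 * (2 * norm X)"
    by (intro norm_le_of_quadratic_form) auto
  then show ?thesis by simp
qed

text \<open>On a minimal projection of \<open>A\<close> every element of \<open>A\<close> acts as a scalar, so the compression of
  \<open>M\<close> to it commutes with \<open>A\<close> and lies in \<open>A\<close>.\<close>

lemma proper_subprojection:
  assumes e: "e \<in> A" "proj e" "e \<noteq> 0"
  obtains f where "f \<in> A" "proj f" "e * f = f" "f \<noteq> 0" "f \<noteq> e"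
proof -
  have "\<exists>f\<in>A. proj f \<and> e * f = f \<and> f \<noteq> 0 \<and> f \<noteq> e"
  proof (rule ccontr)
    assume "\<not> ?thesis"
    then have min: "f = 0 \<or> f = e" if "f \<in> A" "proj f" "e * f = f" for f using that by blast
    have "e * X * e \<in> A" if X: "X \<in> M" for X
    proof (rule A_memI)
      define Z where "Z = e * X * e"
      show "e * X * e \<in> M" using X e A_M by (intro M_closed) auto
      fix S assume S: "S \<in> A"
      have Ze: "Z * e = Z" "e * Z = Z" using e by (simp_all add: Z_def mult.assoc proj_idem proj_idem_left)
      have eS: "e * S = S * e" using e S A_commute by blast
      have "norm (Z * S - S * Z) \<le> 0 + \<eta>" if "0 < \<eta>" for \<eta>
      proof -
        \<comment> \<open>The commutator will cost \<open>2 * norm Z * d\<close>; the added 1 keeps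
          the denominator positive.\<close>
        define d where "d = \<eta> / (2 * norm Z + 1)"
        have "0 < 2 * norm Z + 1" by (simp add: add_nonneg_pos)
        then have d: "0 < d" "d * (2 * norm Z + 1) = \<eta>" using that by (auto simp: d_def)
        obtain F where F: "F \<subseteq> A" "ortho F" "\<Sum>F = 1" "\<forall>f\<in>F. \<exists>l. norm (S * f - l *\<^sub>C f) \<le> d"
          using normal_approx[OF vna_A A_commute S d(1)] by blast
        obtain f where f: "f \<in> F" "e * f \<noteq> 0" by (rule partition_meets[OF F(3) e(3)])
        have fA: "f \<in> A" "proj f" using f F by (auto simp: ortho_def)
        \<comment> \<open>By minimality the block \<open>f\<close> that meets \<open>e\<close>
          contains it, so on \<open>e\<close> the element \<open>S\<close> is within
          \<open>d\<close> of a scalar.\<close>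
        have "proj (e * f)" by (rule proj_mult[OF e(2) fA(2) A_commute[OF e(1) fA(1)]])
        then have "e * f = e"
          using min[OF vna_mult[OF vna_A e(1) fA(1)] _ proj_idem_left[OF e(2)]] f(2) by blast
        then have fe: "f * e = e" using A_commute[OF e(1) fA(1)] by simp
        obtain l where l: "norm (S * f - l *\<^sub>C f) \<le> d" using F f by blast
        have "S * e - l *\<^sub>C e = (S * f - l *\<^sub>C f) * e"
          by (simp add: algebra_simps fe)
        also have "norm \<dots> \<le> d * 1"
          using l proj_norm[OF e(2)] d by (intro order.trans[OF norm_mult_ineq] mult_mono) auto
        finally have n: "norm (S * e - l *\<^sub>C e) \<le> d" by simp
        have "Z * S = Z * (e * S)" by (simp add: Ze flip: mult.assoc)
        moreover have "S * Z = (S * e) * Z" by (simp add: Ze mult.assoc)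
        ultimately have "Z * S - S * Z = Z * (S * e - l *\<^sub>C e) - (S * e - l *\<^sub>C e) * Z"
          by (simp add: eS algebra_simps Ze)
        also have "norm \<dots> \<le> norm (Z * (S * e - l *\<^sub>C e)) + norm ((S * e - l *\<^sub>C e) * Z)"
          by (rule norm_triangle_ineq4)
        also have "\<dots> \<le> norm Z * d + d * norm Z"
          using n by (intro add_mono order.trans[OF norm_mult_ineq] mult_left_mono mult_right_mono) auto
        also have "\<dots> \<le> \<eta>" using d by (simp add: algebra_simps)
        finally show ?thesis by simp
      qed
      then have "norm (Z * S - S * Z) \<le> 0" by (rule field_le_epsilon)
      then show "e * X * e * S = S * (e * X * e)" by (simp add: Z_def)
    qed
    \<comment> \<open>All compressions of \<open>M\<close> to \<open>e\<close> lie in the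
      commutative \<open>A\<close>, so \<open>e\<close> is an abelian projection.\<close>
    then have "e = 0"
      using e A_M A_commute by (intro no_abelian_projection) auto
    then show False using e by simp
  qed
  then show ?thesis using that by blast
qed

text \<open>Of a proper subprojection of \<open>g\<close> and its complement in \<open>g\<close>,
  one carries at most half of the trace; this can be repeated.\<close>

lemma small_subprojection:
  assumes e: "e \<in> A" "proj e" "e \<noteq> 0" and d: "0 < d"
  obtains g where "g \<in> A" "proj g" "e * g = g" "g \<noteq> 0" "tr g \<le> d"
proof -
  have "\<exists>g\<in>A. proj g \<and> e * g = g \<and> g \<noteq> 0 \<and> tr g \<le> tr e * (1/2) ^ n" for n
  proof (induction n)
    case 0
    then show ?case using e by (intro bexI[of _ e]) (auto simp: proj_idem)
  next
    case (Suc n)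
    then obtain g where g: "g \<in> A" "proj g" "e * g = g" "g \<noteq> 0" "tr g \<le> tr e * (1/2) ^ n" by blast
    obtain f where f: "f \<in> A" "proj f" "g * f = f" "f \<noteq> 0" "f \<noteq> g"
      by (rule proper_subprojection[OF g(1,2,4)])
    have gf: "g - f \<in> A" "proj (g - f)" "g - f \<noteq> 0"
      using f g proj_le(2)[OF f(2) g(2) f(3)] by (auto intro: A_closed)
    have ef: "e * f = f" by (metis f(3) g(3) mult.assoc)
    have "tr f + tr (g - f) = tr g" using f g by (simp add: tr_diff A_M)
    then have "tr f \<le> tr g / 2 \<or> tr (g - f) \<le> tr g / 2" by linarith
    then show ?case
    proof
      assume "tr f \<le> tr g / 2"
      then show ?thesis using f g ef by (intro bexI[of _ f]) auto
    next
      assume "tr (g - f) \<le> tr g / 2"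
      then show ?thesis using gf g ef by (intro bexI[of _ "g - f"]) (auto simp: right_diff_distrib)
    qed
  qed
  moreover have "(\<lambda>n. tr e * (1/2) ^ n) \<longlonglongrightarrow> tr e * 0"
    by (intro tendsto_mult tendsto_const LIMSEQ_realpow_zero) auto
  then have "\<forall>\<^sub>F n in sequentially. tr e * (1/2) ^ n < d"
    using d by (intro order_tendstoD) auto
  then obtain n where "tr e * (1/2) ^ n < d" by (auto simp: eventually_sequentially)
  ultimately show ?thesis using that by (meson less_imp_le order.trans)
qed

text \<open>A projection under \<open>e\<close> that is maximal among those of trace at most
  \<open>t\<close> attains \<open>t\<close>: otherwise a nonzero projection of small enough trace,
  taken under the rest of \<open>e\<close>, could be added to it.\<close>

lemma exact_trace:
  assumes e: "e \<in> A" "proj e" and t: "0 \<le> t" "t \<le> tr e"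
  obtains f where "f \<in> A" "proj f" "e * f = f" "tr f = t"
proof -
  define C where "C = {f \<in> A. proj f \<and> e * f = f \<and> tr f \<le> t}"
  obtain m where m: "m \<in> C" and max: "\<And>g. g \<in> C \<Longrightarrow> g * m = m \<Longrightarrow> tr g = tr m"
  proof (rule greedy_maximal[of 0 C "\<lambda>f g. g * f = f" tr t])
    show "0 \<in> C" using t by (simp add: C_def A_closed tr_def tau_0)
    show "f * f = f" if "f \<in> C" for f using that by (simp add: C_def proj_idem)
    show "h * f = f" if "g * f = f" "h * g = g" for f g h :: "'h cop"
    proof -
      have "h * f = (h * g) * f" by (simp only: mult.assoc that(1))
      also have "\<dots> = f" by (simp only: that)
      finally show ?thesis .
    qed
    show "tr f \<le> tr g" if "f \<in> C" "g \<in> C" "g * f = f" for f g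
      using that by (intro tr_mono A_M) (auto simp: C_def)
    show "tr f \<le> t" if "f \<in> C" for f using that by (simp add: C_def)
    show "\<exists>u\<in>C. \<forall>n. u * s n = s n" if s: "\<And>n. s n \<in> C" "\<And>n. s (Suc n) * s n = s n" for s
    proof -
      have ps: "proj (s n)" "s n \<in> A" for n using s by (auto simp: C_def)
      have inc: "s n * s (Suc n) = s n" for n by (rule proj_le(1)[OF ps(1) ps(1) s(2)])
      obtain P where P: "proj P" "\<And>x. (\<lambda>n. s n \<cdot> x) \<longlonglongrightarrow> P \<cdot> x" "\<And>n. s n * P = s n"
        by (rule increasing_proj_limit[of s, OF ps(1) inc]) blast
      have PA: "P \<in> A" by (rule vna_strong_limit[OF vna_A ps(2) P(2)])
      \<comment> \<open>Normality keeps the limit of the chain within the bound.\<close>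
      have "tr P \<le> t"
        unfolding tr_def
        by (rule tau_normal[of s, OF _ ps(1) inc A_M[OF PA] P(1,2)])
          (use s A_M in \<open>auto simp: C_def tr_def\<close>)
      moreover have "e * P = P"
      proof (rule cop_eqI)
        fix x
        have "e \<cdot> s n \<cdot> x = s n \<cdot> x" for n using s(1)[of n] by (simp add: C_def flip: app_simps(1))
        then have "(\<lambda>n. s n \<cdot> x) \<longlonglongrightarrow> e \<cdot> P \<cdot> x" using tendsto_app[OF P(2), of e x] by simp
        then show "(e * P) \<cdot> x = P \<cdot> x" using P(2) LIMSEQ_unique by (metis app_simps(1))
      qed
      ultimately have "P \<in> C" using PA P by (simp add: C_def)
      then show ?thesis using P(3) A_commute[OF PA ps(2)] by auto
    qed
  qed blast
  have mA: "m \<in> A" "proj m" "e * m = m" "tr m \<le> t" using m by (auto simp: C_def)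
  have "tr m = t"
  proof (rule ccontr)
    assume "tr m \<noteq> t"
    then have lt: "0 < t - tr m" using mA by simp
    have h: "e - m \<in> A" "proj (e - m)" using e mA proj_le(2) by (auto intro: A_closed)
    have "tr (e - m) = tr e - tr m" using e mA by (simp add: tr_diff A_M)
    then have "e - m \<noteq> 0" using lt t by (auto simp: tr_def tau_0)
    then obtain g where g: "g \<in> A" "proj g" "(e - m) * g = g" "g \<noteq> 0" "tr g \<le> t - tr m"
      by (rule small_subprojection[OF h _ lt])
    have eg: "e * g = g"
    proof -
      have "e * (e - m) = e - m" using e mA by (simp add: algebra_simps proj_idem)
      then show ?thesis using g(3) by (metis mult.assoc)
    qed
    then have mg: "m * g = 0" "g * m = 0" using g(3) A_commute[OF mA(1) g(1)] by (auto simp: algebra_simps)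
    have "m + g \<in> C"
      using mA g eg mg by (auto simp: C_def A_closed proj_def algebra_simps tr_add A_M)
    moreover have "(m + g) * m = m" using mA mg by (simp add: algebra_simps proj_idem)
    ultimately have "tr (m + g) = tr m" by (rule max)
    then have "tr g = 0" using mA g by (simp add: tr_add A_M)
    then show False using tr_eq_0 g A_M by blast
  qed
  then show ?thesis using that mA by blast
qed

lemma split_trace:
  assumes "finite S" "e \<in> A" "proj e" "\<And>v. v \<in> S \<Longrightarrow> 0 \<le> t v" "sum t S = tr e"
  shows "\<exists>D. (\<forall>v\<in>S. D v \<in> A \<and> proj (D v) \<and> tr (D v) = t v) \<and>
    (\<forall>v\<in>S. \<forall>w\<in>S. v \<noteq> w \<longrightarrow> D v * D w = 0) \<and> (\<Sum>v\<in>S. D v) = e"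
  using assms
proof (induction S arbitrary: e rule: finite_induct)
  case empty
  then show ?case using tr_eq_0 A_M by auto
next
  case (insert u S)
  have s0: "0 \<le> sum t S" using insert by (intro sum_nonneg) auto
  have "0 \<le> t u" "t u \<le> tr e" using insert s0 by auto
  then obtain f where f: "f \<in> A" "proj f" "e * f = f" "tr f = t u"
    by (rule exact_trace[OF insert(4,5)])
  have g: "e - f \<in> A" "proj (e - f)" using f insert proj_le(2) by (auto intro: A_closed)
  have "sum t S = tr (e - f)" using f insert by (simp add: tr_diff A_M)
  then obtain D where D: "\<forall>v\<in>S. D v \<in> A \<and> proj (D v) \<and> tr (D v) = t v"
    "\<forall>v\<in>S. \<forall>w\<in>S. v \<noteq> w \<longrightarrow> D v * D w = 0" "(\<Sum>v\<in>S. D v) = e - f"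
    using insert.IH[OF g] insert(6) by auto
  have Df: "D v * f = 0" "f * D v = 0" if v: "v \<in> S" for v
  proof -
    have "D v * (e - f) = (\<Sum>w\<in>S. D v * D w)" by (simp add: D(3)[symmetric] sum_distrib_left)
    also have "\<dots> = D v * D v + (\<Sum>w\<in>S - {v}. D v * D w)"
      using v insert(1) by (intro sum.remove)
    also have "(\<Sum>w\<in>S - {v}. D v * D w) = 0" using D(2) v by (intro sum.neutral) auto
    also have "D v * D v + 0 = D v" using D(1) v by (simp add: proj_idem)
    finally have "D v * f = D v * ((e - f) * f)" by (metis mult.assoc)
    also have "(e - f) * f = 0" using f by (simp add: algebra_simps proj_idem)
    finally show "D v * f = 0" by simp
    then show "f * D v = 0" using A_commute D v f by metis
  qed
  define D' where "D' = D(u := f)"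
  have "(\<Sum>v\<in>insert u S. D' v) = f + (\<Sum>v\<in>S. D v)"
    using insert(1,2) by (simp add: D'_def) (intro sum.cong, auto)
  then have "(\<Sum>v\<in>insert u S. D' v) = e" by (simp add: D(3))
  moreover have "\<forall>v\<in>insert u S. D' v \<in> A \<and> proj (D' v) \<and> tr (D' v) = t v"
    using D f by (auto simp: D'_def)
  moreover have "\<forall>v\<in>insert u S. \<forall>w\<in>insert u S. v \<noteq> w \<longrightarrow> D' v * D' w = 0"
    using D Df by (auto simp: D'_def)
  ultimately show ?case by blast
qed

lemma equal_split:
  assumes e: "e \<in> A" "proj e" and t: "0 < t" "tr e = real n * t"
  obtains F where "F \<subseteq> A" "ortho F" "\<Sum>F = e" "\<And>f. f \<in> F \<Longrightarrow> tr f = t" "card F = n"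
proof -
  have "\<exists>D. (\<forall>v\<in>{..<n}. D v \<in> A \<and> proj (D v) \<and> tr (D v) = t) \<and>
    (\<forall>v\<in>{..<n}. \<forall>w\<in>{..<n}. v \<noteq> w \<longrightarrow> D v * D w = 0) \<and> (\<Sum>v\<in>{..<n}. D v) = e"
    using t by (intro split_trace e) auto
  then obtain D where D: "\<forall>v\<in>{..<n}. D v \<in> A \<and> proj (D v) \<and> tr (D v) = t"
    "\<forall>v\<in>{..<n}. \<forall>w\<in>{..<n}. v \<noteq> w \<longrightarrow> D v * D w = 0" "(\<Sum>v\<in>{..<n}. D v) = e" by blast
  \<comment> \<open>Positive trace makes the pieces distinct, so the set of them still has
    \<open>n\<close> elements.\<close>
  have inj: "inj_on D {..<n}"
  proof (rule inj_onI, rule ccontr)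
    fix v w assume vw: "v \<in> {..<n}" "w \<in> {..<n}" "D v = D w" "v \<noteq> w"
    then have "D v * D w = 0" using D(2) by blast
    moreover have "D v * D w = D v" using vw D(1) by (simp add: proj_idem)
    ultimately have "tr 0 = t" using D(1) vw(1) by metis
    then show False using t by (simp add: tr_def tau_0)
  qed
  have "ortho (D ` {..<n})"
    unfolding ortho_def
  proof (intro conjI ballI impI)
    show "proj e" if "e \<in> D ` {..<n}" for e using that D(1) by blast
    show "e * f = 0" if ef: "e \<in> D ` {..<n}" "f \<in> D ` {..<n}" "e \<noteq> f" for e f
    proof -
      obtain v w where vw: "v \<in> {..<n}" "w \<in> {..<n}" "e = D v" "f = D w"
        using ef(1,2) by (elim imageE)
      then have "v \<noteq> w" using ef(3) by blast
      then have "D v * D w = 0" using D(2) vw(1,2) by metis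
      then show ?thesis by (simp only: vw)
    qed
  qed simp
  moreover have "\<Sum>(D ` {..<n}) = e" using D(3) sum.reindex[OF inj, of "\<lambda>x. x"] by simp
  moreover have "card (D ` {..<n}) = n" using card_image[OF inj] by simp
  moreover have "D ` {..<n} \<subseteq> A" "\<And>f. f \<in> D ` {..<n} \<Longrightarrow> tr f = t" using D(1) by blast+
  ultimately show ?thesis using that by blast
qed

end

text \<open>As 0 is excluded, the families are disjoint as sets: a common element would be a
  projection with square 0. Hence no summand is lost in the union.\<close>

lemma ortho_UN:
  assumes J: "finite J" and H: "\<And>j. j \<in> J \<Longrightarrow> ortho (H j)" "\<And>j f. j \<in> J \<Longrightarrow> f \<in> H j \<Longrightarrow> f \<noteq> 0"
    and disj: "\<And>i j. i \<in> J \<Longrightarrow> j \<in> J \<Longrightarrow> i \<noteq> j \<Longrightarrow> \<Sum>(H i) * \<Sum>(H j) = 0"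
  shows "ortho (\<Union>j\<in>J. H j)" "\<Sum>(\<Union>j\<in>J. H j) = (\<Sum>j\<in>J. \<Sum>(H j))"
proof -
  have fin: "finite (H j)" if "j \<in> J" for j using H(1)[OF that] by (simp add: ortho_def)
  have zero: "f * g = 0" if "i \<in> J" "j \<in> J" "i \<noteq> j" "f \<in> H i" "g \<in> H j" for f g i j
  proof -
    have "f * g = (f * \<Sum>(H i)) * (\<Sum>(H j) * g)"
      by (simp only: ortho_mult_sum[OF H(1)[OF that(1)] that(4)] ortho_sum_mult[OF H(1)[OF that(2)] that(5)])
    also have "\<dots> = f * (\<Sum>(H i) * \<Sum>(H j)) * g" by (simp only: mult.assoc)
    also have "\<dots> = 0" by (simp only: disj[OF that(1-3)] mult_zero_left mult_zero_right)
    finally show ?thesis .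
  qed
  have dj: "H i \<inter> H j = {}" if "i \<in> J" "j \<in> J" "i \<noteq> j" for i j
  proof (rule ccontr)
    assume "H i \<inter> H j \<noteq> {}"
    then obtain f where f: "f \<in> H i" "f \<in> H j" by blast
    then have "f * f = 0" using zero that by blast
    moreover have "proj f" using H(1)[OF that(1)] f by (simp add: ortho_def)
    ultimately show False using H(2)[OF that(1) f(1)] by (simp add: proj_idem)
  qed
  show "ortho (\<Union>j\<in>J. H j)"
    unfolding ortho_def
  proof (intro conjI ballI impI)
    show "finite (\<Union>j\<in>J. H j)" using J fin by blast
    fix e assume e: "e \<in> (\<Union>j\<in>J. H j)"
    then obtain i where i: "i \<in> J" "e \<in> H i" by blast
    show "proj e" using H(1)[OF i(1)] i(2) by (simp add: ortho_def)
    fix f assume f: "f \<in> (\<Union>j\<in>J. H j)" "e \<noteq> f"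
    then obtain j where j: "j \<in> J" "f \<in> H j" by blast
    show "e * f = 0"
    proof (cases "i = j")
      case True
      then show ?thesis using H(1)[OF i(1)] i j f by (simp add: ortho_def)
    next
      case False
      then show ?thesis using zero i j by blast
    qed
  qed
  show "\<Sum>(\<Union>j\<in>J. H j) = (\<Sum>j\<in>J. \<Sum>(H j))"
    using J fin dj by (intro sum.UNION_disjoint) auto
qed

section \<open>Averaging over blocks of equal trace\<close>

text \<open>The discrete Fourier matrix, indexed through an enumeration \<open>h\<close> of
  \<open>F\<close>. Orthogonality of two columns is the vanishing of a geometric sum over a
  \<open>q\<close>-th root of unity \<open>z \<noteq> 1\<close>.\<close>

lemma fourier_matrix:
  assumes F: "finite F" "F \<noteq> {}"
  obtains w :: "'a \<Rightarrow> 'a \<Rightarrow> complex"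
  where "\<And>k l. w k l * cnj (w k l) = 1 / of_nat (card F)"
    "\<And>l m. l \<in> F \<Longrightarrow> m \<in> F \<Longrightarrow> (\<Sum>k\<in>F. cnj (w k l) * w k m) = (if l = m then 1 else 0)"
proof -
  define q where "q = card F"
  have q: "0 < q" using F by (simp add: q_def card_gt_0_iff)
  obtain h where h: "bij_betw h F {0..<q}"
    using ex_bij_betw_finite_nat[OF F(1)] by (auto simp: q_def)
  define x where "x k l = 2 * pi * real (h k) * real (h l) / real q" for k l
  define w where "w k l = cis (x k l) / of_real (sqrt (real q))" for k l
  have sq: "complex_of_real (sqrt (real q)) * complex_of_real (sqrt (real q)) = of_nat q"
    by (simp flip: of_real_mult)
  have wc: "cnj (w k l) * w k m = cis (x k m - x k l) / of_nat q" for k l m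
    by (simp add: w_def cis_cnj sq cis_mult)
  have "w k l * cnj (w k l) = 1 / of_nat (card F)" for k l
    using wc[of k l l] by (simp add: mult.commute q_def)
  moreover have "(\<Sum>k\<in>F. cnj (w k l) * w k m) = (if l = m then 1 else 0)" if lm: "l \<in> F" "m \<in> F" for l m
  proof (cases "l = m")
    case True
    then show ?thesis using q by (simp add: wc) (simp add: q_def)
  next
    case False
    define y where "y = 2 * pi * (real (h m) - real (h l)) / real q"
    define z where "z = cis y"
    have "h l \<noteq> h m" using h lm False by (auto simp: bij_betw_def inj_on_def)
    moreover have "h l < q" "h m < q" using h lm by (auto simp: bij_betw_def)
    ultimately have hlm: "real (h m) - real (h l) \<noteq> 0" "\<bar>real (h m) - real (h l)\<bar> < real q" by auto
    \<comment> \<open>Distinct indices below \<open>q\<close> differ by less than \<open>q\<close>,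
      hence not by a multiple of \<open>q\<close>.\<close>
    have "z \<noteq> 1"
    proof
      assume "z = 1"
      then have "cos y = 1" by (simp add: z_def complex_eq_iff)
      then obtain n :: int where "y = of_int n * 2 * pi" using cos_one_2pi_int by blast
      then have "2 * pi * ((real (h m) - real (h l)) / real q) = 2 * pi * of_int n"
        by (simp add: y_def)
      then have "(real (h m) - real (h l)) / real q = of_int n"
        by (simp only: mult_cancel_left) simp
      then have "real (h m) - real (h l) = of_int n * real q"
        using q by (simp add: divide_eq_eq)
      then have "n \<noteq> 0" "\<bar>of_int n\<bar> * real q < real q" using hlm by (auto simp: abs_mult)
      then show False using q by (simp add: mult_less_cancel_right2 del: of_int_abs flip: of_int_abs)
    qed
    have zq: "z ^ q = 1"
    proof -
      have "z ^ q = cis (2 * pi * (real (h m) - real (h l)))"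
        unfolding z_def Complex.DeMoivre using q by (simp add: y_def)
      also have "\<dots> = cis (2 * pi * real (h m)) / cis (2 * pi * real (h l))"
        by (simp add: cis_divide algebra_simps)
      also have "\<dots> = 1"
        by (simp add: cis_multiple_2pi)
      finally show ?thesis .
    qed
    have "(\<Sum>k\<in>F. cnj (w k l) * w k m) = (\<Sum>k\<in>F. z ^ h k / of_nat q)"
    proof (rule sum.cong[OF refl])
      fix k
      have "x k m - x k l = real (h k) * y" by (simp add: x_def y_def diff_divide_distrib algebra_simps)
      then show "cnj (w k l) * w k m = z ^ h k / of_nat q"
        unfolding wc z_def Complex.DeMoivre by simp
    qed
    also have "\<dots> = (\<Sum>j\<in>{0..<q}. z ^ j / of_nat q)" by (rule sum.reindex_bij_betw[OF h])
    also have "\<dots> = (\<Sum>j<q. z ^ j) / of_nat q"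
      by (simp add: sum_divide_distrib lessThan_atLeast0)
    also have "(\<Sum>j<q. z ^ j) = 0"
      using geometric_sum[OF \<open>z \<noteq> 1\<close>, of q] zq by simp
    finally show ?thesis using False by simp
  qed
  ultimately show ?thesis using that by blast
qed

context masa_factor
begin

text \<open>After conjugation of \<open>\<Sum>v. v D\<^sub>v\<close> by the Fourier unitary \<open>\<Sum>l. U\<^sub>l\<close> of the matrix units \<open>V\<^sub>k V\<^sub>l\<^sup>*\<close>, each
  diagonal block is the average of the original blocks, all of them scalar except those in \<open>F0\<close>.\<close>

lemma mixing:
  fixes D :: "complex \<Rightarrow> 'h cop"
  assumes F: "ortho F" "F \<subseteq> A" "F \<noteq> {}" "\<And>f. f \<in> F \<Longrightarrow> tr f = t" "0 < t" and e: "e = \<Sum>F"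
    and S: "finite S" and D: "\<And>v. v \<in> S \<Longrightarrow> D v \<in> A" "\<And>v. v \<in> S \<Longrightarrow> proj (D v)"
      "\<And>v w. v \<in> S \<Longrightarrow> w \<in> S \<Longrightarrow> v \<noteq> w \<Longrightarrow> D v * D w = 0" "(\<Sum>v\<in>S. D v) = e"
    and F0: "F0 \<subseteq> F" "card F0 \<le> m" "\<And>f. f \<in> F - F0 \<Longrightarrow> \<exists>v\<in>S. f * D v = f"
  obtains Q where "\<And>v. v \<in> S \<Longrightarrow> Q v \<in> M" "\<And>v. v \<in> S \<Longrightarrow> proj (Q v)"
    "\<And>v w. v \<in> S \<Longrightarrow> w \<in> S \<Longrightarrow> v \<noteq> w \<Longrightarrow> Q v * Q w = 0" "(\<Sum>v\<in>S. Q v) = e"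
    "\<And>v. v \<in> S \<Longrightarrow> tr (Q v) = tr (D v)"
    "norm (E (\<Sum>v\<in>S. v *\<^sub>C Q v) - ((\<Sum>v\<in>S. v * of_real (tr (D v))) / of_real (tr e)) *\<^sub>C e)
      \<le> 12 * real m * (\<Sum>v\<in>S. norm v) / real (card F)"
proof -
  have fin: "finite F" using F(1) by (simp add: ortho_def)
  have pF: "proj k" "k \<in> A" "k \<in> M" if "k \<in> F" for k
    using F(1,2) that A_M by (auto simp: ortho_def)
  have oF: "k * l = 0" if "k \<in> F" "l \<in> F" "k \<noteq> l" for k l
    using F(1) that by (simp add: ortho_def)
  have pe: "proj e" and eA: "e \<in> A" unfolding e using F(1) pF by (auto intro!: proj_ortho_sum vna_sum[OF vna_A])
  have ek: "e * k = k" "k * e = k" if "k \<in> F" for k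
    unfolding e using ortho_mult_sum[OF F(1) that] ortho_sum_mult[OF F(1) that] by auto
  \<comment> \<open>A reference block; equality of the traces lets \<open>V k\<close> carry it onto
    the block \<open>k\<close>.\<close>
  obtain b where b: "b \<in> F" using F(3) by blast
  have "\<exists>V. V \<in> M \<and> star V * V = b \<and> V * star V = k" if k: "k \<in> F" for k
  proof -
    have "tr b = tr k" using F(4) k b by simp
    then show ?thesis by (rule comparison[OF pF(3,1)[OF b] pF(3,1)[OF k]]) blast
  qed
  then obtain V where V: "\<And>k. k \<in> F \<Longrightarrow> V k \<in> M" "\<And>k. k \<in> F \<Longrightarrow> star (V k) * V k = b"
    "\<And>k. k \<in> F \<Longrightarrow> V k * star (V k) = k" by metis
  have Vb: "V k * b = V k" "b * star (V k) = star (V k)" if "k \<in> F" for k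
    using partial_isometry_mult[of "V k"] V(2)[OF that] pF(1)[OF b] by auto
  have kV: "k * V k = V k" if "k \<in> F" for k
    using V(2,3)[OF that] Vb(1)[OF that] by (metis mult.assoc)
  have Vk: "star (V k) * k = star (V k)" if "k \<in> F" for k
    using V(2,3)[OF that] Vb(2)[OF that] by (metis mult.assoc)
  have kVl: "k * V l = (if k = l then V l else 0)" if "k \<in> F" "l \<in> F" for k l
  proof (cases "k = l")
    case False
    have "k * V l = k * (l * V l)" using kV[OF that(2)] by simp
    also have "\<dots> = (k * l) * V l" by (simp only: mult.assoc)
    also have "\<dots> = 0" using oF[OF that False] by simp
    finally show ?thesis using False by simp
  qed (use kV that in simp)
  have VV: "star (V k) * V l = (if k = l then b else 0)" if "k \<in> F" "l \<in> F" for k l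
  proof -
    have "star (V k) * V l = star (V k) * (k * V l)" using Vk[OF that(1)] by (metis mult.assoc)
    then show ?thesis using kVl[OF that] V(2) that by auto
  qed
  obtain w :: "'h cop \<Rightarrow> 'h cop \<Rightarrow> complex"
    where w: "\<And>k l. w k l * cnj (w k l) = 1 / of_nat (card F)"
    "\<And>l m. l \<in> F \<Longrightarrow> m \<in> F \<Longrightarrow> (\<Sum>k\<in>F. cnj (w k l) * w k m) = (if l = m then 1 else 0)"
    by (rule fourier_matrix[OF fin F(3)]) blast
  \<comment> \<open>\<open>U l\<close> is the restriction of the Fourier unitary to the block
    \<open>l\<close>.\<close>
  define U where "U l = (\<Sum>k\<in>F. w k l *\<^sub>C (V k * star (V l)))" for l
  have UM: "U l \<in> M" if "l \<in> F" for l
    unfolding U_def using V(1) that by (intro M_closed; simp)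
  have sU: "star (U l) = (\<Sum>k\<in>F. cnj (w k l) *\<^sub>C (V l * star (V k)))" for l
    by (simp add: U_def star_sum)
  have kU: "k * U l = w k l *\<^sub>C (V k * star (V l))" if "k \<in> F" "l \<in> F" for k l
  proof -
    have "k * U l = (\<Sum>j\<in>F. if j = k then w k l *\<^sub>C (V k * star (V l)) else 0)"
      unfolding U_def sum_distrib_left
    proof (rule sum.cong[OF refl])
      fix j assume "j \<in> F"
      then have "k * (V j * star (V l)) = (if k = j then V j * star (V l) else 0)"
        using kVl[OF that(1), of j] by (simp flip: mult.assoc)
      then show "k * w j l *\<^sub>C (V j * star (V l)) = (if j = k then w k l *\<^sub>C (V k * star (V l)) else 0)"
        by auto
    qed
    then show ?thesis using fin that by simp
  qed
  have UU: "star (U l) * U j = (if l = j then l else 0)" if "l \<in> F" "j \<in> F" for l j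
  proof -
    have "star (U l) * U j = (\<Sum>k\<in>F. cnj (w k l) *\<^sub>C (V l * (star (V k) * U j)))"
      unfolding sU sum_distrib_right by (simp add: mult.assoc)
    also have "\<dots> = (\<Sum>k\<in>F. (cnj (w k l) * w k j) *\<^sub>C (V l * star (V j)))"
    proof (rule sum.cong[OF refl])
      fix k assume k: "k \<in> F"
      have "star (V k) * U j = star (V k) * (k * U j)" using Vk[OF k] by (metis mult.assoc)
      also have "\<dots> = w k j *\<^sub>C ((star (V k) * V k) * star (V j))"
        unfolding kU[OF k that(2)] by (simp add: mult.assoc)
      also have "\<dots> = w k j *\<^sub>C star (V j)" by (simp only: V(2)[OF k] Vb(2)[OF that(2)])
      finally show "cnj (w k l) *\<^sub>C (V l * (star (V k) * U j)) = (cnj (w k l) * w k j) *\<^sub>C (V l * star (V j))"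
        by simp
    qed
    also have "\<dots> = (if l = j then 1 else 0) *\<^sub>C (V l * star (V j))"
      unfolding w(2)[OF that, symmetric] scaleC_sum_left ..
    finally show ?thesis using V(3)[OF that(1)] by auto
  qed
  have Ul: "U l * l = U l" "l * star (U l) = star (U l)" if "l \<in> F" for l
  proof -
    show 1: "U l * l = U l"
      unfolding U_def sum_distrib_right using Vk[OF that] by (intro sum.cong refl) (simp add: mult.assoc)
    show "l * star (U l) = star (U l)"
      using arg_cong[OF 1, of star] pF(1)[OF that] by (simp add: proj_def)
  qed
  \<comment> \<open>Elements of \<open>A\<close> commute with the blocks, so their conjugates by the
    whole Fourier unitary have no mixed terms. The diagonal sum is this conjugate, and it is
    multiplicative on \<open>A\<close>.\<close>
  have conj_prod: "(\<Sum>l\<in>F. U l * X * star (U l)) * (\<Sum>l\<in>F. U l * Y * star (U l)) = (\<Sum>l\<in>F. U l * (X * l * Y) * star (U l))" for X Y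
  proof -
    have "(\<Sum>l\<in>F. U l * X * star (U l)) * (\<Sum>l\<in>F. U l * Y * star (U l))
      = (\<Sum>l\<in>F. \<Sum>j\<in>F. U l * X * (star (U l) * U j) * Y * star (U j))"
      unfolding sum_product by (simp add: mult.assoc)
    also have "\<dots> = (\<Sum>l\<in>F. \<Sum>j\<in>F. if j = l then U l * (X * l * Y) * star (U l) else 0)"
      by (intro sum.cong refl) (auto simp: UU mult.assoc)
    also have "\<dots> = (\<Sum>l\<in>F. U l * (X * l * Y) * star (U l))" using fin by simp
    finally show ?thesis .
  qed
  have lX: "U l * (X * l * Y) * star (U l) = U l * (X * Y) * star (U l)" if "l \<in> F" "X \<in> A" for l X Y
  proof -
    have "X * l = l * X" using A_commute pF(2)[OF that(1)] that(2) by blast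
    then have "U l * (X * l * Y) = (U l * l) * (X * Y)" by (simp add: mult.assoc)
    then show ?thesis using Ul(1)[OF that(1)] by simp
  qed
  have conj_mult: "(\<Sum>l\<in>F. U l * X * star (U l)) * (\<Sum>l\<in>F. U l * Y * star (U l)) = (\<Sum>l\<in>F. U l * (X * Y) * star (U l))"
    if "X \<in> A" for X Y
    unfolding conj_prod using lX that by (intro sum.cong refl) blast
  have conj_star: "star (\<Sum>l\<in>F. U l * X * star (U l)) = (\<Sum>l\<in>F. U l * star X * star (U l))" for X
    by (simp add: star_sum mult.assoc)
  have conj_M: "(\<Sum>l\<in>F. U l * X * star (U l)) \<in> M" if "X \<in> M" for X
    using UM that by (intro M_closed; simp)
  have conj_tau: "\<tau> (\<Sum>l\<in>F. U l * X * star (U l)) = \<tau> (e * X)" if X: "X \<in> M" for X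
  proof -
    have "\<tau> (\<Sum>l\<in>F. U l * X * star (U l)) = (\<Sum>l\<in>F. \<tau> (U l * X * star (U l)))"
      using UM X by (intro tau_sum M_closed; simp)
    also have "\<dots> = (\<Sum>l\<in>F. \<tau> (l * X))"
    proof (rule sum.cong[OF refl])
      fix l assume l: "l \<in> F"
      have "\<tau> ((U l * X) * star (U l)) = \<tau> (star (U l) * (U l * X))"
        using UM[OF l] X by (intro tau_commute M_closed)
      also have "star (U l) * (U l * X) = l * X" using UU[OF l l] by (simp flip: mult.assoc)
      finally show "\<tau> (U l * X * star (U l)) = \<tau> (l * X)" .
    qed
    also have "\<dots> = \<tau> (e * X)"
      unfolding e sum_distrib_right using pF X by (intro tau_sum[symmetric] M_closed; simp)
    finally show ?thesis .
  qed
  define Q where "Q v = (\<Sum>l\<in>F. U l * D v * star (U l))" for v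
  have Q1: "Q v \<in> M" if "v \<in> S" for v unfolding Q_def by (intro conj_M A_M D that)
  have Q2: "proj (Q v)" if "v \<in> S" for v
    unfolding proj_def Q_def using conj_mult[OF D(1)[OF that], of "D v"] conj_star[of "D v"] D(2)[OF that]
    by (simp add: proj_def)
  have Q3: "Q v * Q u = 0" if "v \<in> S" "u \<in> S" "v \<noteq> u" for v u
    unfolding Q_def conj_mult[OF D(1)[OF that(1)]] D(3)[OF that] by simp
  have Dsum: "(\<Sum>v\<in>S. c v *\<^sub>C Q v) = (\<Sum>l\<in>F. U l * (\<Sum>v\<in>S. c v *\<^sub>C D v) * star (U l))" for c
    unfolding Q_def scaleC_sum_right sum_distrib_left sum_distrib_right
    by (subst sum.swap) (simp add: mult.assoc)
  \<comment> \<open>The conjugate \<open>G\<close> of \<open>e\<close> is a projection under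
    \<open>e\<close> with the trace of \<open>e\<close>. Faithfulness of the trace then gives
    equality, and orthogonality of the rows of the Fourier matrix need not be computed.\<close>
  have Q4: "(\<Sum>v\<in>S. Q v) = e"
  proof -
    define G where "G = (\<Sum>l\<in>F. U l * e * star (U l))"
    have G: "(\<Sum>v\<in>S. Q v) = G" using Dsum[of "\<lambda>_. 1"] by (simp add: D(4) G_def)
    have pG: "proj G"
      unfolding proj_def G_def using conj_mult[OF eA, of e] conj_star[of e] pe by (simp add: proj_def)
    have GM: "G \<in> M" unfolding G_def by (intro conj_M A_M eA)
    have eV: "e * V k = V k" if "k \<in> F" for k using kV[OF that] ek(1)[OF that] by (metis mult.assoc)
    have eU: "e * U l = U l" for l
      unfolding U_def sum_distrib_left by (intro sum.cong refl) (simp add: eV flip: mult.assoc)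
    have eG: "e * G = G" unfolding G_def sum_distrib_left by (simp add: eU flip: mult.assoc)
    have "\<tau> G = \<tau> e" unfolding G_def conj_tau[OF A_M[OF eA]] using pe by (simp add: proj_idem)
    then have "tr (e - G) = 0" using A_M[OF eA] GM by (simp add: tr_def tau_diff)
    then have "e - G = 0" by (intro tr_eq_0 M_closed A_M eA GM proj_le(2) pG pe eG)
    then show ?thesis using G by simp
  qed
  have eD: "e * D v = D v" if "v \<in> S" for v
  proof -
    have "e * D v = D v * D v + (\<Sum>u\<in>S - {v}. D u * D v)"
      unfolding D(4)[symmetric] sum_distrib_right using S that by (intro sum.remove)
    also have "(\<Sum>u\<in>S - {v}. D u * D v) = 0" using D(3) that by (intro sum.neutral) auto
    finally show ?thesis using D(2)[OF that] by (simp add: proj_idem)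
  qed
  have Q5: "tr (Q v) = tr (D v)" if "v \<in> S" for v
    unfolding tr_def Q_def conj_tau[OF A_M[OF D(1)[OF that]]] eD[OF that] ..
  define q where "q = card F"
  have q: "0 < q" using F(3) fin by (simp add: q_def card_gt_0_iff)
  define C where "C = (\<Sum>v\<in>S. norm v)"
  define Z where "Z = (\<Sum>v\<in>S. v *\<^sub>C Q v)"
  define B where "B = (\<Sum>v\<in>S. v *\<^sub>C D v)"
  have C0: "0 \<le> C" by (simp add: C_def sum_nonneg)
  have ZM: "Z \<in> M" unfolding Z_def using Q1 by (intro M_closed; simp)
  have BA: "B \<in> A" unfolding B_def using D(1) by (intro A_closed; simp)
  have nB: "norm B \<le> C"
    unfolding B_def C_def
  proof (rule sum_norm_le)
    fix v assume "v \<in> S"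
    then show "norm (v *\<^sub>C D v) \<le> norm v"
      using proj_norm[OF D(2)] by (simp add: norm_scaleC_cop mult_left_le)
  qed
  have tre: "tr e = real q * t"
    unfolding e using F(4) pF(3) by (subst tr_sum) (auto simp: q_def)
  \<comment> \<open>The normalised trace of \<open>B\<close> over the block \<open>l\<close>. On a
    block inside one \<open>D v\<close> it is \<open>v\<close>, and the mean of all of them is
    \<open>L\<close>.\<close>
  define \<mu> where "\<mu> l = \<tau> (l * B) / of_real t" for l
  define L where "L = (\<Sum>v\<in>S. v * of_real (tr (D v))) / of_real (tr e)"
  have nmu: "norm (\<mu> l) \<le> 2 * C" if "l \<in> F" for l
  proof -
    have "norm (\<tau> (B * l)) \<le> 2 * norm B * t"
      using norm_tau_mult_proj[OF A_M[OF BA] pF(3,1)[OF that]] F(4)[OF that] by simp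
    moreover have "B * l = l * B" using A_commute BA pF(2)[OF that] by blast
    ultimately have "norm (\<tau> (l * B)) \<le> (2 * norm B) * t" by simp
    then have "norm (\<mu> l) \<le> 2 * norm B" using F(5) by (simp add: \<mu>_def norm_divide divide_le_eq)
    then show ?thesis using nB by simp
  qed
  have Lmu: "L = (\<Sum>l\<in>F. \<mu> l) / of_nat q"
  proof -
    have "(\<Sum>v\<in>S. v * of_real (tr (D v))) = \<tau> B"
      unfolding B_def using D A_M by (subst tau_sum) (auto simp: tau_scaleC tau_proj M_closed)
    also have "B = e * B"
      unfolding B_def sum_distrib_left using eD by (intro sum.cong) auto
    also have "\<tau> (e * B) = (\<Sum>l\<in>F. \<tau> (l * B))"
      unfolding e sum_distrib_right using pF A_M[OF BA] by (intro tau_sum M_closed; simp)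
    finally show ?thesis
      using F(5) q unfolding L_def tre \<mu>_def by (simp flip: sum_divide_distrib add: divide_divide_eq_left mult.commute)
  qed
  have kZk: "k * Z * k = (1 / of_nat q) *\<^sub>C (\<Sum>l\<in>F. V k * (star (V l) * B * V l) * star (V k))" if k: "k \<in> F" for k
  proof -
    have Uk: "star (U l) * k = cnj (w k l) *\<^sub>C (V l * star (V k))" if l: "l \<in> F" for l
      using arg_cong[OF kU[OF k l], of star] pF(1)[OF k] by (simp add: proj_def)
    have "k * Z * k = (\<Sum>l\<in>F. (k * U l) * B * (star (U l) * k))"
      unfolding Z_def Dsum B_def[symmetric] sum_distrib_left sum_distrib_right by (simp only: mult.assoc)
    \<comment> \<open>Equal moduli of the entries give every block the same weight
      \<open>1 / q\<close>.\<close>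
    also have "\<dots> = (\<Sum>l\<in>F. (w k l * cnj (w k l)) *\<^sub>C (V k * (star (V l) * B * V l) * star (V k)))"
      by (intro sum.cong refl) (simp add: kU[OF k] Uk mult.assoc mult.commute)
    finally show ?thesis unfolding w(1) by (simp add: scaleC_sum_right q_def)
  qed
  \<comment> \<open>Only the at most \<open>m\<close> blocks in \<open>F0\<close> contribute, each
    with at most \<open>C\<close> from the transported block and \<open>2 * C\<close> from
    \<open>\<mu> l\<close>.\<close>
  have bound: "norm (k * Z * k - L *\<^sub>C k) \<le> 3 * real m * C / real q" if k: "k \<in> F" for k
  proof -
    define X where "X l = V k * (star (V l) * B * V l) * star (V k) - \<mu> l *\<^sub>C k" for l
    have "k * Z * k - L *\<^sub>C k = (1 / of_nat q) *\<^sub>C (\<Sum>l\<in>F. X l)"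
      unfolding kZk[OF k] Lmu X_def sum_subtractf scaleC_sum_left[symmetric]
      by (simp add: scaleC_cop_simps)
    moreover have "(\<Sum>l\<in>F. X l) = (\<Sum>l\<in>F0. X l)"
    proof (rule sum.mono_neutral_right[OF fin F0(1)], rule ballI)
      fix l assume l: "l \<in> F - F0"
      then obtain v where v: "v \<in> S" "l * D v = l" using F0(3) by blast
      have lF: "l \<in> F" using l by blast
      have "l * B = v *\<^sub>C (l * D v) + (\<Sum>u\<in>S - {v}. u *\<^sub>C (l * D u))"
        unfolding B_def sum_distrib_left scaleC_cop(6) using S v by (intro sum.remove)
      also have "(\<Sum>u\<in>S - {v}. u *\<^sub>C (l * D u)) = 0"
      proof (rule sum.neutral, rule ballI)
        fix u assume u: "u \<in> S - {v}"
        have "l * D u = l * (D v * D u)" using v(2) by (metis mult.assoc)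
        also have "D v * D u = 0" using D(3)[OF v(1), of u] u by blast
        finally show "u *\<^sub>C (l * D u) = 0" by simp
      qed
      finally have lB: "l * B = v *\<^sub>C l" by (simp add: v(2))
      then have "\<mu> l = v"
        unfolding \<mu>_def using pF[OF lF] F(4)[OF lF] F(5) by (simp add: tau_scaleC tau_proj)
      moreover have "star (V l) * B * V l = star (V l) * (l * B) * V l"
        using Vk[OF lF] by (simp flip: mult.assoc)
      then have "star (V l) * B * V l = v *\<^sub>C b"
        unfolding lB using Vk[OF lF] V(2)[OF lF] by simp
      ultimately show "X l = 0" using Vb(1)[OF k] V(3)[OF k] by (simp add: X_def)
    qed
    moreover have "norm (\<Sum>l\<in>F0. X l) \<le> real m * (3 * C)"
    proof -
      have nV: "norm (V l) \<le> 1" "norm (star (V l)) \<le> 1" if "l \<in> F" for l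
      proof -
        have "proj (star (V l) * V l)" using V(2)[OF that] pF(1)[OF b] by simp
        then show "norm (V l) \<le> 1" by (intro norm_cop_bound) (auto intro: partial_isometry_norm)
        then show "norm (star (V l)) \<le> 1" by simp
      qed
      have "norm (X l) \<le> 3 * C" if "l \<in> F0" for l
      proof -
        have l: "l \<in> F" using F0(1) that by blast
        have "norm (V k * (star (V l) * B * V l) * star (V k)) \<le> (1 * (1 * C * 1)) * 1"
          using nV[OF l] nV[OF k] nB C0 by (intro order.trans[OF norm_mult_ineq] mult_mono) auto
        moreover have "norm (\<mu> l *\<^sub>C k) \<le> 2 * C"
          using mult_mono[OF nmu[OF l] proj_norm[OF pF(1)[OF k]]] C0 by (simp add: norm_scaleC_cop)
        ultimately show ?thesis
          unfolding X_def using norm_triangle_ineq4[of "V k * (star (V l) * B * V l) * star (V k)" "\<mu> l *\<^sub>C k"] by linarith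
      qed
      then have "norm (\<Sum>l\<in>F0. X l) \<le> (\<Sum>l\<in>F0. 3 * C)" by (intro sum_norm_le)
      also have "\<dots> = real (card F0) * (3 * C)" by simp
      also have "\<dots> \<le> real m * (3 * C)" using F0(2) C0 by (intro mult_right_mono) auto
      finally show ?thesis .
    qed
    ultimately show ?thesis using q by (simp add: norm_scaleC_cop norm_divide field_simps)
  qed
  have "norm (E Z - L *\<^sub>C e) \<le> 12 * real m * C / real q"
  proof -
    define X where "X k = k * E Z * k - L *\<^sub>C k" for k
    have EZ: "E Z \<in> A" by (rule E_in[OF ZM])
    have eZ: "e * Z = Z"
    proof -
      have "e * Q v = Q v" if v: "v \<in> S" for v
      proof -
        have "e * Q v = Q v * Q v + (\<Sum>u\<in>S - {v}. Q u * Q v)"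
          unfolding Q4[symmetric] sum_distrib_right using S v by (intro sum.remove)
        also have "(\<Sum>u\<in>S - {v}. Q u * Q v) = 0" using Q3 v by (intro sum.neutral) auto
        finally show ?thesis using Q2[OF v] by (simp add: proj_idem)
      qed
      then show ?thesis unfolding Z_def sum_distrib_left by (intro sum.cong) auto
    qed
    have "E Z = e * E Z"
      using E_module[OF ZM eA A_closed(2)] by (simp add: eZ)
    also have "\<dots> = (\<Sum>k\<in>F. k * E Z * k)"
      unfolding e sum_distrib_right
    proof (rule sum.cong[OF refl])
      fix k assume k: "k \<in> F"
      show "k * E Z = k * E Z * k"
        using A_commute[OF pF(2)[OF k] EZ] pF(1)[OF k] by (metis mult.assoc proj_idem)
    qed
    finally have "E Z - L *\<^sub>C e = (\<Sum>k\<in>F. X k)"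
      by (simp add: X_def sum_subtractf e scaleC_sum_right)
    \<comment> \<open>The factor 4 is the bound for \<open>E\<close>; the block-diagonal form
      prevents a further factor \<open>q\<close>.\<close>
    also have "norm \<dots> \<le> 4 * (3 * real m * C / real q)"
    proof (rule norm_ortho_sum_le[OF F(1)])
      fix k assume k: "k \<in> F"
      show "k * X k = X k" "X k * k = X k"
        using pF(1)[OF k] by (simp_all add: X_def algebra_simps proj_idem proj_idem_left)
      have "X k = E (k * Z * k - L *\<^sub>C k)"
        using ZM pF(2,3)[OF k] E_module[OF ZM pF(2)[OF k] pF(2)[OF k]]
        by (simp add: X_def E_diff E_scaleC E_id M_closed)
      moreover have "k * Z * k - L *\<^sub>C k \<in> M" using ZM pF(3)[OF k] by (intro M_closed)
      ultimately have "norm (X k) \<le> 4 * norm (k * Z * k - L *\<^sub>C k)" by (simp add: norm_E)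
      then show "norm (X k) \<le> 4 * (3 * real m * C / real q)" using bound[OF k] by linarith
    qed (use C0 in simp)
    finally show ?thesis by simp
  qed
  then show ?thesis
    using that[of Q] Q1 Q2 Q3 Q4 Q5 unfolding Z_def L_def C_def q_def by blast
qed

text \<open>Blocks of trace \<open>t\<close> are cut inside each \<open>D v\<close> as long as they
  fit. Rounding down loses less than one block per point, so what remains makes up at most
  \<open>card S\<close> blocks, whatever \<open>q\<close> is.\<close>

lemma local_mixing:
  fixes a :: "complex \<Rightarrow> real"
  assumes e: "e \<in> A" "proj e" "e \<noteq> 0" and S: "finite S" and a: "\<And>v. v \<in> S \<Longrightarrow> 0 \<le> a v" "sum a S = 1"
    and eps: "0 < \<epsilon>"
  shows "\<exists>Q. (\<forall>v\<in>S. Q v \<in> M \<and> proj (Q v) \<and> tr (Q v) = a v * tr e) \<and>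
    (\<forall>v\<in>S. \<forall>w\<in>S. v \<noteq> w \<longrightarrow> Q v * Q w = 0) \<and> (\<Sum>v\<in>S. Q v) = e \<and>
    norm (E (\<Sum>v\<in>S. v *\<^sub>C Q v) - (\<Sum>v\<in>S. of_real (a v) * v) *\<^sub>C e) \<le> \<epsilon>"
proof -
  define T where "T = tr e"
  have T: "0 < T" using tr_nonneg[of e] tr_eq_0[of e] e A_M by (force simp: T_def)
  define C where "C = (\<Sum>v\<in>S. norm v)"
  define m where "m = card S"
  \<comment> \<open>The number of blocks is chosen to bring the mixing error below \<epsilon>;
    passing to the successor makes it positive.\<close>
  obtain q0 where "12 * real m * C / \<epsilon> < real q0" using reals_Archimedean2 by blast
  moreover define q where "q = Suc q0"
  ultimately have q: "0 < q" "12 * real m * C / real q \<le> \<epsilon>"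
    using eps by (auto simp: field_simps)
  define t where "t = T / real q"
  have t: "0 < t" "real q * t = T" using T q by (auto simp: t_def)
  have aT: "0 \<le> a v * T" if "v \<in> S" for v using a(1)[OF that] T by simp
  have "sum (\<lambda>v. a v * T) S = tr e" using a(2) by (simp add: T_def flip: sum_distrib_right)
  then obtain D where D: "\<forall>v\<in>S. D v \<in> A \<and> proj (D v) \<and> tr (D v) = a v * T"
    "\<forall>v\<in>S. \<forall>w\<in>S. v \<noteq> w \<longrightarrow> D v * D w = 0" "(\<Sum>v\<in>S. D v) = e"
    using split_trace[of S e "\<lambda>v. a v * T", OF S e(1,2) aT] by blast
  define n where "n v = nat \<lfloor>a v * real q\<rfloor>" for v
  have n: "real (n v) \<le> a v * real q" "a v * real q - 1 \<le> real (n v)" if "v \<in> S" for v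
    using a(1)[OF that] by (simp_all add: n_def)
  have nt: "real (n v) * t \<le> a v * T" if "v \<in> S" for v
    using mult_right_mono[OF n(1)[OF that], of t] t by (simp add: mult.assoc)
  have "\<exists>g. g \<in> A \<and> proj g \<and> D v * g = g \<and> tr g = real (n v) * t" if v: "v \<in> S" for v
  proof -
    have "0 \<le> real (n v) * t" "real (n v) * t \<le> tr (D v)" using nt[OF v] D(1) v t by auto
    then show ?thesis using exact_trace[of "D v" "real (n v) * t"] D(1) v by blast
  qed
  then obtain g where g: "\<And>v. v \<in> S \<Longrightarrow> g v \<in> A" "\<And>v. v \<in> S \<Longrightarrow> proj (g v)"
    "\<And>v. v \<in> S \<Longrightarrow> D v * g v = g v" "\<And>v. v \<in> S \<Longrightarrow> tr (g v) = real (n v) * t"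
    by metis
  have gD: "g v * D v = g v" if "v \<in> S" for v
    using g(3)[OF that] A_commute g(1)[OF that] D(1) that by metis
  have gDw: "g v * D w = 0" "D w * g v = 0" if "v \<in> S" "w \<in> S" "v \<noteq> w" for v w
  proof -
    have "g v * D w = g v * (D v * D w)" using gD[OF that(1)] by (metis mult.assoc)
    then show 1: "g v * D w = 0" using D(2) that by simp
    then show "D w * g v = 0" using A_commute g(1) D(1) that by metis
  qed
  have gw: "g v * g w = 0" if "v \<in> S" "w \<in> S" "v \<noteq> w" for v w
  proof -
    have "g v * g w = (g v * D w) * g w" using g(3)[OF that(2)] by (simp add: mult.assoc)
    then show ?thesis using gDw[OF that] by simp
  qed
  \<comment> \<open>What the fitting blocks leave of \<open>e\<close>, gathered from all the
    \<open>D v\<close>.\<close>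
  define r where "r = e - (\<Sum>v\<in>S. g v)"
  have ge: "g v * e = g v" if v: "v \<in> S" for v
  proof -
    have "g v * e = g v * D v + (\<Sum>w\<in>S - {v}. g v * D w)"
      unfolding D(3)[symmetric] sum_distrib_left using S v by (intro sum.remove)
    also have "(\<Sum>w\<in>S - {v}. g v * D w) = 0" using gDw v by (intro sum.neutral) auto
    finally show ?thesis using gD[OF v] by simp
  qed
  have gg: "g v * (\<Sum>w\<in>S. g w) = g v" if v: "v \<in> S" for v
  proof -
    have "g v * (\<Sum>w\<in>S. g w) = g v * g v + (\<Sum>w\<in>S - {v}. g v * g w)"
      unfolding sum_distrib_left using S v by (intro sum.remove)
    also have "(\<Sum>w\<in>S - {v}. g v * g w) = 0" using gw v by (intro sum.neutral) auto
    finally show ?thesis using g(2)[OF v] by (simp add: proj_idem)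
  qed
  define s where "s = (\<Sum>v\<in>S. g v)"
  have sA: "s \<in> A" unfolding s_def using g(1) by (intro A_closed; simp)
  have ss: "s * s = s" unfolding s_def[symmetric] using gg
    by (subst (1) s_def) (simp add: sum_distrib_right s_def)
  have ps: "proj s"
    using ss g(2) by (simp add: proj_def) (simp add: s_def star_sum proj_star)
  have se: "s * e = s" unfolding s_def sum_distrib_right using ge by (intro sum.cong) auto
  then have es: "e * s = s" using A_commute[OF sA e(1)] by simp
  have r: "r \<in> A" "proj r" unfolding r_def s_def[symmetric] using sA e ps es proj_le(2)
    by (auto intro: A_closed)
  have gr: "g v * r = 0" if "v \<in> S" for v
    unfolding r_def using ge[OF that] gg[OF that] by (simp add: algebra_simps)
  have trs: "tr s = real (\<Sum>v\<in>S. n v) * t"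
    unfolding s_def using g A_M by (subst tr_sum) (auto simp: sum_distrib_right)
  have nq: "(\<Sum>v\<in>S. n v) \<le> q"
  proof -
    have "real (\<Sum>v\<in>S. n v) \<le> (\<Sum>v\<in>S. a v * real q)" using n(1) by (simp add: sum_mono)
    also have "\<dots> = real q" using a(2) by (simp flip: sum_distrib_right)
    finally show ?thesis by (simp only: of_nat_le_iff)
  qed
  define N where "N = q - (\<Sum>v\<in>S. n v)"
  have N: "N \<le> m"
  proof -
    have "real q - real m = (\<Sum>v\<in>S. a v * real q - 1)"
      using a(2) by (simp add: sum_subtractf m_def flip: sum_distrib_right)
    also have "\<dots> \<le> (\<Sum>v\<in>S. real (n v))" using n(2) by (intro sum_mono)
    finally have "real q \<le> real (m + (\<Sum>v\<in>S. n v))" by simp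
    then have "q \<le> m + (\<Sum>v\<in>S. n v)" by (simp only: of_nat_le_iff)
    then show ?thesis by (simp add: N_def)
  qed
  \<comment> \<open>As \<open>e\<close> has trace \<open>q * t\<close>, the remainder has a trace
    that is an integer multiple of \<open>t\<close> and so splits into full blocks.\<close>
  have trr: "tr r = real N * t"
    unfolding r_def s_def[symmetric] N_def using e sA A_M nq t trs
    by (simp add: tr_diff of_nat_diff algebra_simps flip: T_def)
  obtain F0 where F0: "F0 \<subseteq> A" "ortho F0" "\<Sum>F0 = r" "\<And>f. f \<in> F0 \<Longrightarrow> tr f = t" "card F0 = N"
    by (rule equal_split[OF r t(1) trr]) blast
  have "\<exists>F. F \<subseteq> A \<and> ortho F \<and> \<Sum>F = g v \<and> (\<forall>f\<in>F. tr f = t)" if "v \<in> S" for v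
    by (rule equal_split[OF g(1)[OF that] g(2)[OF that] t(1) g(4)[OF that]]) blast
  then obtain G where G: "\<And>v. v \<in> S \<Longrightarrow> G v \<subseteq> A" "\<And>v. v \<in> S \<Longrightarrow> ortho (G v)"
    "\<And>v. v \<in> S \<Longrightarrow> \<Sum>(G v) = g v" "\<And>v f. v \<in> S \<Longrightarrow> f \<in> G v \<Longrightarrow> tr f = t"
    by metis
  \<comment> \<open>\<open>None\<close> stands for the blocks of the remainder,
    \<open>Some v\<close> for those inside \<open>D v\<close>.\<close>
  define H where "H j = (case j of None \<Rightarrow> F0 | Some v \<Rightarrow> G v)" for j
  define J where "J = insert None (Some ` S)"
  have J: "finite J" using S by (simp add: J_def)
  have H1: "ortho (H j)" "H j \<subseteq> A" "\<And>f. f \<in> H j \<Longrightarrow> tr f = t" if "j \<in> J" for j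
    using that F0(1,2,4) G(1)[THEN subsetD] G(2,4) by (auto simp: J_def H_def)
  have H2: "f \<noteq> 0" if "j \<in> J" "f \<in> H j" for j f
    using H1(3)[OF that] t by (auto simp: tr_def tau_0)
  have rg: "r * g v = 0" if "v \<in> S" for v using gr[OF that] A_commute r(1) g(1)[OF that] by metis
  have H3: "\<Sum>(H i) * \<Sum>(H j) = 0" if "i \<in> J" "j \<in> J" "i \<noteq> j" for i j
    using that gr rg by (auto simp: J_def H_def F0(3) G(3) intro!: gw)
  define F where "F = (\<Union>j\<in>J. H j)"
  have F: "ortho F" "\<Sum>F = (\<Sum>j\<in>J. \<Sum>(H j))"
    unfolding F_def using ortho_UN[of J H] J H1(1) H2 H3 by blast+
  have "(\<Sum>j\<in>J. \<Sum>(H j)) = r + (\<Sum>v\<in>S. g v)"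
    using S unfolding J_def by (simp add: sum.reindex H_def F0(3) G(3))
  then have Fe: "e = \<Sum>F" using F(2) by (simp add: r_def)
  have FA: "F \<subseteq> A" and Ft: "tr f = t" if "f \<in> F" for f
    using H1 that unfolding F_def by blast+
  have FA: "F \<subseteq> A" using H1(2) unfolding F_def by blast
  have "T = (\<Sum>f\<in>F. tr f)"
    unfolding T_def Fe using FA A_M by (intro tr_sum) blast
  also have "\<dots> = real (card F) * t" using Ft by simp
  finally have "real (card F) = real q" using t by auto
  then have cF: "card F = q" by simp
  then have "F \<noteq> {}" using q by auto
  have F0F: "F0 \<subseteq> F" by (auto simp: F_def J_def H_def)
  have good: "\<exists>v\<in>S. f * D v = f" if f: "f \<in> F - F0" for f
  proof -
    obtain v where v: "v \<in> S" "f \<in> G v" using f by (auto simp: F_def J_def H_def)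
    have "f * g v = f" using ortho_mult_sum[OF G(2)[OF v(1)] v(2)] G(3)[OF v(1)] by simp
    then have "f * D v = f" using gD[OF v(1)] by (metis mult.assoc)
    then show ?thesis using v(1) by blast
  qed
  obtain Q where Q: "\<And>v. v \<in> S \<Longrightarrow> Q v \<in> M" "\<And>v. v \<in> S \<Longrightarrow> proj (Q v)"
    "\<And>v w. v \<in> S \<Longrightarrow> w \<in> S \<Longrightarrow> v \<noteq> w \<Longrightarrow> Q v * Q w = 0" "(\<Sum>v\<in>S. Q v) = e"
    "\<And>v. v \<in> S \<Longrightarrow> tr (Q v) = tr (D v)"
    "norm (E (\<Sum>v\<in>S. v *\<^sub>C Q v) - ((\<Sum>v\<in>S. v * of_real (tr (D v))) / of_real (tr e)) *\<^sub>C e)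
      \<le> 12 * real m * (\<Sum>v\<in>S. norm v) / real (card F)"
  proof (rule mixing[OF F(1) FA \<open>F \<noteq> {}\<close> Ft t(1) Fe S _ _ _ D(3) F0F _ good])
    show "card F0 \<le> m" using F0(5) N by simp
  qed (use D in auto)
  have "(\<Sum>v\<in>S. v * of_real (tr (D v))) / of_real (tr e) = (\<Sum>v\<in>S. of_real (a v) * v)"
  proof -
    have "(\<Sum>v\<in>S. v * of_real (tr (D v))) = (\<Sum>v\<in>S. of_real (a v) * v) * of_real T"
      unfolding sum_distrib_right using D(1) by (intro sum.cong) (auto simp: mult_ac)
    then show ?thesis using T by (simp add: T_def)
  qed
  then have "norm (E (\<Sum>v\<in>S. v *\<^sub>C Q v) - (\<Sum>v\<in>S. of_real (a v) * v) *\<^sub>C e) \<le> \<epsilon>"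
    using Q(6) q(2) unfolding cF C_def by simp
  moreover have "tr (Q v) = a v * tr e" if "v \<in> S" for v
    using Q(5)[OF that] D(1) that by (simp add: T_def)
  ultimately show ?thesis using Q(1-4) by (intro exI[of _ Q]) auto
qed

end

section \<open>The closure of the expected unitary orbit\<close>

text \<open>Three non-collinear points are affinely independent, so total mass and weighted sum
  determine the weights. This is where non-collinearity enters.\<close>

lemma barycentric_unique:
  fixes S :: "complex set"
  assumes S: "card S = 3" "\<not> collinear S"
    and eq: "(\<Sum>v\<in>S. a v) = (\<Sum>v\<in>S. b v)" "(\<Sum>v\<in>S. of_real (a v) * v) = (\<Sum>v\<in>S. of_real (b v) * v)"
    and v: "v \<in> S"
  shows "a v = (b v :: real)"
proof -
  have fin: "finite S" using S(1) by (simp add: card_ge_0_finite)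
  obtain x y z where "S = {x, y, z}" "x \<noteq> y" "y \<noteq> z" "x \<noteq> z"
    using S(1) by (auto simp: card_3_iff)
  then have "\<not> affine_dependent S"
    using S(2) collinear_3_eq_affine_dependent[of x y z] by auto
  moreover have "(\<Sum>v\<in>S. a v - b v) = 0" using eq(1) by (simp add: sum_subtractf)
  moreover have "(\<Sum>v\<in>S. (a v - b v) *\<^sub>R v) = 0"
    using eq(2) by (simp add: scaleR_conv_of_real sum_subtractf algebra_simps)
  ultimately have "a v - b v = 0"
    unfolding affine_dependent_explicit_finite[OF fin] using v by blast
  then show ?thesis by simp
qed

text \<open>The partial isometries from \<open>Q v\<close> onto \<open>P v\<close> given by
  comparison have orthogonal initial spaces and orthogonal final spaces, both filling the whole
  space; their sum is the unitary.\<close>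

lemma (in tracial_factor) unitary_of_equal_traces:
  assumes S: "finite S" and P: "\<And>v. v \<in> S \<Longrightarrow> P v \<in> M" "\<And>v. v \<in> S \<Longrightarrow> proj (P v)"
      "\<And>v w. v \<in> S \<Longrightarrow> w \<in> S \<Longrightarrow> v \<noteq> w \<Longrightarrow> P v * P w = 0" "(\<Sum>v\<in>S. P v) = 1"
    and Q: "\<And>v. v \<in> S \<Longrightarrow> Q v \<in> M" "\<And>v. v \<in> S \<Longrightarrow> proj (Q v)"
      "\<And>v w. v \<in> S \<Longrightarrow> w \<in> S \<Longrightarrow> v \<noteq> w \<Longrightarrow> Q v * Q w = 0" "(\<Sum>v\<in>S. Q v) = 1"
    and eq: "\<And>v. v \<in> S \<Longrightarrow> tr (P v) = tr (Q v)"
  obtains U where "U \<in> M" "star U * U = 1" "U * star U = 1" "\<And>v. v \<in> S \<Longrightarrow> star U * P v * U = Q v"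
proof -
  have "\<exists>W. W \<in> M \<and> star W * W = Q v \<and> W * star W = P v" if v: "v \<in> S" for v
    using comparison[OF Q(1,2)[OF v] P(1,2)[OF v]] eq[OF v] by metis
  then obtain W where W: "\<And>v. v \<in> S \<Longrightarrow> W v \<in> M" "\<And>v. v \<in> S \<Longrightarrow> star (W v) * W v = Q v"
    "\<And>v. v \<in> S \<Longrightarrow> W v * star (W v) = P v" by metis
  have WQ: "W v * Q v = W v" "Q v * star (W v) = star (W v)" if "v \<in> S" for v
    using partial_isometry_mult[of "W v"] W(2)[OF that] Q(2)[OF that] by auto
  have PW: "P v * W v = W v" "star (W v) * P v = star (W v)" if "v \<in> S" for v
    using W(2,3)[OF that] WQ[OF that] by (metis mult.assoc)+
  have PW': "P v * W w = (if v = w then W w else 0)" if "v \<in> S" "w \<in> S" for v w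
  proof (cases "v = w")
    case False
    have "P v * W w = (P v * P w) * W w" using PW(1)[OF that(2)] by (simp add: mult.assoc)
    then show ?thesis using P(3)[OF that False] False by simp
  qed (use PW that in simp)
  have WW: "star (W v) * W w = (if v = w then Q v else 0)" if "v \<in> S" "w \<in> S" for v w
  proof -
    have "star (W v) * W w = star (W v) * (P v * W w)" using PW(2)[OF that(1)] by (metis mult.assoc)
    then show ?thesis using PW'[OF that] W(2) that by auto
  qed
  have WW': "W v * star (W w) = (if v = w then P v else 0)" if "v \<in> S" "w \<in> S" for v w
  proof -
    have "W v * star (W w) = W v * (Q v * Q w) * star (W w)"
      using WQ(1)[OF that(1)] WQ(2)[OF that(2)] by (metis mult.assoc)
    then show ?thesis using Q(2,3)[of v] Q(3)[OF that] W(3) that WQ by (auto simp: proj_idem)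
  qed
  define U where "U = (\<Sum>v\<in>S. W v)"
  have UM: "U \<in> M" unfolding U_def using W(1) by (intro M_closed)
  have PU: "P v * U = W v" if v: "v \<in> S" for v
  proof -
    have "P v * U = (\<Sum>w\<in>S. if v = w then W w else 0)"
      unfolding U_def sum_distrib_left using PW' v by (intro sum.cong) auto
    then show ?thesis using S v by simp
  qed
  have sUW: "star U * W v = Q v" if v: "v \<in> S" for v
  proof -
    have "star U * W v = (\<Sum>w\<in>S. if w = v then Q w else 0)"
      unfolding U_def star_sum sum_distrib_right using WW v by (intro sum.cong) auto
    then show ?thesis using S v by simp
  qed
  have WsU: "W v * star U = P v" if v: "v \<in> S" for v
  proof -
    have "W v * star U = (\<Sum>w\<in>S. if v = w then P v else 0)"
      unfolding U_def star_sum sum_distrib_left using WW' v by (intro sum.cong) auto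
    then show ?thesis using S v by simp
  qed
  have "star U * U = (\<Sum>v\<in>S. star U * W v)" by (simp add: U_def sum_distrib_left)
  then have 1: "star U * U = 1" using sUW Q(4) by simp
  have "U * star U = (\<Sum>v\<in>S. W v * star U)"
    by (subst (1) U_def) (simp add: sum_distrib_right)
  then have 2: "U * star U = 1" using WsU P(4) by simp
  have "star U * P v * U = Q v" if "v \<in> S" for v
    using PU[OF that] sUW[OF that] by (simp add: mult.assoc)
  then show ?thesis using that UM 1 2 by blast
qed

section \<open>The two inclusions for the closure of the expected orbit\<close>

context masa_factor
begin

lemma norm_tau: "X \<in> M \<Longrightarrow> norm (\<tau> X) \<le> 2 * norm X"
  using norm_tau_mult_proj[of X 1] M_closed by (simp add: tr_def tau_1)

lemma tau_limit:
  assumes "\<And>n. X n \<in> M" "X \<longlonglongrightarrow> Y" "\<And>n. \<tau> (X n) = c"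
  shows "\<tau> Y = c"
proof -
  have YM: "Y \<in> M" using vna_closed[OF vna_M] assms closed_sequentially by blast
  have "(\<lambda>n. 2 * norm (X n - Y)) \<longlonglongrightarrow> 2 * 0"
    using assms(2) by (intro tendsto_intros tendsto_norm_zero) (simp add: LIM_zero)
  moreover have "norm (c - \<tau> Y) \<le> 2 * norm (X n - Y)" for n
    using norm_tau[of "X n - Y"] assms YM by (simp add: M_closed tau_diff)
  ultimately have "norm (c - \<tau> Y) \<le> 2 * 0"
    by (intro LIMSEQ_le_const) blast+
  then show ?thesis by simp
qed

definition orbit :: "'h cop \<Rightarrow> 'h cop set" where
  "orbit N = {E (star U * N * U) | U. U \<in> M \<and> star U * U = 1 \<and> U * star U = 1}"

lemma closure_orbit_subset:
  assumes N: "N \<in> M" and S: "finite S" and P: "\<And>v. v \<in> S \<Longrightarrow> proj (P v)" "\<And>v. v \<in> S \<Longrightarrow> P v \<in> M"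
      "(\<Sum>v\<in>S. P v) = 1" "N = (\<Sum>v\<in>S. v *\<^sub>C P v)"
    and Y: "Y \<in> closure (orbit N)"
  shows "Y \<in> A" "\<tau> Y = \<tau> N" "spec Y \<subseteq> convex hull S"
proof -
  obtain X where X: "\<And>n. X n \<in> orbit N" "X \<longlonglongrightarrow> Y"
    using Y unfolding closure_sequential by blast
  have "\<exists>U. X n = E (star U * N * U) \<and> U \<in> M \<and> star U * U = 1 \<and> U * star U = 1" for n
    using X(1)[of n] by (auto simp: orbit_def)
  then obtain U where U: "\<And>n. X n = E (star (U n) * N * U n)" "\<And>n. U n \<in> M"
    "\<And>n. star (U n) * U n = 1" "\<And>n. U n * star (U n) = 1" by metis
  have UNU: "star (U n) * T * U n \<in> M" if "T \<in> M" for n T using that U(2) by (intro M_closed)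
  have XA: "X n \<in> A" for n unfolding U(1) by (intro E_in UNU N)
  show YA: "Y \<in> A" using vna_closed[OF vna_A] XA X(2) closed_sequentially by blast
  have "\<tau> (X n) = \<tau> N" for n
  proof -
    have "\<tau> (X n) = \<tau> (star (U n) * (N * U n))"
      unfolding U(1) E_tau[OF UNU[OF N]] by (simp only: mult.assoc)
    also have "\<dots> = \<tau> ((N * U n) * star (U n))" using N U(2) by (intro tau_commute M_closed)
    finally show ?thesis by (simp add: mult.assoc U(4))
  qed
  then show "\<tau> Y = \<tau> N" using tau_limit[of X, OF A_M[OF XA] X(2)] by blast
  show "spec Y \<subseteq> convex hull S"
  proof (rule subsetI, rule ccontr)
    fix z assume z: "z \<in> spec Y" "z \<notin> convex hull S"
    have "closed (convex hull S)" using finite_imp_compact_convex_hull[OF S] compact_imp_closed by blast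
    then obtain a b where ab: "inner a z < b" "\<And>v. v \<in> convex hull S \<Longrightarrow> b < inner a v"
      using separating_hyperplane_closed_point[OF convex_convex_hull _ z(2)] by blast
    define d where "d = b - inner a z"
    have d: "0 < d" using ab(1) by (simp add: d_def)
    have av: "d \<le> Re (cnj a * (v - z))" if "v \<in> S" for v
    proof -
      have "b < inner a v" using ab(2) that hull_inc by metis
      then show ?thesis by (simp add: d_def inner_complex_def algebra_simps)
    qed
    \<comment> \<open>The form of \<open>X n\<close> at \<open>x\<close> combines the points of
      \<open>S\<close> with weights \<open>c v \<ge> 0\<close> of total
      \<open>(norm x)\<^sup>2\<close>, and the hyperplane puts every point at least \<open>d\<close>
      away from \<open>z\<close>. The bound does not depend on \<open>n\<close>, so it passes to
      \<open>Y\<close>.\<close>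
    have low: "d * (norm x)\<^sup>2 \<le> Re (cinner ((cnj a *\<^sub>C (X n - z *\<^sub>C 1)) \<cdot> x) x)" for n x
    proof -
      define B where "B v = E (star (U n) * P v * U n)" for v
      have Bpos: "pos (B v)" if "v \<in> S" for v
        unfolding B_def using P that UNU by (intro E_pos pos_conj pos_proj) auto
      define c where "c v = Re (cinner (B v \<cdot> x) x)" for v
      have c: "cinner (B v \<cdot> x) x = of_real (c v)" "0 \<le> c v" if "v \<in> S" for v
        using Bpos[OF that] cinner_self_adjoint_real[of "B v" x] by (auto simp: pos_iff_self_adjoint c_def)
      have "X n = (\<Sum>v\<in>S. v *\<^sub>C B v)"
      proof -
        have "star (U n) * N * U n = (\<Sum>v\<in>S. v *\<^sub>C (star (U n) * P v * U n))"
          by (simp add: P(4) sum_distrib_left sum_distrib_right)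
        then show ?thesis unfolding U(1) B_def using P(2) UNU
          by (simp add: E_sum E_scaleC M_closed)
      qed
      then have 1: "cinner (X n \<cdot> x) x = (\<Sum>v\<in>S. v * of_real (c v))"
        by (simp add: app_sum cinner_sum_left cinner_scaleC_left c)
      have "(\<Sum>v\<in>S. B v) = E (\<Sum>v\<in>S. star (U n) * P v * U n)"
        unfolding B_def using P(2) UNU by (intro E_sum[symmetric]) blast
      also have "\<dots> = E (star (U n) * (\<Sum>v\<in>S. P v) * U n)"
        by (simp add: sum_distrib_left sum_distrib_right)
      also have "\<dots> = 1" by (simp add: P(3) U(3) E_id A_closed)
      finally have B1: "(\<Sum>v\<in>S. B v) = 1" .
      have "cinner ((\<Sum>v\<in>S. B v) \<cdot> x) x = (\<Sum>v\<in>S. of_real (c v))"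
        by (simp add: app_sum cinner_sum_left c)
      then have 2: "cinner x x = (\<Sum>v\<in>S. of_real (c v))" by (simp only: B1 app_simps(2))
      have "cinner ((cnj a *\<^sub>C (X n - z *\<^sub>C 1)) \<cdot> x) x = cnj a * (cinner (X n \<cdot> x) x - z * cinner x x)"
        by (simp add: cinner_diff_left cinner_scaleC_left)
      also have "\<dots> = (\<Sum>v\<in>S. of_real (c v) * (cnj a * (v - z)))"
        unfolding 1 2 by (simp add: sum_distrib_left sum_subtractf algebra_simps)
      finally have "Re (cinner ((cnj a *\<^sub>C (X n - z *\<^sub>C 1)) \<cdot> x) x) = (\<Sum>v\<in>S. c v * Re (cnj a * (v - z)))"
        by simp
      moreover have "(\<Sum>v\<in>S. c v * d) \<le> (\<Sum>v\<in>S. c v * Re (cnj a * (v - z)))"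
        using av c(2) by (intro sum_mono mult_left_mono) auto
      moreover have "(norm x)\<^sup>2 = (\<Sum>v\<in>S. c v)"
        using arg_cong[OF 2, of Re] by (simp add: cinner_self flip: of_real_power)
      ultimately show ?thesis by (simp only: mult.commute[of d] sum_distrib_right)
    qed
    have "d * (norm x)\<^sup>2 \<le> Re (cinner ((cnj a *\<^sub>C (Y - z *\<^sub>C 1)) \<cdot> x) x)" for x
    proof -
      have "(\<lambda>n. (X n - Y) \<cdot> x) \<longlonglongrightarrow> 0"
      proof (rule Lim_null_comparison)
        show "\<forall>\<^sub>F n in sequentially. norm ((X n - Y) \<cdot> x) \<le> norm (X n - Y) * norm x"
          by (intro always_eventually allI norm_app)
        show "(\<lambda>n. norm (X n - Y) * norm x) \<longlonglongrightarrow> 0"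
          using X(2) by (intro tendsto_mult_left_zero tendsto_norm_zero) (simp add: LIM_zero)
      qed
      then have "(\<lambda>n. X n \<cdot> x) \<longlonglongrightarrow> Y \<cdot> x" by (simp add: LIM_zero_iff)
      then have "(\<lambda>n. Re (cinner ((cnj a *\<^sub>C (X n - z *\<^sub>C 1)) \<cdot> x) x))
          \<longlonglongrightarrow> Re (cinner ((cnj a *\<^sub>C (Y - z *\<^sub>C 1)) \<cdot> x) x)"
        unfolding app_simps by (intro tendsto_Re tendsto_cinner tendsto_scaleC tendsto_intros)
      then show ?thesis using low by (intro LIMSEQ_le_const) auto
    qed
    then obtain R where R: "R * (cnj a *\<^sub>C (Y - z *\<^sub>C 1)) = 1" "(cnj a *\<^sub>C (Y - z *\<^sub>C 1)) * R = 1"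
      using inverse_of_strictly_accretive[OF d] by blast
    \<comment> \<open>The factor \<open>cnj a\<close> is absorbed into the inverse.\<close>
    then have "(cnj a *\<^sub>C R) * (Y - z *\<^sub>C 1) = 1" "(Y - z *\<^sub>C 1) * (cnj a *\<^sub>C R) = 1" by simp_all
    then show False using z(1) unfolding spec_def by blast
  qed
qed

text \<open>Replacing \<open>Y\<close> on each block \<open>g\<close> by a point of the hull turns
  the normalised trace into a convex combination with weights \<open>tr (g * e) / tr e\<close>. The
  error is arbitrarily small and the hull is closed.\<close>

lemma compressed_trace_in_hull:
  assumes S: "finite S" "S \<noteq> {}" and Y: "Y \<in> A" "spec Y \<subseteq> convex hull S" and e: "e \<in> A" "proj e" "e \<noteq> 0"
  shows "\<tau> (Y * e) / of_real (tr e) \<in> convex hull S"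
proof -
  define K where "K = convex hull S"
  have K: "closed K" "convex K" "K \<noteq> {}"
    using finite_imp_compact_convex_hull[OF S(1)] compact_imp_closed S(2) by (auto simp: K_def)
  then obtain h0 where h0: "h0 \<in> K" by blast
  have t: "0 < tr e" using tr_nonneg[of e] tr_eq_0[of e] e A_M by force
  have "\<exists>h\<in>K. dist h (\<tau> (Y * e) / of_real (tr e)) < \<eta>" if "0 < \<eta>" for \<eta>
  proof -
    have \<eta>: "0 < \<eta> / 3" using that by simp
    obtain G where G: "G \<subseteq> A" "ortho G" "\<Sum>G = 1"
      "\<forall>g\<in>G. g \<noteq> 0 \<longrightarrow> (\<exists>l\<in>spec Y. norm (Y * g - l *\<^sub>C g) \<le> \<eta> / 3)"
      using normal_approx_in_spec[OF vna_A A_commute Y(1) \<eta>] by blast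
    \<comment> \<open>On the zero block any point of the hull will do; \<open>h0\<close> is the
      default.\<close>
    have "\<exists>l\<in>K. norm (Y * g - l *\<^sub>C g) \<le> \<eta> / 3" if "g \<in> G" for g
      using G(4) that Y(2) h0 \<eta> by (cases "g = 0") (auto simp: K_def)
    then obtain l where l: "\<And>g. g \<in> G \<Longrightarrow> l g \<in> K" "\<And>g. g \<in> G \<Longrightarrow> norm (Y * g - l g *\<^sub>C g) \<le> \<eta> / 3"
      by metis
    have fin: "finite G" using G by (simp add: ortho_def)
    have g: "proj (g * e)" "g * e \<in> A" "g * e \<in> M" "g \<in> M" "g * (g * e) = g * e" if "g \<in> G" for g
    proof -
      have "g \<in> A" "proj g" using that G by (auto simp: ortho_def)
      show "proj (g * e)" "g * e \<in> A" "g * e \<in> M" "g \<in> M" "g * (g * e) = g * e"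
        by (fact proj_mult[OF \<open>proj g\<close> e(2) A_commute[OF \<open>g \<in> A\<close> e(1)]] vna_mult[OF vna_A \<open>g \<in> A\<close> e(1)]
            A_M[OF vna_mult[OF vna_A \<open>g \<in> A\<close> e(1)]] A_M[OF \<open>g \<in> A\<close>] proj_idem_left[OF \<open>proj g\<close>])+
    qed
    have sum_e: "(\<Sum>g\<in>G. tr (g * e)) = tr e"
      using tr_sum[of G "\<lambda>g. g * e"] g(3) G(3) by (simp flip: sum_distrib_right)
    define h where "h = (\<Sum>g\<in>G. (tr (g * e) / tr e) *\<^sub>R l g)"
    have "h \<in> K"
      unfolding h_def
    proof (rule convex_sum[OF fin K(2)])
      show "(\<Sum>g\<in>G. tr (g * e) / tr e) = 1" using sum_e t by (simp flip: sum_divide_distrib)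
      show "0 \<le> tr (g * e) / tr e" if "g \<in> G" for g using t g that tr_nonneg by simp
    qed (use l in blast)
    moreover have "norm (\<tau> (Y * e) - of_real (tr e) * h) \<le> 2 * (\<eta> / 3) * tr e"
    proof -
      have "Y * e = (\<Sum>g\<in>G. Y * (g * e))"
        by (simp add: G(3) flip: sum_distrib_left sum_distrib_right)
      then have "\<tau> (Y * e) = (\<Sum>g\<in>G. \<tau> (Y * (g * e)))"
        using g(3) A_M[OF Y(1)] by (simp add: tau_sum M_closed)
      moreover have "of_real (tr e) * h = (\<Sum>g\<in>G. l g * \<tau> (g * e))"
        unfolding h_def sum_distrib_left using t g tau_proj
        by (intro sum.cong refl) (simp add: scaleR_conv_of_real)
      moreover have "\<tau> ((Y * g - l g *\<^sub>C g) * (g * e)) = \<tau> (Y * (g * e)) - l g * \<tau> (g * e)" if "g \<in> G" for g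
      proof -
        have "(Y * g - l g *\<^sub>C g) * (g * e) = Y * (g * e) - l g *\<^sub>C (g * e)"
          using g(5)[OF that] by (simp add: left_diff_distrib mult.assoc)
        then show ?thesis using g(3)[OF that] A_M[OF Y(1)] by (simp add: tau_diff tau_scaleC M_closed)
      qed
      ultimately have "\<tau> (Y * e) - of_real (tr e) * h = (\<Sum>g\<in>G. \<tau> ((Y * g - l g *\<^sub>C g) * (g * e)))"
        by (simp add: sum_subtractf)
      also have "norm \<dots> \<le> (\<Sum>g\<in>G. 2 * (\<eta> / 3) * tr (g * e))"
      proof (rule sum_norm_le)
        fix x assume x: "x \<in> G"
        have "norm (\<tau> ((Y * x - l x *\<^sub>C x) * (x * e))) \<le> 2 * norm (Y * x - l x *\<^sub>C x) * tr (x * e)"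
          using g[OF x] A_M[OF Y(1)] by (intro norm_tau_mult_proj vna_diff[OF vna_M]
              vna_scaleC[OF vna_M] vna_mult[OF vna_M, of Y x])
        also have "\<dots> \<le> 2 * (\<eta> / 3) * tr (x * e)"
          using l(2)[OF x] tr_nonneg g[OF x] by (intro mult_right_mono) auto
        finally show "norm (\<tau> ((Y * x - l x *\<^sub>C x) * (x * e))) \<le> 2 * (\<eta> / 3) * tr (x * e)" .
      qed
      also have "\<dots> = 2 * (\<eta> / 3) * tr e" by (simp only: sum_e flip: sum_distrib_left)
      finally show ?thesis .
    qed
    then have "norm (of_real (tr e) * (\<tau> (Y * e) / of_real (tr e) - h)) \<le> 2 * (\<eta> / 3) * tr e"
      using t by (simp add: right_diff_distrib)
    then have "norm (\<tau> (Y * e) / of_real (tr e) - h) \<le> 2 * (\<eta> / 3)"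
      using t by (simp add: norm_mult mult.commute)
    then have "dist h (\<tau> (Y * e) / of_real (tr e)) < \<eta>"
      using that by (simp add: dist_norm norm_minus_commute)
    ultimately show ?thesis by blast
  qed
  then have "\<tau> (Y * e) / of_real (tr e) \<in> closure K" by (simp add: closure_approachable)
  then show ?thesis using K by (simp add: K_def)
qed

lemma closure_orbit_supset:
  assumes N: "N \<in> M" and S: "card S = 3" "\<not> collinear S" and P: "\<And>v. proj (P v)" "\<And>v. P v \<in> M"
      "\<And>v w. v \<noteq> w \<Longrightarrow> P v * P w = 0" "(\<Sum>v\<in>S. P v) = 1" "N = (\<Sum>v\<in>S. v *\<^sub>C P v)"
    and Y: "Y \<in> A" "\<tau> Y = \<tau> N" "spec Y \<subseteq> convex hull S"
  shows "Y \<in> closure (orbit N)"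
  unfolding closure_approachable
proof (intro allI impI)
  fix \<epsilon> :: real assume \<epsilon>: "0 < \<epsilon>"
  have fin: "finite S" "S \<noteq> {}" using S(1) by (auto simp: card_ge_0_finite)
  \<comment> \<open>A block loses at most \<open>d\<close> in the mixing, \<open>2 * d\<close>
    between \<open>L\<close> and the spectral value \<open>l\<close>, and \<open>d\<close> between
    \<open>l\<close> and \<open>Y\<close>. The sum \<open>4 * d\<close> is not enlarged by gluing
    and stays below \<epsilon>.\<close>
  define d where "d = \<epsilon> / 5"
  have d: "0 < d" using \<epsilon> by (simp add: d_def)
  obtain F where F: "F \<subseteq> A" "ortho F" "\<Sum>F = 1"
    "\<forall>e\<in>F. e \<noteq> 0 \<longrightarrow> (\<exists>l\<in>spec Y. norm (Y * e - l *\<^sub>C e) \<le> d)"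
    using normal_approx_in_spec[OF vna_A A_commute Y(1) d] by blast
  have finF: "finite F" using F by (simp add: ortho_def)
  have eF: "proj e" "e \<in> A" "e \<in> M" if "e \<in> F" for e using that F A_M by (auto simp: ortho_def)
  have YM: "Y \<in> M" using Y(1) by (rule A_M)
  \<comment> \<open>The family may miss \<open>Y * e\<close> in norm, but its weighted traces must
    give the trace of \<open>Y * e\<close> exactly: only an exact identity can be summed over the
    blocks and compared with the trace of \<open>N\<close>.\<close>
  define good where "good e Q \<longleftrightarrow> (\<forall>v\<in>S. Q v \<in> M \<and> proj (Q v)) \<and> (\<forall>v\<in>S. \<forall>w\<in>S. v \<noteq> w \<longrightarrow> Q v * Q w = 0) \<and>
    (\<Sum>v\<in>S. Q v) = e \<and> (\<Sum>v\<in>S. of_real (tr (Q v)) * v) = \<tau> (Y * e) \<and>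
    norm (E (\<Sum>v\<in>S. v *\<^sub>C Q v) - Y * e) \<le> 4 * d" for e and Q :: "complex \<Rightarrow> 'h cop"
  have "\<exists>Q. good e Q" if e: "e \<in> F" for e
  proof (cases "e = 0")
    case True
    then show ?thesis
      using d by (intro exI[of _ "\<lambda>_. 0"]) (simp add: good_def M_closed tr_def tau_0 E_id A_closed)
  next
    case False
    define L where "L = \<tau> (Y * e) / of_real (tr e)"
    have t: "0 < tr e" using tr_nonneg[of e] tr_eq_0[of e] eF[OF e] False by force
    have "L \<in> convex hull S"
      unfolding L_def by (rule compressed_trace_in_hull[OF fin Y(1,3) eF(2,1)[OF e] False])
    then obtain a where a: "\<And>v. v \<in> S \<Longrightarrow> 0 \<le> a v" "sum a S = 1" "(\<Sum>v\<in>S. a v *\<^sub>R v) = L"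
      unfolding convex_hull_finite[OF fin(1)] by auto
    obtain Q where Q: "\<forall>v\<in>S. Q v \<in> M \<and> proj (Q v) \<and> tr (Q v) = a v * tr e"
      "\<forall>v\<in>S. \<forall>w\<in>S. v \<noteq> w \<longrightarrow> Q v * Q w = 0" "(\<Sum>v\<in>S. Q v) = e"
      "norm (E (\<Sum>v\<in>S. v *\<^sub>C Q v) - (\<Sum>v\<in>S. of_real (a v) * v) *\<^sub>C e) \<le> d"
      using local_mixing[OF eF(2,1)[OF e] False fin(1) a(1,2) d] by blast
    have aL: "(\<Sum>v\<in>S. of_real (a v) * v) = L" using a(3) by (simp add: scaleR_conv_of_real)
    have "(\<Sum>v\<in>S. of_real (tr (Q v)) * v) = (\<Sum>v\<in>S. of_real (a v) * v) * of_real (tr e)"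
      unfolding sum_distrib_right using Q(1) by (intro sum.cong) auto
    then have trQ: "(\<Sum>v\<in>S. of_real (tr (Q v)) * v) = \<tau> (Y * e)"
      unfolding aL L_def using t by simp
    obtain l where l: "norm (Y * e - l *\<^sub>C e) \<le> d" using F(4) e False by blast
    have "norm (\<tau> ((Y * e - l *\<^sub>C e) * e)) \<le> 2 * norm (Y * e - l *\<^sub>C e) * tr e"
      using YM eF[OF e] by (intro norm_tau_mult_proj M_closed)
    also have "\<dots> \<le> 2 * d * tr e" using l t by (intro mult_right_mono) auto
    also have "\<tau> ((Y * e - l *\<^sub>C e) * e) = (L - l) * of_real (tr e)"
    proof -
      have "(Y * e - l *\<^sub>C e) * e = Y * e - l *\<^sub>C e"
        using eF(1)[OF e] by (simp add: left_diff_distrib mult.assoc proj_idem)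
      then show ?thesis
        using YM eF[OF e] t by (simp add: tau_diff tau_scaleC tau_proj M_closed L_def left_diff_distrib)
    qed
    finally have Ll: "norm (L - l) \<le> 2 * d" using t by (simp add: norm_mult)
    have "E (\<Sum>v\<in>S. v *\<^sub>C Q v) - Y * e
      = (E (\<Sum>v\<in>S. v *\<^sub>C Q v) - L *\<^sub>C e) + ((L - l) *\<^sub>C e - (Y * e - l *\<^sub>C e))"
      by (simp add: scaleC_cop_simps)
    also have "norm \<dots> \<le> norm (E (\<Sum>v\<in>S. v *\<^sub>C Q v) - L *\<^sub>C e) + norm ((L - l) *\<^sub>C e - (Y * e - l *\<^sub>C e))"
      by (rule norm_triangle_ineq)
    also have "\<dots> \<le> d + (norm ((L - l) *\<^sub>C e) + norm (Y * e - l *\<^sub>C e))"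
      using Q(4) unfolding aL by (intro add_mono norm_triangle_ineq4)
    also have "\<dots> \<le> d + (2 * d * 1 + d)"
      using Ll l proj_norm[OF eF(1)[OF e]] d unfolding norm_scaleC_cop by (intro add_mono mult_mono) auto
    finally have "norm (E (\<Sum>v\<in>S. v *\<^sub>C Q v) - Y * e) \<le> 4 * d" by simp
    then show ?thesis using Q(1-3) trQ by (intro exI[of _ Q]) (simp add: good_def)
  qed
  then obtain Q where good: "\<And>e. e \<in> F \<Longrightarrow> good e (Q e)" by metis
  have Q: "Q e v \<in> M" "proj (Q e v)" if "e \<in> F" "v \<in> S" for e v
    using good[OF that(1)] that(2) by (auto simp: good_def)
  have Qorth: "Q e v * Q e w = 0" if "e \<in> F" "v \<in> S" "w \<in> S" "v \<noteq> w" for e v w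
    using good[OF that(1)] that by (auto simp: good_def)
  have Qsum: "(\<Sum>v\<in>S. Q e v) = e" if "e \<in> F" for e using good[OF that] by (simp add: good_def)
  have Qe: "Q e v * e = Q e v" "e * Q e v = Q e v" if ev: "e \<in> F" "v \<in> S" for e v
  proof -
    have "Q e v * e = (\<Sum>w\<in>S. Q e v * Q e w)"
      by (simp only: Qsum[OF ev(1)] flip: sum_distrib_left)
    also have "\<dots> = Q e v * Q e v + (\<Sum>w\<in>S - {v}. Q e v * Q e w)"
      by (rule sum.remove[OF fin(1) ev(2)])
    also have "(\<Sum>w\<in>S - {v}. Q e v * Q e w) = 0" using Qorth ev by (intro sum.neutral) auto
    finally show 1: "Q e v * e = Q e v" using Q(2)[OF ev] by (simp add: proj_idem)
    show "e * Q e v = Q e v"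
      using arg_cong[OF 1, of star] Q(2)[OF ev] eF(1)[OF ev(1)] by (simp add: proj_def)
  qed
  have Q0: "Q e v * Q f w = 0" if "e \<in> F" "f \<in> F" "v \<in> S" "w \<in> S" "e \<noteq> f \<or> v \<noteq> w" for e f v w
  proof (cases "e = f")
    case True
    then show ?thesis using Qorth that by auto
  next
    case False
    have "Q e v * Q f w = Q e v * (e * f) * Q f w"
      using Qe(1)[OF that(1,3)] Qe(2)[OF that(2,4)] by (metis mult.assoc)
    also have "e * f = 0" using F(2) that False by (simp add: ortho_def)
    finally show ?thesis by simp
  qed
  define R where "R v = (\<Sum>e\<in>F. Q e v)" for v
  have RM: "R v \<in> M" if "v \<in> S" for v unfolding R_def using Q that by (intro M_closed)
  have Rprod: "R v * R w = (if v = w then R v else 0)" if "v \<in> S" "w \<in> S" for v w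
  proof -
    have "R v * R w = (\<Sum>e\<in>F. \<Sum>f\<in>F. Q e v * Q f w)" by (simp add: R_def sum_product)
    also have "\<dots> = (\<Sum>e\<in>F. \<Sum>f\<in>F. if f = e then if v = w then Q e v else 0 else 0)"
      using Q0 Q(2) that by (intro sum.cong refl) (auto simp: proj_idem)
    also have "\<dots> = (if v = w then R v else 0)" using finF by (simp add: R_def)
    finally show ?thesis .
  qed
  have Rproj: "proj (R v)" if "v \<in> S" for v
    using Rprod[OF that that] Q(2) that by (simp add: proj_def R_def star_sum)
  have Rsum: "(\<Sum>v\<in>S. R v) = 1"
    unfolding R_def by (subst sum.swap) (simp add: Qsum F(3))
  have trR: "tr (R v) = (\<Sum>e\<in>F. tr (Q e v))" if "v \<in> S" for v
    unfolding R_def using Q that by (intro tr_sum)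
  \<comment> \<open>Summed over the blocks, the exact trace conditions give \<tau> of
    \<open>Y\<close>, which is \<tau> of \<open>N\<close>. So the traces of the \<open>P v\<close>
    and of the \<open>R v\<close> have equal total and equal weighted sum.\<close>
  have tr_eq: "tr (P v) = tr (R v)" if "v \<in> S" for v
  proof (rule barycentric_unique[OF S _ _ that])
    show "(\<Sum>v\<in>S. tr (P v)) = (\<Sum>v\<in>S. tr (R v))"
      using tr_sum[of S P] tr_sum[of S R] P(2) RM by (simp add: P(4) Rsum)
    have "(\<Sum>v\<in>S. of_real (tr (P v)) * v) = \<tau> N"
      unfolding P(5) using P by (subst tau_sum) (auto simp: tau_scaleC tau_proj M_closed mult.commute)
    also have "\<dots> = \<tau> (\<Sum>e\<in>F. Y * e)" by (simp add: Y(2) F(3) flip: sum_distrib_left)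
    also have "\<dots> = (\<Sum>e\<in>F. \<tau> (Y * e))" using YM eF by (intro tau_sum M_closed)
    also have "\<dots> = (\<Sum>e\<in>F. \<Sum>v\<in>S. of_real (tr (Q e v)) * v)"
      using good by (intro sum.cong) (auto simp: good_def)
    also have "\<dots> = (\<Sum>v\<in>S. of_real (tr (R v)) * v)"
      by (subst sum.swap) (simp add: trR sum_distrib_right)
    finally show "(\<Sum>v\<in>S. of_real (tr (P v)) * v) = (\<Sum>v\<in>S. of_real (tr (R v)) * v)" .
  qed
  obtain U where U: "U \<in> M" "star U * U = 1" "U * star U = 1" "\<And>v. v \<in> S \<Longrightarrow> star U * P v * U = R v"
  proof (rule unitary_of_equal_traces[of S P R])
    show "\<And>v w. v \<in> S \<Longrightarrow> w \<in> S \<Longrightarrow> v \<noteq> w \<Longrightarrow> R v * R w = 0" using Rprod by auto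
  qed (use fin P RM Rproj Rsum tr_eq in auto)
  have "star U * N * U = (\<Sum>v\<in>S. v *\<^sub>C (star U * P v * U))"
    by (simp add: P(5) sum_distrib_left sum_distrib_right)
  also have "\<dots> = (\<Sum>v\<in>S. v *\<^sub>C R v)" using U(4) by simp
  also have "\<dots> = (\<Sum>e\<in>F. \<Sum>v\<in>S. v *\<^sub>C Q e v)"
    unfolding R_def scaleC_sum_right by (rule sum.swap)
  finally have UNU: "star U * N * U = (\<Sum>e\<in>F. \<Sum>v\<in>S. v *\<^sub>C Q e v)" .
  have ZM: "(\<Sum>v\<in>S. v *\<^sub>C Q e v) \<in> M" if "e \<in> F" for e using Q that by (intro M_closed; simp)
  have "E (star U * N * U) - Y = (\<Sum>e\<in>F. E (\<Sum>v\<in>S. v *\<^sub>C Q e v)) - (\<Sum>e\<in>F. Y * e)"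
    unfolding UNU using ZM by (simp add: E_sum F(3) flip: sum_distrib_left)
  also have "\<dots> = (\<Sum>e\<in>F. E (\<Sum>v\<in>S. v *\<^sub>C Q e v) - Y * e)" by (rule sum_subtractf[symmetric])
  also have "norm \<dots> \<le> 4 * d"
  proof (rule norm_ortho_sum_le[OF F(2)])
    fix e assume e: "e \<in> F"
    define Z where "Z = (\<Sum>v\<in>S. v *\<^sub>C Q e v)"
    \<comment> \<open>The module property of \<open>E\<close> keeps each error under its own
      \<open>e\<close>, as the norm bound for block sums requires.\<close>
    have "e * Z = Z" unfolding Z_def sum_distrib_left using Qe(2)[OF e] by (intro sum.cong) auto
    then have eEZ: "e * E Z = E Z"
      using E_module[OF ZM[OF e] eF(2)[OF e] A_closed(2)] by (simp add: Z_def)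
    have ye: "e * (Y * e) = Y * e" using A_commute[OF eF(2)[OF e] Y(1)] eF(1)[OF e]
      by (metis mult.assoc proj_idem)
    show 1: "e * (E (\<Sum>v\<in>S. v *\<^sub>C Q e v) - Y * e) = E (\<Sum>v\<in>S. v *\<^sub>C Q e v) - Y * e"
      using eEZ ye by (simp add: right_diff_distrib flip: Z_def)
    have "E (\<Sum>v\<in>S. v *\<^sub>C Q e v) - Y * e \<in> A"
      using ZM[OF e] eF[OF e] Y(1) by (intro A_closed E_in)
    then show "(E (\<Sum>v\<in>S. v *\<^sub>C Q e v) - Y * e) * e = E (\<Sum>v\<in>S. v *\<^sub>C Q e v) - Y * e"
      using A_commute[OF eF(2)[OF e]] 1 by metis
    show "norm (E (\<Sum>v\<in>S. v *\<^sub>C Q e v) - Y * e) \<le> 4 * d" using good[OF e] by (simp add: good_def)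
  qed (use d in simp)
  finally have "dist (E (star U * N * U)) Y < \<epsilon>" using \<epsilon> by (simp add: dist_norm d_def)
  moreover have "E (star U * N * U) \<in> orbit N" using U by (auto simp: orbit_def)
  ultimately show "\<exists>y\<in>orbit N. dist y Y < \<epsilon>" by blast
qed

text \<open>\<open>N\<close> need not lie in \<open>A\<close>. Its spectral projections are found in
  the bicommutant of \<open>N\<close> and \<open>star N\<close>, which is abelian by normality of
  \<open>N\<close> and contained in \<open>M\<close>.\<close>

theorem closure_orbit:
  assumes N: "N \<in> M" "star N * N = N * star N" and S: "card (spec N) = 3" "\<not> collinear (spec N)"
  shows "closure (orbit N) = {Y \<in> A. \<tau> Y = \<tau> N \<and> spec Y \<subseteq> closure (convex hull spec N)}"
proof -
  have fin: "finite (spec N)" using S(1) by (simp add: card_ge_0_finite)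
  define G where "G = {N, star N}"
  define C where "C = cmt (cmt G)"
  have "vna C" unfolding C_def by (rule vna_bicommutant) (auto simp: G_def)
  moreover have "G \<subseteq> cmt G" using N(2) by (auto simp: G_def cmt_def)
  then have "X * Y = Y * X" if "X \<in> C" "Y \<in> C" for X Y
    using abelian_bicommutant that by (auto simp: C_def)
  moreover have "N \<in> C" unfolding C_def using subset_cmt_cmt[of G] by (auto simp: G_def)
  moreover have "C \<subseteq> cmt (cmt M)"
    unfolding C_def using N M_closed(8) by (intro cmt_anti) (auto simp: G_def)
  then have CM: "C \<subseteq> M" using vna_M by (simp add: vna_def)
  ultimately obtain P where P: "\<And>v. proj (P v)" "\<And>v. P v \<in> C" "\<And>v w. v \<noteq> w \<Longrightarrow> P v * P w = 0"
    "(\<Sum>v\<in>spec N. P v) = 1" "N = (\<Sum>v\<in>spec N. v *\<^sub>C P v)"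
    using normal_finite_spec[of C N] fin by metis
  have PM: "P v \<in> M" for v using P(2) CM by blast
  have cl: "closure (convex hull spec N) = convex hull spec N"
    by (intro closure_closed compact_imp_closed finite_imp_compact_convex_hull fin)
  show ?thesis
    unfolding cl
    using closure_orbit_subset[OF N(1) fin P(1) PM P(4,5)]
      closure_orbit_supset[OF N(1) S P(1) PM P(3-5)] by blast
qed

end

section \<open>Transfer to the given algebra\<close>

lemma blinfun_of_eq_iff: "blinfun_of S = blinfun_of T \<longleftrightarrow> S = T"
  by (rule blinfun_of_inject)

lemma cbounded_cases:
  assumes "X \<in> cbounded"
  obtains T where "X = blinfun_of T"
  using assms by (metis cop_of_inverse)

lemma blinfun_of_simps:
  "blinfun_of S o\<^sub>L blinfun_of T = blinfun_of (S * T)" "blinfun_of S + blinfun_of T = blinfun_of (S + T)"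
  "blinfun_of S - blinfun_of T = blinfun_of (S - T)" "c *\<^sub>C blinfun_of S = blinfun_of (c *\<^sub>C S)"
  "adj (blinfun_of S) = blinfun_of (star S)" "id_blinfun = blinfun_of 1" "0 = blinfun_of 0"
  by (simp_all add: times_cop.rep_eq plus_cop.rep_eq minus_cop.rep_eq scaleC_cop.rep_eq
      star.rep_eq one_cop.rep_eq zero_cop.rep_eq)

lemma positive_op_blinfun_of: "positive_op (blinfun_of T) \<longleftrightarrow> pos T"
  using blinfun_of[of T] by (simp add: positive_op_def pos_def app.rep_eq)

lemma spectrum_blinfun_of: "spectrum (blinfun_of T) = spec T"
proof -
  have "(\<exists>S\<in>cbounded. S o\<^sub>L (blinfun_of T - z *\<^sub>C id_blinfun) = id_blinfun \<and>
      (blinfun_of T - z *\<^sub>C id_blinfun) o\<^sub>L S = id_blinfun) \<longleftrightarrow>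
    (\<exists>S. S * (T - z *\<^sub>C 1) = 1 \<and> (T - z *\<^sub>C 1) * S = 1)" for z
  proof
    assume "\<exists>S\<in>cbounded. S o\<^sub>L (blinfun_of T - z *\<^sub>C id_blinfun) = id_blinfun \<and>
      (blinfun_of T - z *\<^sub>C id_blinfun) o\<^sub>L S = id_blinfun"
    then obtain S where S: "S \<in> cbounded" "S o\<^sub>L (blinfun_of T - z *\<^sub>C id_blinfun) = id_blinfun"
      "(blinfun_of T - z *\<^sub>C id_blinfun) o\<^sub>L S = id_blinfun" by blast
    obtain S' where "S = blinfun_of S'" using S(1) by (rule cbounded_cases)
    then show "\<exists>S. S * (T - z *\<^sub>C 1) = 1 \<and> (T - z *\<^sub>C 1) * S = 1"
      using S(2,3) by (auto simp: blinfun_of_simps blinfun_of_eq_iff)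
  next
    assume "\<exists>S. S * (T - z *\<^sub>C 1) = 1 \<and> (T - z *\<^sub>C 1) * S = 1"
    then obtain S where "S * (T - z *\<^sub>C 1) = 1" "(T - z *\<^sub>C 1) * S = 1" by blast
    then show "\<exists>S\<in>cbounded. S o\<^sub>L (blinfun_of T - z *\<^sub>C id_blinfun) = id_blinfun \<and>
      (blinfun_of T - z *\<^sub>C id_blinfun) o\<^sub>L S = id_blinfun"
      by (intro bexI[of _ "blinfun_of S"] blinfun_of) (simp add: blinfun_of_simps)
  qed
  then show ?thesis unfolding spectrum_def spec_def by blast
qed

lemma commutant_blinfun_of: "commutant (blinfun_of ` S) = blinfun_of ` cmt S"
proof (intro equalityI subsetI)
  fix X assume X: "X \<in> commutant (blinfun_of ` S)"
  then have "X \<in> cbounded" by (simp add: commutant_def)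
  then obtain T where T: "X = blinfun_of T" by (rule cbounded_cases)
  then show "X \<in> blinfun_of ` cmt S"
    using X by (auto simp: commutant_def cmt_def blinfun_of_simps blinfun_of_eq_iff)
next
  fix X assume "X \<in> blinfun_of ` cmt S"
  then show "X \<in> commutant (blinfun_of ` S)"
    using blinfun_of by (auto simp: commutant_def cmt_def blinfun_of_simps)
qed

text \<open>\<open>blinfun_of\<close> is isometric and its domain is complete, so a limit of images
  is the image of a limit.\<close>

lemma closure_blinfun_of: "closure (blinfun_of ` S) = blinfun_of ` closure S"
proof (intro equalityI subsetI)
  have dist: "dist (blinfun_of S) (blinfun_of T) = dist S T" for S T :: "'a cop"
    by (simp add: dist_norm norm_cop.rep_eq minus_cop.rep_eq)
  fix X
  show "X \<in> blinfun_of ` closure S" if X: "X \<in> closure (blinfun_of ` S)"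
  proof -
    obtain f where f: "\<And>n. f n \<in> blinfun_of ` S" "f \<longlonglongrightarrow> X"
      using X unfolding closure_sequential by blast
    have "\<exists>T. T \<in> S \<and> f n = blinfun_of T" for n using f(1)[of n] by blast
    then obtain g where g: "\<And>n. g n \<in> S" "\<And>n. f n = blinfun_of (g n)"
      by metis
    have "Cauchy g"
      using LIMSEQ_imp_Cauchy[OF f(2)] by (simp add: Cauchy_def g(2) dist)
    then obtain L where L: "g \<longlonglongrightarrow> L"
      using Cauchy_convergent_iff convergent_def by blast
    then have "f \<longlonglongrightarrow> blinfun_of L" by (simp add: tendsto_iff g(2) dist)
    then have "X = blinfun_of L" using f(2) LIMSEQ_unique by blast
    moreover have "L \<in> closure S"
      unfolding closure_sequential using L g(1) by (intro exI[of _ g] conjI allI)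
    ultimately show ?thesis by blast
  qed
  show "X \<in> closure (blinfun_of ` S)" if "X \<in> blinfun_of ` closure S"
    using that by (fastforce simp: closure_approachable dist)
qed

text \<open>For a self-adjoint \<open>T\<close> in \<open>M \<inter> cmt A\<close>, the bicommutant
  of \<open>A\<close> and \<open>T\<close> relative to \<open>M\<close> is an abelian star
  subalgebra, so maximality puts \<open>T\<close> into \<open>A\<close>. The general case splits
  into real and imaginary part.\<close>

lemma masa_eq_relative_commutant:
  assumes vM: "vna M" and m: "masa (blinfun_of ` M) (blinfun_of ` A)"
  shows "A \<subseteq> M" "A = M \<inter> cmt A" "\<And>X. X \<in> A \<Longrightarrow> star X \<in> A"
proof -
  have mem: "blinfun_of X \<in> blinfun_of ` B \<longleftrightarrow> X \<in> B" for X :: "'a cop" and B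
    by (auto simp: blinfun_of_eq_iff)
  have sub: "abelian_star_subalgebra (blinfun_of ` M) (blinfun_of ` B) \<longleftrightarrow> B \<subseteq> M \<and> 0 \<in> B \<and>
     (\<forall>X\<in>B. \<forall>Y\<in>B. X + Y \<in> B \<and> X * Y \<in> B \<and> X * Y = Y * X) \<and>
     (\<forall>X\<in>B. star X \<in> B \<and> (\<forall>c. c *\<^sub>C X \<in> B))" for B
  proof -
    have "blinfun_of ` B \<subseteq> blinfun_of ` M \<longleftrightarrow> B \<subseteq> M"
      by (simp add: inj_image_subset_iff inj_def blinfun_of_eq_iff)
    then show ?thesis
      by (simp add: abelian_star_subalgebra_def ball_simps blinfun_of_simps blinfun_of_eq_iff mem)
  qed
  have A: "A \<subseteq> M" "\<And>X Y. X \<in> A \<Longrightarrow> Y \<in> A \<Longrightarrow> X + Y \<in> A" "\<And>X Y. X \<in> A \<Longrightarrow> Y \<in> A \<Longrightarrow> X * Y = Y * X"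
    "\<And>X. X \<in> A \<Longrightarrow> star X \<in> A" "\<And>X c. X \<in> A \<Longrightarrow> c *\<^sub>C X \<in> A"
    using m sub[of A] unfolding masa_def by blast+
  show "A \<subseteq> M" "\<And>X. X \<in> A \<Longrightarrow> star X \<in> A" by (fact A)+
  have max: "B = A" if "abelian_star_subalgebra (blinfun_of ` M) (blinfun_of ` B)" "A \<subseteq> B" for B
  proof -
    have "blinfun_of ` B = blinfun_of ` A"
      using m that unfolding masa_def by (meson image_mono)
    then show ?thesis by (simp add: inj_image_eq_iff inj_def blinfun_of_eq_iff)
  qed
  have sa: "T \<in> A" if T: "T \<in> M" "T \<in> cmt A" "star T = T" for T
  proof -
    define S where "S = insert T A"
    define C where "C = M \<inter> cmt S"
    \<comment> \<open>A relative bicommutant is closed under the operations at once, unlike an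
      explicit algebra of polynomials in \<open>T\<close>. From \<open>S \<subseteq> C\<close>
      follows \<open>B \<subseteq> C\<close>, and with it commutativity of \<open>B\<close>.\<close>
    define B where "B = M \<inter> cmt C"
    have "S \<subseteq> cmt S" using T A(3) by (auto simp: S_def cmt_def)
    then have SC: "S \<subseteq> C" using T A(1) by (auto simp: C_def S_def)
    have SB: "S \<subseteq> B" using T A(1) by (auto simp: B_def C_def S_def cmt_def)
    have BC: "B \<subseteq> C" using cmt_anti[OF SC] by (auto simp: B_def C_def)
    have Sstar: "star X \<in> S" if "X \<in> S" for X using that T A(4) by (auto simp: S_def)
    have Cstar: "star X \<in> C" if "X \<in> C" for X
      using that star_cmt[OF Sstar] vna_star[OF vM] by (auto simp: C_def)
    have "abelian_star_subalgebra (blinfun_of ` M) (blinfun_of ` B)"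
      unfolding sub
    proof (intro conjI ballI allI)
      fix X Y assume XY: "X \<in> B" "Y \<in> B"
      show "X + Y \<in> B" "X * Y \<in> B"
        using XY by (auto simp: B_def intro: cmt_add cmt_mult vna_add[OF vM] vna_mult[OF vM])
      have "Y \<in> C" using XY BC by blast
      then show "X * Y = Y * X" using XY by (simp add: B_def cmt_def)
    next
      fix X c assume X: "X \<in> B"
      show "star X \<in> B" using X star_cmt[OF Cstar] vna_star[OF vM] by (auto simp: B_def)
      show "c *\<^sub>C X \<in> B" using X by (auto simp: B_def intro: cmt_scaleC vna_scaleC[OF vM])
    qed (auto simp: B_def cmt_0 vna_0[OF vM])
    then have "B = A" using SB by (intro max) (auto simp: S_def)
    then show ?thesis using SB by (auto simp: S_def)
  qed
  show "A = M \<inter> cmt A"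
  proof
    show "A \<subseteq> M \<inter> cmt A" using A(1,3) by (auto simp: cmt_def)
    show "M \<inter> cmt A \<subseteq> A"
    proof
      fix T assume T: "T \<in> M \<inter> cmt A"
      have sT: "star T \<in> M \<inter> cmt A" using T star_cmt[OF A(4)] vna_star[OF vM] by blast
      have "(1/2) *\<^sub>R (T + star T) \<in> A"
        using T sT by (intro sa) (auto simp: add.commute intro!: cmt_scaleR cmt_add vna_scaleR[OF vM] vna_add[OF vM])
      moreover have "(- \<i> / 2) *\<^sub>C (T - star T) \<in> A"
        using T sT by (intro sa)
          (auto simp: scaleC_cop_simps intro!: cmt_scaleC cmt_diff vna_scaleC[OF vM] vna_diff[OF vM])
      ultimately show "T \<in> A"
        by (subst scaleC_decomp) (rule A(2), assumption, rule A(5), assumption)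
    qed
  qed
qed

text \<open>An increasing sequence of projections has a directed range, and its strong limit is the
  least upper bound in the operator order because the quadratic forms converge. Normality of the
  state then applies.\<close>

lemma normal_state_increasing_proj:
  assumes st: "normal_state_on (blinfun_of ` M) \<tau>" and f: "\<And>n. f n \<in> M" "\<And>n. proj (f n)" "\<And>n. f n * f (Suc n) = f n"
    and P: "P \<in> M" "proj P" "\<And>x. (\<lambda>n. f n \<cdot> x) \<longlonglongrightarrow> P \<cdot> x" and t: "\<And>n. Re (\<tau> (blinfun_of (f n))) \<le> t"
  shows "Re (\<tau> (blinfun_of P)) \<le> t"
proof -
  define S where "S = range (\<lambda>n. blinfun_of (f n))"
  have op_le_iff: "op_le (blinfun_of X) (blinfun_of Y) \<longleftrightarrow> pos (Y - X)" for X Y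
    by (simp add: op_le_def blinfun_of_simps positive_op_blinfun_of)
  have le: "pos (f n - f m)" if "m \<le> n" for m n
  proof -
    have "f m * f n = f m" by (rule increasing_proj_le[of f, OF f(2,3) that])
    from arg_cong[OF this, of star] have "f n * f m = f m" using f(2) by (simp add: proj_def)
    then show ?thesis by (intro pos_proj proj_le(2) f(2))
  qed
  have lim: "(\<lambda>n. Re (cinner (f n \<cdot> x) x)) \<longlonglongrightarrow> Re (cinner (P \<cdot> x) x)" for x
    by (intro tendsto_Re tendsto_cinner P(3) tendsto_const)
  have ub: "pos (P - f n)" for n
    unfolding pos_iff_self_adjoint
  proof (intro conjI allI)
    show "star (P - f n) = P - f n" using P(2) f(2) by (simp add: proj_def)
    fix x
    have "Re (cinner (f n \<cdot> x) x) \<le> Re (cinner (f k \<cdot> x) x)" if "n \<le> k" for k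
      using le[OF that] by (simp add: pos_iff_self_adjoint cinner_diff_left)
    then have "Re (cinner (f n \<cdot> x) x) \<le> Re (cinner (P \<cdot> x) x)"
      by (intro LIMSEQ_le_const[OF lim]) blast
    then show "0 \<le> Re (cinner ((P - f n) \<cdot> x) x)" by (simp add: cinner_diff_left)
  qed
  have lub: "pos (R - P)" if R: "\<And>n. pos (R - f n)" for R
    unfolding pos_iff_self_adjoint
  proof (intro conjI allI)
    have "star (R - f 0) = R - f 0" by (rule pos_self_adjoint[OF R])
    then have "star R = R" using f(2)[of 0] by (simp add: proj_def)
    then show "star (R - P) = R - P" using P(2) by (simp add: proj_def)
    fix x
    have "Re (cinner (f k \<cdot> x) x) \<le> Re (cinner (R \<cdot> x) x)" for k
      using R[of k] by (simp add: pos_iff_self_adjoint cinner_diff_left)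
    then have "Re (cinner (P \<cdot> x) x) \<le> Re (cinner (R \<cdot> x) x)"
      by (intro LIMSEQ_le_const2[OF lim]) blast
    then show "0 \<le> Re (cinner ((R - P) \<cdot> x) x)" by (simp add: cinner_diff_left)
  qed
  have "directed_sa (blinfun_of ` M) S"
    unfolding directed_sa_def
  proof (intro conjI ballI)
    show "S \<noteq> {}" "S \<subseteq> blinfun_of ` M" using f(1) by (auto simp: S_def)
    fix X assume "X \<in> S"
    then obtain m where m: "X = blinfun_of (f m)" by (auto simp: S_def)
    show "adj X = X" using f(2)[of m] by (simp add: m blinfun_of_simps proj_def)
    fix Y assume "Y \<in> S"
    then obtain n where n: "Y = blinfun_of (f n)" by (auto simp: S_def)
    show "\<exists>Z\<in>S. op_le X Z \<and> op_le Y Z"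
      using le[of m "max m n"] le[of n "max m n"]
      by (intro bexI[of _ "blinfun_of (f (max m n))"]) (auto simp: m n S_def op_le_iff)
  qed
  moreover have "op_lub (blinfun_of ` M) S (blinfun_of P)"
    unfolding op_lub_def using P(1) ub lub by (auto simp: S_def op_le_iff)
  ultimately have "Re (\<tau> (blinfun_of P)) = (SUP X\<in>S. Re (\<tau> X))"
    using st by (auto simp: normal_state_on_def)
  also have "\<dots> \<le> t"
    using t by (intro cSUP_least) (auto simp: S_def)
  finally show ?thesis .
qed

theorem theorem1p3:
  fixes M A :: "('h :: complex_hilbert \<Rightarrow>\<^sub>L 'h) set"
    and \<tau> :: "('h \<Rightarrow>\<^sub>L 'h) \<Rightarrow> complex"
    and E :: "('h \<Rightarrow>\<^sub>L 'h) \<Rightarrow> ('h \<Rightarrow>\<^sub>L 'h)"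
    and N :: "'h \<Rightarrow>\<^sub>L 'h"
  assumes "type_II1_factor M"
    and "faithful_normal_tracial_state M \<tau>"
    and "masa M A"
    and "normal_conditional_expectation M A E"
    and "trace_preserving M \<tau> E"
    and "N \<in> M"
    and "normal_op N"
    and "card (spectrum N) = 3"
    and "\<not> collinear (spectrum N)"
  shows "closure (expected_orbit M E N) =
    {X \<in> A. \<tau> X = \<tau> N \<and> spectrum X \<subseteq> closure (convex hull (spectrum N))}"
proof -
  \<comment> \<open>The data are pulled back along \<open>blinfun_of\<close>. Since \<open>M\<close>
    and \<open>A\<close> consist of complex-linear operators, nothing is lost.\<close>
  define M' where "M' = {T. blinfun_of T \<in> M}"
  define A' where "A' = {T. blinfun_of T \<in> A}"
  define \<tau>' where "\<tau>' T = \<tau> (blinfun_of T)" for T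
  \<comment> \<open>Off \<open>M'\<close> the value is whatever \<open>cop_of\<close> returns; it is
    meaningful on \<open>M'\<close>, where \<open>E\<close> yields elements of
    \<open>A\<close>.\<close>
  define E' where "E' T = cop_of (E (blinfun_of T))" for T
  have vnM: "von_neumann_algebra M" and fac: "factor M" and noab: "\<And>P. abelian_projection M P \<Longrightarrow> P = 0"
    using assms(1) by (auto simp: type_II1_factor_def factor_def)
  have Mcb: "M \<subseteq> cbounded" using vnM by (simp add: von_neumann_algebra_def)
  have AM: "A \<subseteq> M" using assms(3) by (simp add: masa_def abelian_star_subalgebra_def)
  have M: "M = blinfun_of ` M'" using Mcb by (auto simp: M'_def elim!: cbounded_cases)
  have A: "A = blinfun_of ` A'" using Mcb AM by (auto simp: A'_def elim!: cbounded_cases)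
  have vna: "vna M'"
    using vnM unfolding von_neumann_algebra_def M commutant_blinfun_of vna_def
    by (auto simp: inj_image_eq_iff inj_def blinfun_of_eq_iff blinfun_of_simps)
  have masa: "masa (blinfun_of ` M') (blinfun_of ` A')" using assms(3) unfolding M A .
  have st: "normal_state_on M \<tau>" and trc: "\<And>X Y. X \<in> M \<Longrightarrow> Y \<in> M \<Longrightarrow> \<tau> (X o\<^sub>L Y) = \<tau> (Y o\<^sub>L X)"
    and fth: "\<And>X. X \<in> M \<Longrightarrow> \<tau> (adj X o\<^sub>L X) = 0 \<Longrightarrow> X = 0"
    using assms(2) by (auto simp: faithful_normal_tracial_state_def)
  have lin: "complex_linear_on M \<tau>" and tpos: "\<And>X. X \<in> M \<Longrightarrow> positive_op X \<Longrightarrow> \<tau> X \<in> \<real>\<^sub>\<ge>\<^sub>0"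
    and t1: "\<tau> id_blinfun = 1"
    using st by (auto simp: normal_state_on_def state_on_def)
  have ce: "conditional_expectation M A E" using assms(4) by (simp add: normal_conditional_expectation_def)
  have Elin: "complex_linear_on M E" and EA: "\<And>X. X \<in> M \<Longrightarrow> E X \<in> A"
    and Epos: "\<And>X. X \<in> M \<Longrightarrow> positive_op X \<Longrightarrow> positive_op (E X)" and Eid: "\<And>X. X \<in> A \<Longrightarrow> E X = X"
    and Emod: "\<And>X Y Z. X \<in> M \<Longrightarrow> Y \<in> A \<Longrightarrow> Z \<in> A \<Longrightarrow> E (Y o\<^sub>L X o\<^sub>L Z) = Y o\<^sub>L E X o\<^sub>L Z"
    using ce by (auto simp: conditional_expectation_def)
  have mem: "blinfun_of T \<in> M \<longleftrightarrow> T \<in> M'" "blinfun_of T \<in> A \<longleftrightarrow> T \<in> A'" for T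
    by (auto simp: M'_def A'_def)
  have E': "blinfun_of (E' T) = E (blinfun_of T)" if "T \<in> M'" for T
    unfolding E'_def using EA[of "blinfun_of T"] that AM Mcb by (intro cop_of_inverse) (auto simp: M'_def)
  interpret masa_factor M' \<tau>' A' E'
  proof unfold_locales
    show "vna M'" by (fact vna)
    show "\<exists>c. X = c *\<^sub>C 1" if "X \<in> M'" "X \<in> cmt M'" for X
    proof -
      have "blinfun_of X \<in> M \<inter> commutant M" using that by (simp add: M commutant_blinfun_of)
      then have "blinfun_of X \<in> range (\<lambda>c. c *\<^sub>C id_blinfun)"
        using fac unfolding factor_def by blast
      then show ?thesis by (auto simp: blinfun_of_simps blinfun_of_eq_iff)
    qed
    show "\<tau>' (X + Y) = \<tau>' X + \<tau>' Y" if "X \<in> M'" "Y \<in> M'" for X Y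
      using lin that by (simp add: \<tau>'_def complex_linear_on_def mem flip: blinfun_of_simps)
    show "\<tau>' (c *\<^sub>C X) = c * \<tau>' X" if "X \<in> M'" for X c
      using lin that by (simp add: \<tau>'_def complex_linear_on_def mem scaleC_complex_def flip: blinfun_of_simps)
    show "\<tau>' X \<in> \<real>\<^sub>\<ge>\<^sub>0" if "X \<in> M'" "pos X" for X
      using tpos that by (simp add: \<tau>'_def mem positive_op_blinfun_of)
    show "\<tau>' 1 = 1" using t1 by (simp add: \<tau>'_def blinfun_of_simps)
    show "\<tau>' (X * Y) = \<tau>' (Y * X)" if "X \<in> M'" "Y \<in> M'" for X Y
      using trc[of "blinfun_of X" "blinfun_of Y"] that by (simp add: \<tau>'_def mem blinfun_of_simps)
    show "X = 0" if "X \<in> M'" "\<tau>' (star X * X) = 0" for X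
      using fth[of "blinfun_of X"] that by (simp add: \<tau>'_def mem blinfun_of_simps blinfun_of_eq_iff)
    show "Re (\<tau>' P) \<le> t" if "\<And>n. f n \<in> M'" "\<And>n. proj (f n)" "\<And>n. f n * f (Suc n) = f n" "P \<in> M'" "proj P"
      "\<And>x. (\<lambda>n. f n \<cdot> x) \<longlonglongrightarrow> P \<cdot> x" "\<And>n. Re (\<tau>' (f n)) \<le> t" for f P t
      using normal_state_increasing_proj[OF st[unfolded M], of f P t] that by (simp add: \<tau>'_def)
    show "A' \<subseteq> M'" "A' = M' \<inter> cmt A'" "X \<in> A' \<Longrightarrow> star X \<in> A'" for X
      using masa_eq_relative_commutant[OF vna masa] by blast+
    show "p = 0" if p: "p \<in> M'" "proj p"
      "\<And>X Y. X \<in> M' \<Longrightarrow> Y \<in> M' \<Longrightarrow> (p * X * p) * (p * Y * p) = (p * Y * p) * (p * X * p)" for p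
    proof -
      have "abelian_projection M (blinfun_of p)"
        using p unfolding abelian_projection_def projection_op_def M proj_def
        by (simp add: ball_simps blinfun_of_simps blinfun_of_eq_iff)
      then have "blinfun_of p = 0" by (rule noab)
      then show ?thesis by (simp add: blinfun_of_simps blinfun_of_eq_iff)
    qed
    show "E' (X + Y) = E' X + E' Y" if "X \<in> M'" "Y \<in> M'" for X Y
      using Elin that vna_add[OF vna that]
      by (simp add: E' complex_linear_on_def mem flip: blinfun_of_eq_iff blinfun_of_simps)
    show "E' (c *\<^sub>C X) = c *\<^sub>C E' X" if "X \<in> M'" for X c
      using Elin that vna_scaleC[OF vna that]
      by (simp add: E' complex_linear_on_def mem flip: blinfun_of_eq_iff blinfun_of_simps)
    show "E' X \<in> A'" if "X \<in> M'" for X using EA that by (simp add: E' flip: mem)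
    show "pos (E' X)" if "X \<in> M'" "pos X" for X
      using Epos that by (simp add: E' mem flip: positive_op_blinfun_of)
    show "E' X = X" if "X \<in> A'" for X
      using Eid[of "blinfun_of X"] that by (simp add: E'_def mem blinfun_of_inverse)
    show "E' (Y * X * Z) = Y * E' X * Z" if "X \<in> M'" "Y \<in> A'" "Z \<in> A'" for X Y Z
    proof -
      have "Y \<in> M'" "Z \<in> M'" using that AM by (auto simp: A'_def M'_def)
      then have "Y * X * Z \<in> M'" using that by (intro vna_mult[OF vna])
      then show ?thesis
        using Emod[of "blinfun_of X" "blinfun_of Y" "blinfun_of Z"] that
        by (simp add: E' mem flip: blinfun_of_eq_iff blinfun_of_simps)
    qed
    show "\<tau>' (E' X) = \<tau>' X" if "X \<in> M'" for X
      using assms(5) that by (simp add: \<tau>'_def E' trace_preserving_def mem)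
  qed
  obtain N' where N': "N = blinfun_of N'" "N' \<in> M'" using assms(6) M by blast
  have orb: "expected_orbit M E N = blinfun_of ` orbit N'"
  proof -
    define V where "V = {U \<in> M'. star U * U = 1 \<and> U * star U = 1}"
    have "expected_orbit M E N = (\<lambda>U. E (adj U o\<^sub>L N o\<^sub>L U)) ` {U \<in> blinfun_of ` M'. unitary_op U}"
      by (auto simp: expected_orbit_def M)
    also have "{U \<in> blinfun_of ` M'. unitary_op U} = blinfun_of ` V"
      by (auto simp: V_def unitary_op_def blinfun_of_simps blinfun_of_eq_iff)
    also have "(\<lambda>U. E (adj U o\<^sub>L N o\<^sub>L U)) ` blinfun_of ` V = (\<lambda>U. blinfun_of (E' (star U * N' * U))) ` V"
      unfolding image_image
    proof (rule image_cong[OF refl])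
      fix U assume "U \<in> V"
      then have "star U * N' * U \<in> M'" using N'(2) by (intro M_closed) (simp_all add: V_def)
      then show "E (adj (blinfun_of U) o\<^sub>L N o\<^sub>L blinfun_of U) = blinfun_of (E' (star U * N' * U))"
        by (simp only: N'(1) blinfun_of_simps E')
    qed
    also have "\<dots> = blinfun_of ` orbit N'" by (auto simp: V_def orbit_def)
    finally show ?thesis .
  qed
  have "star N' * N' = N' * star N'"
    using assms(7) by (simp add: normal_op_def N'(1) blinfun_of_simps blinfun_of_eq_iff)
  then have "closure (orbit N') = {Y \<in> A'. \<tau>' Y = \<tau>' N' \<and> spec Y \<subseteq> closure (convex hull spec N')}"
    using assms(8,9) N' by (intro closure_orbit) (auto simp: spectrum_blinfun_of)
  then have "closure (expected_orbit M E N)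
      = blinfun_of ` {Y \<in> A'. \<tau>' Y = \<tau>' N' \<and> spec Y \<subseteq> closure (convex hull spec N')}"
    by (simp add: orb closure_blinfun_of)
  also have "\<dots> = {X \<in> A. \<tau> X = \<tau> N \<and> spectrum X \<subseteq> closure (convex hull (spectrum N))}"
    unfolding A N'(1) spectrum_blinfun_of \<tau>'_def by (auto simp: spectrum_blinfun_of)
  finally show ?thesis .
qed

end
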